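(* Let $U=\{u_1,\dots,u_n\}$ be a known fully ordered universe and $S\subseteq U$ an unknown set of size $w$. Consider set size approximation algorithms that access $S$ only through interval subset samples. Then: (1) Any non-adaptive set size approximation algorithm that performs only interval samples requires $\Omega(\min(n/w,\sqrt{w}))$ such samples. (2) There exists a non-adaptive set size approximation algorithm that uses $O(\min(n/w,\sqrt{w})/\epsilon^2)$ interval samples. The probability of using more samples decreases exponentially with the number of samples. (3) There exists an adaptive set size approximation algorithm that uses $\tilde{O}(\log(w)^4/\epsilon^2)$ interval samples. The probability of using more samples decreases exponentially with the number of samples.
   Context: An interval is a subset of $U$ of the form $\{u_i,u_{i+1},\dots,u_j\}$ with $i\le j$. An interval (subset) sample specifies an interval $T$; if $T\cap S\neq\emptyset$ it returns an element of $T\cap S$ selected uniformly at random (independently of other samples), and otherwise it returns an indication that $T\cap S$ is empty. A set size approximation algorithm is given $\epsilon\in(0,1]$ and sample access to $S$, and for every $S\subseteq U$ must output $\widehat{w}$ with $\frac{1}{1+\epsilon}|S|\le\widehat{w}\le(1+\epsilon)|S|$ with probability at least $2/3$ (over its coin tosses and the samples). A non-adaptive algorithm cannot choose its next sampled subset based on previous answers, but may decide when to stop based on the information obtained. The notation $\tilde{O}(f)$ hides factors logarithmic in $f$ (e.g. $\tilde{O}(\log^4 w)$ may hide a $\log\log w$ factor). Lower bounds are for constant $\epsilon$. *)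

theory Defs
  imports "HOL-Probability.Probability"
begin

text \<open>The universe is identified with \<open>{1..n}\<close> (the element \<open>u\<^sub>i\<close> with its index \<open>i\<close>), and a pair
  \<open>(i, j)\<close> with \<open>1 \<le> i \<le> j \<le> n\<close> stands for the interval \<open>{i..j}\<close>.
  The answer \<open>None\<close> indicates that the sampled interval does not meet \<open>S\<close>.\<close>

type_synonym answer = "nat option"

definition interval_sample :: "nat set \<Rightarrow> nat \<times> nat \<Rightarrow> answer pmf" where
  "interval_sample S T =
     (let X = {fst T..snd T} \<inter> S
      in if X = {} then return_pmf None else map_pmf Some (pmf_of_set X))"

type_synonym coins = "nat \<Rightarrow> bool"

definition coin_space :: "coins measure" where
  "coin_space = PiM UNIV (\<lambda>_. measure_pmf (bernoulli_pmf (1/2)))"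

text \<open>An algorithm acts on its coin tosses and the list of answers received so far, oldest first:
  \<open>query\<close> gives the next interval to sample, with \<open>None\<close> meaning that the algorithm stops, in which
  case its output is given by \<open>estimate\<close>.
  The earlier queries are determined by these arguments, so they need not be recorded.\<close>

record algo =
  query :: "coins \<Rightarrow> answer list \<Rightarrow> (nat \<times> nat) option"
  estimate :: "coins \<Rightarrow> answer list \<Rightarrow> real"

definition interval_algorithm :: "nat \<Rightarrow> algo \<Rightarrow> bool" where
  "interval_algorithm n A \<longleftrightarrow>
     (\<forall>r h i j. query A r h = Some (i, j) \<longrightarrow> 1 \<le> i \<and> i \<le> j \<and> j \<le> n) \<and>
     (\<forall>h. (\<lambda>r. query A r h) \<in> measurable coin_space (count_space UNIV)) \<and>
     (\<forall>h. (\<lambda>r. estimate A r h) \<in> borel_measurable coin_space)"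

text \<open>The next interval may depend on the coin tosses and on the number of samples made so far, but
  not on the answers. The decision to stop and the output are unrestricted.\<close>

definition nonadaptive :: "algo \<Rightarrow> bool" where
  "nonadaptive A \<longleftrightarrow> (\<exists>q. \<forall>r h T. query A r h = Some T \<longrightarrow> T = q r (length h))"

text \<open>Distribution of the list of answers after at most \<open>k\<close> samples, for fixed coin tosses \<open>r\<close>.\<close>

primrec run :: "algo \<Rightarrow> nat set \<Rightarrow> coins \<Rightarrow> nat \<Rightarrow> answer list pmf" where
  "run A S r 0 = return_pmf []"
| "run A S r (Suc k) =
     bind_pmf (run A S r k)
       (\<lambda>h. case query A r h of
              None \<Rightarrow> return_pmf h
            | Some T \<Rightarrow> map_pmf (\<lambda>a. h @ [a]) (interval_sample S T))"

text \<open>The probability that more than \<open>m\<close> samples are made, i.e. that the algorithm has not stopped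
  after \<open>m\<close> of them.\<close>

definition prob_more_samples :: "algo \<Rightarrow> nat set \<Rightarrow> nat \<Rightarrow> real" where
  "prob_more_samples A S m =
     (\<integral>r. measure_pmf.prob (run A S r m) {h. query A r h \<noteq> None} \<partial>coin_space)"

text \<open>The probability of stopping with an output satisfying \<open>P\<close>. The events of having done so within
  \<open>k\<close> samples increase with \<open>k\<close>, so the probability of their union is the supremum.\<close>

definition prob_output :: "algo \<Rightarrow> nat set \<Rightarrow> (real \<Rightarrow> bool) \<Rightarrow> real" where
  "prob_output A S P =
     (SUP k. \<integral>r. measure_pmf.prob (run A S r k) {h. query A r h = None \<and> P (estimate A r h)}
        \<partial>coin_space)"

definition size_approximation :: "nat \<Rightarrow> real \<Rightarrow> algo \<Rightarrow> bool" where
  "size_approximation n \<epsilon> A \<longleftrightarrow>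
     interval_algorithm n A \<and>
     (\<forall>S\<subseteq>{1..n}.
        prob_output A S (\<lambda>x. 1 / (1 + \<epsilon>) * real (card S) \<le> x \<and> x \<le> (1 + \<epsilon>) * real (card S)) \<ge> 2/3)"

text \<open>On input \<open>S\<close> the algorithm uses \<open>b\<close> samples, up to a constant factor absorbed in \<open>b\<close>, and the
  probability of using more decreases exponentially, measured in units of \<open>b\<close>.\<close>

definition uses_samples :: "algo \<Rightarrow> nat set \<Rightarrow> real \<Rightarrow> bool" where
  "uses_samples A S b \<longleftrightarrow>
     (\<forall>m::nat. real m \<ge> b \<longrightarrow> prob_more_samples A S m \<le> exp (- (real m / b)))"

text \<open>For \<open>1 \<le> w \<le> n\<close> the minimum is at least 1, so the outer maximum only matters for \<open>w = 0\<close>,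
  where one sample is still needed.\<close>

definition nonadaptive_bound :: "nat \<Rightarrow> nat \<Rightarrow> real \<Rightarrow> real" where
  "nonadaptive_bound n w \<epsilon> = max 1 (min (real n / real w) (sqrt (real w))) / \<epsilon>\<^sup>2"

text \<open>The maximum only matters for \<open>w \<le> 1\<close>, where the logarithm is not positive.\<close>

definition adaptive_bound :: "nat \<Rightarrow> real \<Rightarrow> real" where
  "adaptive_bound w \<epsilon> = (log 2 (max 2 (real w))) ^ 4 / \<epsilon>\<^sup>2"

end

theory Submission
  imports Defs
begin

text \<open>
  Lower bound: let \<open>S\<close> consist of one random element from each of \<open>w\<close> groups of five that make up a
  random block of \<open>5 w\<close> consecutive indices, and compare it with the whole block.  A fixed query cuts at
  most two of the about \<open>n / w\<close> blocks; the answers to all other queries are equally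
  distributed for both sets as long as no group is hit twice, which takes about \<open>sqrt w\<close> samples.

  Non-adaptive algorithm: alternate between sampling the universe, where a sample is a repetition with
  probability \<open>d / w\<close> once \<open>d\<close> elements have been seen, and testing a random single index, which hits
  with probability proportional to \<open>w\<close>.  Stop when either kind of event has occurred about
  \<open>24 / \<epsilon>\<^sup>2\<close> times.  The number of events minus the sum of their conditional probabilities is a martingale,
  and that sum is a known multiple of \<open>w\<close> or of \<open>1 / w\<close>.

  Adaptive algorithm: sample \<open>{1..n}\<close>, then the indices below the sampled element, and so on until the
  answer is empty.  Such a walk makes \<open>harm w\<close> steps on average, with variance at most
  \<open>harm w\<close>, and an approximation of \<open>harm w\<close> up to an additive \<open>\<epsilon> / 2\<close> determines \<open>w\<close> up to a factor
  \<open>1 + \<epsilon>\<close>.  Forty walks give an estimate of the number of further walks to average.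

  All probabilities of the two algorithms are bounded by exhibiting nonnegative supermartingales.
\<close>

section \<open>Expectations over runs and coin tosses\<close>

text \<open>The coin tosses are one infinite sequence fixed before the run, whereas a
  supermartingale wants fresh randomness at every step. Both algorithms are therefore state machines
  that read a new block of coins before each sample; histories of bounded length then depend on
  finitely many coins, which also settles measurability. Each algorithm carries two potentials: a
  normalised squared deviation, at least 1 wherever a wrong output is given and at most 1/3 at the
  start, and an exponential one that is huge if the algorithm is still running after many samples.

  Groups have five elements because outputs within a factor 1 + \<epsilon> \<le> 2 of w and of 5 w
  cannot coincide: 2 * 2 < 5. As stopping may depend on the answers, the two kinds of hidden sets
  are compared on whole histories.

  A walk makes \<open>harm w\<close> steps on average because the number of elements below the
  sampled one is uniform, and the recursion m(N) = 1 + average of m(i) over i < N is solved by the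
  harmonic numbers. As these grow like a logarithm, an additive error in them is a multiplicative
  error in w.\<close>

lemma finite_set_pmf_interval_sample: "finite (set_pmf (interval_sample S T))"
  by (auto simp: interval_sample_def Let_def)

lemma set_pmf_interval_sample:
  "set_pmf (interval_sample S T) =
     (let X = {fst T..snd T} \<inter> S in if X = {} then {None} else Some ` X)"
  by (auto simp: interval_sample_def Let_def)

lemma expectation_interval_sample:
  fixes f :: "answer \<Rightarrow> real"
  shows "measure_pmf.expectation (interval_sample S (i, j)) f =
    (if {i..j} \<inter> S = {} then f None else (\<Sum>x\<in>{i..j} \<inter> S. f (Some x)) / card ({i..j} \<inter> S))"
  by (auto simp: interval_sample_def integral_pmf_of_set)

lemma expectation_bind_finite:
  fixes f :: "'b \<Rightarrow> real"
  assumes "finite (set_pmf p)" "\<And>x. x \<in> set_pmf p \<Longrightarrow> finite (set_pmf (g x))"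
  shows "measure_pmf.expectation (bind_pmf p g) f =
    measure_pmf.expectation p (\<lambda>x. measure_pmf.expectation (g x) f)"
  using assms by (subst pmf_expectation_bind[where A = "set_pmf p"])
    (auto simp: integral_measure_pmf_real[where A = "set_pmf p"] mult.commute)

lemma finite_set_pmf_run: "finite (set_pmf (run A S r k))"
  by (induction k) (auto simp: finite_set_pmf_interval_sample split: option.split)

lemma expectation_run_Suc:
  fixes f :: "answer list \<Rightarrow> real"
  shows "measure_pmf.expectation (run A S r (Suc k)) f =
    measure_pmf.expectation (run A S r k)
      (\<lambda>h. case query A r h of None \<Rightarrow> f h
           | Some T \<Rightarrow> measure_pmf.expectation (interval_sample S T) (\<lambda>a. f (h @ [a])))"
  by (auto simp: expectation_bind_finite finite_set_pmf_run finite_set_pmf_interval_sample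
      intro!: Bochner_Integration.integral_cong split: option.split)

lemma length_run:
  assumes "h \<in> set_pmf (run A S r k)"
  shows "length h \<le> k" and "query A r h \<noteq> None \<Longrightarrow> length h = k"
  using assms
  by (induction k arbitrary: h) (auto split: option.splits simp: le_Suc_eq)

lemma expectation_mono_finite:
  fixes f g :: "'a \<Rightarrow> real"
  assumes "finite (set_pmf p)" "\<And>x. x \<in> set_pmf p \<Longrightarrow> f x \<le> g x"
  shows "measure_pmf.expectation p f \<le> measure_pmf.expectation p g"
  using assms by (intro integral_mono_AE integrable_measure_pmf_finite) (auto simp: AE_measure_pmf_iff)

lemma prob_eq_expectation: "measure_pmf.prob p X = measure_pmf.expectation p (indicator X)"
  by simp

section \<open>Integration over the coin tosses\<close>

interpretation coin: prob_space coin_space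
  unfolding coin_space_def by (intro prob_space_PiM measure_pmf.prob_space_axioms)

lemma measurable_coin: "(\<lambda>r. r i) \<in> measurable coin_space (count_space UNIV)"
proof -
  have "(\<lambda>r. r i) \<in> measurable coin_space (measure_pmf (bernoulli_pmf (1/2)))"
    unfolding coin_space_def by (rule measurable_component_singleton) simp
  then show ?thesis by (simp add: measurable_cong_sets[OF refl sets_measure_pmf_count_space])
qed

text \<open>Coordinates of the product measure are independent, so overwriting coin \<open>i\<close>
  with a fresh toss does not change the law of the sequence.\<close>

lemma integral_coin_split:
  fixes f :: "coins \<Rightarrow> real"
  assumes "integrable coin_space f"
  shows "(\<integral>r. f r \<partial>coin_space) =
    ((\<integral>r. f (r(i := True)) \<partial>coin_space) + (\<integral>r. f (r(i := False)) \<partial>coin_space)) / 2"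
proof -
  let ?B = "measure_pmf (bernoulli_pmf (1/2))"
  let ?g = "\<lambda>(x, r). r(i := x)"
  have D: "distr (?B \<Otimes>\<^sub>M coin_space) coin_space ?g = coin_space"
    using distr_pair_PiM_eq_PiM[of UNIV "\<lambda>_. ?B" i]
    by (simp add: coin_space_def measure_pmf.prob_space_axioms)
  have g: "?g \<in> measurable (?B \<Otimes>\<^sub>M coin_space) coin_space"
    unfolding coin_space_def case_prod_unfold
    by (rule measurable_fun_upd[where J = UNIV]) (auto simp: measurable_snd)
  have fm: "f \<in> borel_measurable coin_space" using assms by simp
  interpret pair_prob_space ?B coin_space ..
  have int: "integrable (?B \<Otimes>\<^sub>M coin_space) (\<lambda>z. f (?g z))"
    using integrable_distr[OF g] assms D by simp
  have "(\<integral>r. f r \<partial>coin_space) = (\<integral>z. f (?g z) \<partial>(?B \<Otimes>\<^sub>M coin_space))"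
    using integral_distr[OF g fm] D by simp
  also have "\<dots> = (\<integral>x. (\<integral>r. f (r(i := x)) \<partial>coin_space) \<partial>?B)"
    using int by (subst integral_fst'[symmetric]) (auto simp: case_prod_unfold)
  finally show ?thesis by simp
qed

text \<open>A function of finitely many coins takes finitely many values, so measurability and
  integrability come for free, and independence of later coins becomes insensitivity to overwriting
  them.\<close>

definition depends_below :: "nat \<Rightarrow> (coins \<Rightarrow> 'a) \<Rightarrow> bool" where
  "depends_below N f \<longleftrightarrow> (\<forall>r r'. (\<forall>i<N. r i = r' i) \<longrightarrow> f r = f r')"

lemma depends_belowD: "depends_below N f \<Longrightarrow> (\<And>i. i < N \<Longrightarrow> r i = r' i) \<Longrightarrow> f r = f r'"
  by (auto simp: depends_below_def)

lemma depends_below_Suc: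
  assumes "depends_below (Suc N) f"
  shows "depends_below N (\<lambda>r. f (r(N := b)))"
  unfolding depends_below_def
  by (intro allI impI depends_belowD[OF assms]) (auto simp: less_Suc_eq)

lemma depends_below_fun_upd: "depends_below N f \<Longrightarrow> N \<le> i \<Longrightarrow> f (r(i := b)) = f r"
  by (rule depends_belowD) auto

lemma depends_below_measurable:
  assumes "depends_below N f" "\<And>y. y \<in> space M"
  shows "f \<in> measurable coin_space M"
  using assms(1)
proof (induction N arbitrary: f)
  case 0
  then have "f = (\<lambda>_. f undefined)" by (auto simp: depends_below_def)
  then show ?case using assms(2) by (metis measurable_const)
next
  case (Suc N)
  have "(\<lambda>r. if r N then f (r(N := True)) else f (r(N := False))) \<in> measurable coin_space M"
    using measurable_coin[of N] 
    by (intro measurable_If Suc.IH depends_below_Suc[OF Suc.prems]) 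
       (simp add: pred_def[symmetric] measurable_coin)
  moreover have "(\<lambda>r. if r N then f (r(N := True)) else f (r(N := False))) = f"
    by (auto simp: fun_eq_iff fun_upd_idem)
  ultimately show ?case by simp
qed

lemma depends_below_integrable:
  fixes f :: "coins \<Rightarrow> real"
  assumes "depends_below N f"
  shows "integrable coin_space f"
  using assms
proof (induction N arbitrary: f)
  case 0
  then have "f = (\<lambda>_. f undefined)" by (auto simp: depends_below_def)
  then show ?case by (metis coin.integrable_const)
next
  case (Suc N)
  have I: "integrable coin_space (\<lambda>r. f (r(N := b)))" for b
    by (intro Suc.IH depends_below_Suc[OF Suc.prems])
  show ?case
  proof (rule Bochner_Integration.integrable_bound)
    show "integrable coin_space (\<lambda>r. \<bar>f (r(N := True))\<bar> + \<bar>f (r(N := False))\<bar>)"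
      using I by auto
    show "f \<in> borel_measurable coin_space"
      using Suc.prems by (rule depends_below_measurable) simp
    have "\<bar>f r\<bar> \<le> \<bar>f (r(N := True))\<bar> + \<bar>f (r(N := False))\<bar>" for r
      using fun_upd_triv[of r N] by (cases "r N") (auto simp: )
    then show "AE r in coin_space. norm (f r) \<le> norm (\<bar>f (r(N := True))\<bar> + \<bar>f (r(N := False))\<bar>)"
      by (intro AE_I2) (auto intro: order_trans)
  qed
qed

definition bits :: "nat \<Rightarrow> nat \<Rightarrow> coins \<Rightarrow> nat" where
  "bits p d r = (\<Sum>j<d. of_bool (r (p + j)) * 2 ^ j)"

lemma bits_Suc: "bits p (Suc d) r = bits p d r + of_bool (r (p + d)) * 2 ^ d"
  by (simp add: bits_def)

lemma depends_below_bits: "p + d \<le> N \<Longrightarrow> depends_below N (bits p d)"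
  by (auto simp: depends_below_def bits_def)

lemma bits_less: "bits p d r < 2 ^ d"
  by (induction d) (auto simp: bits_Suc, auto simp: bits_def)

text \<open>The number read from \<open>d\<close> fresh coins is uniform and independent of whatever
  the coins before \<open>p\<close> determine. The induction peels off the top bit, which adds 0 or
  \<open>2 ^ d\<close>.\<close>

lemma integral_bits:
  fixes g :: "nat \<Rightarrow> coins \<Rightarrow> real"
  assumes "\<And>x. depends_below p (g x)"
  shows "(\<integral>r. g (bits p d r) r \<partial>coin_space) = (\<Sum>x<2^d. \<integral>r. g x r \<partial>coin_space) / 2 ^ d"
  using assms
proof (induction d arbitrary: g)
  case 0
  then show ?case by (simp add: bits_def)
next
  case (Suc d)
  have dep: "depends_below (p + Suc d) (\<lambda>r. g (bits p (Suc d) r) r)"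
    unfolding depends_below_def
  proof (intro allI impI)
    fix r r' :: coins assume "\<forall>i<p + Suc d. r i = r' i"
    then have "bits p (Suc d) r = bits p (Suc d) r'" "g x r = g x r'" for x
      using depends_belowD[OF depends_below_bits[OF order_refl], of p "Suc d" r r']
        depends_belowD[OF Suc.prems, of r r' x] by auto
    then show "g (bits p (Suc d) r) r = g (bits p (Suc d) r') r'" by simp
  qed
  have upd: "g (bits p (Suc d) (r(p + d := b))) (r(p + d := b)) = g (bits p d r + of_bool b * 2 ^ d) r" for r b
  proof -
    have "g x (r(p + d := b)) = g x r" for x
      by (rule depends_below_fun_upd[OF Suc.prems]) simp
    then show ?thesis
      using depends_below_fun_upd[OF depends_below_bits, of p d "p + d" "p + d" r b]
      by (simp add: bits_Suc del: fun_upd_apply) simp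
  qed
  have half: "(\<integral>r. g (bits p d r + c) r \<partial>coin_space) = (\<Sum>x<2^d. \<integral>r. g (x + c) r \<partial>coin_space) / 2 ^ d" for c
    by (rule Suc.IH) (rule Suc.prems)
  have split: "(\<Sum>x<2 ^ Suc d. F x) = (\<Sum>x<2^d. F x) + (\<Sum>x<2^d. F (x + 2 ^ d))" for F :: "nat \<Rightarrow> real"
    using sum.atLeastLessThan_concat[of 0 "2^d" "2^d + 2^d" F] sum.shift_bounds_nat_ivl[of F 0 "2^d" "2^d"]
    by (simp add: atLeast0LessThan mult_2)
  have "(\<integral>r. g (bits p (Suc d) r) r \<partial>coin_space) =
    ((\<integral>r. g (bits p d r + 2 ^ d) r \<partial>coin_space) + (\<integral>r. g (bits p d r + 0) r \<partial>coin_space)) / 2"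
    by (subst integral_coin_split[OF depends_below_integrable[OF dep], of "p + d"])
      (simp only: upd of_bool_eq mult_1 mult_zero_left)
  then show ?case
    unfolding split half by (simp add: field_simps)
qed

section \<open>Algorithms given by state machines\<close>

lemma measure_le_finite:
  assumes "finite (set_pmf p)" "\<And>h. h \<in> set_pmf p \<Longrightarrow> 0 \<le> \<Phi> h" "0 \<le> L"
    "\<And>h. h \<in> set_pmf p \<Longrightarrow> h \<in> X \<Longrightarrow> L \<le> \<Phi> h"
  shows "L * measure_pmf.prob p X \<le> measure_pmf.expectation p \<Phi>"
proof -
  have "L * measure_pmf.prob p X = measure_pmf.expectation p (\<lambda>h. L * indicator X h)"
    by simp
  also have "\<dots> \<le> measure_pmf.expectation p \<Phi>"
    by (rule expectation_mono_finite) (use assms in \<open>auto simp: indicator_def\<close>)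
  finally show ?thesis .
qed

lemma expectation_return_pmf: "measure_pmf.expectation (return_pmf x) f = (f x :: real)"
  by (subst integral_measure_pmf_real[where A = "{x}"]) auto

lemma coin_integral_const: "(\<integral>r. (c :: real) \<partial>coin_space) = c"
  by (simp add: coin.prob_space)

lemma depends_below_compose2:
  assumes "depends_below N f" "depends_below N g"
  shows "depends_below N (\<lambda>r. F (f r) (g r))"
  using assms unfolding depends_below_def by metis

text \<open>Each sample may use a number \<open>x < 2 ^ D\<close> read from its own block of coins;
  with \<open>D = 0\<close> only the answers are random. An \<open>algo\<close> sees coins and
  answers alone, so \<open>state\<close> recomputes the state from them.\<close>

locale machine =
  fixes D :: nat
    and start :: 's
    and ask :: "nat \<Rightarrow> 's \<Rightarrow> nat \<Rightarrow> nat \<times> nat"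
    and step :: "nat \<Rightarrow> 's \<Rightarrow> nat \<Rightarrow> answer \<Rightarrow> 's"
    and stop :: "'s \<Rightarrow> bool"
    and out :: "'s \<Rightarrow> real"
begin

definition block :: "nat \<Rightarrow> coins \<Rightarrow> nat" where
  "block t = bits (t * D) D"

definition state :: "coins \<Rightarrow> answer list \<Rightarrow> 's" where
  "state r h = fold (\<lambda>t s. step t s (block t r) (h ! t)) [0..<length h] start"

definition machine_algo :: algo where
  "machine_algo = \<lparr>query = (\<lambda>r h. if stop (state r h) then None
       else Some (ask (length h) (state r h) (block (length h) r))),
     estimate = (\<lambda>r h. out (state r h))\<rparr>"

lemma state_Nil [simp]: "state r [] = start"
  by (simp add: state_def)

lemma state_snoc [simp]:
  "state r (h @ [a]) = step (length h) (state r h) (block (length h) r) a"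
proof -
  have "fold (\<lambda>t s. step t s (block t r) ((h @ [a]) ! t)) [0..<length h] start
      = fold (\<lambda>t s. step t s (block t r) (h ! t)) [0..<length h] start"
    by (rule fold_cong) (auto simp: nth_append)
  then show ?thesis by (simp add: state_def)
qed

lemma query_machine: "query machine_algo r h = (if stop (state r h) then None
    else Some (ask (length h) (state r h) (block (length h) r)))"
  and estimate_machine: "estimate machine_algo r h = out (state r h)"
  by (simp_all add: machine_algo_def)

lemma depends_below_block: "t < k \<Longrightarrow> depends_below (k * D) (block t)"
  unfolding block_def by (rule depends_below_bits) (metis Suc_leI add.commute mult_Suc mult_le_mono1)

lemma block_less: "block t r < 2 ^ D"
  unfolding block_def by (rule bits_less)

lemma depends_below_state: "length h \<le> k \<Longrightarrow> depends_below (k * D) (\<lambda>r. state r h)"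
proof (induction h rule: rev_induct)
  case Nil
  show ?case by (simp add: depends_below_def)
next
  case (snoc a h)
  then have "depends_below (k * D) (\<lambda>r. state r h)" "depends_below (k * D) (block (length h))"
    by (auto intro: depends_below_block)
  then show ?case
    by (simp add: depends_below_compose2[where F = "\<lambda>s x. step (length h) s x a"])
qed

lemma depends_below_state_fun: "length h \<le> k \<Longrightarrow> depends_below (k * D) (\<lambda>r. F (state r h))"
  using depends_below_state[of h k] unfolding depends_below_def by (auto intro!: arg_cong[where f = F])

lemma depends_below_query:
  "length h < k \<Longrightarrow> depends_below (k * D) (\<lambda>r. query machine_algo r h)"
  unfolding query_machine
  by (rule depends_below_compose2[OF depends_below_state depends_below_block]) auto

text \<open>Hence block \<open>k\<close> is fresh with respect to the first \<open>k\<close>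
  samples.\<close>

lemma depends_below_run: "depends_below (k * D) (\<lambda>r. run machine_algo S r k)"
proof (induction k)
  case (Suc k)
  show ?case
    unfolding depends_below_def
  proof (intro allI impI)
    fix r r' :: coins assume r: "\<forall>i<Suc k * D. r i = r' i"
    have "run machine_algo S r k = run machine_algo S r' k"
      using depends_belowD[OF Suc.IH, of r r'] r by auto
    moreover have "query machine_algo r h = query machine_algo r' h"
      if "h \<in> set_pmf (run machine_algo S r' k)" for h
      using depends_belowD[OF depends_below_query[of h "Suc k"], of r r'] r length_run(1)[OF that]
      by (auto simp: less_Suc_eq_le)
    ultimately show "run machine_algo S r (Suc k) = run machine_algo S r' (Suc k)"
      by (auto intro!: bind_pmf_cong)
  qed
qed (simp add: depends_below_def)

lemma machine_interval_algorithm: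
  assumes "\<And>t s x. 1 \<le> fst (ask t s x) \<and> fst (ask t s x) \<le> snd (ask t s x) \<and> snd (ask t s x) \<le> n"
  shows "interval_algorithm n machine_algo"
proof -
  have "(\<lambda>r. query machine_algo r h) \<in> measurable coin_space (count_space UNIV)" for h
    by (rule depends_below_measurable[OF depends_below_query[of h "Suc (length h)"]]) auto
  moreover have "(\<lambda>r. estimate machine_algo r h) \<in> borel_measurable coin_space" for h
    unfolding estimate_machine
    by (rule depends_below_measurable[OF depends_below_state_fun[OF order_refl]]) simp
  ultimately show ?thesis
    using assms unfolding interval_algorithm_def query_machine
    by (auto split: if_splits) (metis fst_conv snd_conv)+
qed

lemma depends_below_expectation:
  fixes f :: "coins \<Rightarrow> answer list \<Rightarrow> real"
  assumes "k * D \<le> N"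
    and "\<And>h. length h \<le> k \<Longrightarrow> depends_below N (\<lambda>r. f r h)"
  shows "depends_below N (\<lambda>r. measure_pmf.expectation (run machine_algo S r k) (f r))"
  unfolding depends_below_def
proof (intro allI impI)
  fix r r' :: coins assume r: "\<forall>i<N. r i = r' i"
  have 1: "run machine_algo S r k = run machine_algo S r' k"
    using depends_belowD[OF depends_below_run, of k r r'] r assms(1) by auto
  have "f r h = f r' h" if "h \<in> set_pmf (run machine_algo S r' k)" for h
    using depends_belowD[OF assms(2)[OF length_run(1)[OF that]], of r r'] r by simp
  with 1 show "measure_pmf.expectation (run machine_algo S r k) (f r)
      = measure_pmf.expectation (run machine_algo S r' k) (f r')"
    by (auto intro!: integral_cong_AE simp: AE_measure_pmf_iff)
qed

lemma length_run_machine: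
  "h \<in> set_pmf (run machine_algo S r k) \<Longrightarrow> \<not> stop (state r h) \<Longrightarrow> length h = k"
  by (rule length_run(2)) (auto simp: query_machine)

end

text \<open>The decrease is demanded on average over random number and answer, and only in reachable
  states that are still running; a stopped run keeps its potential. The time is an argument of
  \<open>\<Phi>\<close> so that a potential may contain a factor growing with it.\<close>

locale machine_supermartingale = machine D start ask step stop out
  for D and start :: 's and ask step stop out +
  fixes S :: "nat set" and inv :: "nat \<Rightarrow> 's \<Rightarrow> bool" and \<Phi> :: "nat \<Rightarrow> 's \<Rightarrow> real"
  assumes inv_start: "inv 0 start"
    and inv_step: "\<And>t s x a. inv t s \<Longrightarrow> \<not> stop s \<Longrightarrow> x < 2 ^ D \<Longrightarrow>
      a \<in> set_pmf (interval_sample S (ask t s x)) \<Longrightarrow> inv (Suc t) (step t s x a)"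
    and decrease: "\<And>t s. inv t s \<Longrightarrow> \<not> stop s \<Longrightarrow>
      (\<Sum>x<2^D. measure_pmf.expectation (interval_sample S (ask t s x)) (\<lambda>a. \<Phi> (Suc t) (step t s x a)))
        \<le> 2 ^ D * \<Phi> t s"
    and nonneg: "\<And>t s. inv t s \<Longrightarrow> 0 \<le> \<Phi> t s"
begin

lemma inv_run: "h \<in> set_pmf (run machine_algo S r k) \<Longrightarrow> inv (length h) (state r h)"
proof (induction k arbitrary: h)
  case (Suc k)
  then show ?case
    by (auto simp: query_machine block_less intro!: inv_step split: if_splits)
qed (simp add: inv_start)

definition potential :: "nat \<Rightarrow> coins \<Rightarrow> real" where
  "potential k r = measure_pmf.expectation (run machine_algo S r k) (\<lambda>h. \<Phi> (length h) (state r h))"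

lemma depends_below_potential: "depends_below (k * D) (potential k)"
  unfolding potential_def
proof (rule depends_below_expectation)
  fix h :: "answer list" assume "length h \<le> k"
  then show "depends_below (k * D) (\<lambda>r. \<Phi> (length h) (state r h))"
    by (rule depends_below_state_fun)
qed simp

lemma potential_decreasing: "(\<integral>r. potential k r \<partial>coin_space) \<le> \<Phi> 0 start"
proof (induction k)
  case 0
  have "potential 0 r = \<Phi> 0 start" for r
    by (simp only: potential_def run.simps expectation_return_pmf list.size state_Nil)
  then have "(\<integral>r. potential 0 r \<partial>coin_space) = (\<integral>r. \<Phi> 0 start \<partial>coin_space)"
    by (intro Bochner_Integration.integral_cong refl)
  also have "\<dots> = \<Phi> 0 start" by (rule coin_integral_const)
  finally show ?case by (rule eq_refl)
next
  case (Suc k)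
  \<comment> \<open>\<open>f x\<close> is the expected potential after one more step if the random
    number were \<open>x\<close>. It depends on the first \<open>k * D\<close> coins only, so
    \<open>integral_bits\<close> replaces the actual number by an average over all
    \<open>x\<close>.\<close>
  define f where "f x r h = (if stop (state r h) then \<Phi> (length h) (state r h)
    else measure_pmf.expectation (interval_sample S (ask k (state r h) x))
      (\<lambda>a. \<Phi> (Suc k) (step k (state r h) x a)))" for x r h
  define g where "g x r = measure_pmf.expectation (run machine_algo S r k) (f x r)" for x r
  have dep: "depends_below (k * D) (g x)" for x
    unfolding g_def
  proof (rule depends_below_expectation)
    fix h :: "answer list" assume "length h \<le> k"
    then show "depends_below (k * D) (\<lambda>r. f x r h)"
      unfolding f_def by (rule depends_below_state_fun)
  qed simp
  have "potential (Suc k) r = g (block k r) r" for r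
    unfolding potential_def g_def expectation_run_Suc
    by (rule integral_cong_AE)
      (auto simp: AE_measure_pmf_iff query_machine f_def dest: length_run_machine)
  then have "(\<integral>r. potential (Suc k) r \<partial>coin_space) = (\<Sum>x<2^D. \<integral>r. g x r \<partial>coin_space) / 2 ^ D"
    using integral_bits[of "k * D" g D, OF dep] by (simp add: block_def)
  also have "\<dots> = (\<integral>r. (\<Sum>x<2^D. g x r) / 2 ^ D \<partial>coin_space)"
    using depends_below_integrable[OF dep] by simp
  also have "\<dots> \<le> (\<integral>r. potential k r \<partial>coin_space)"
  proof (rule integral_mono)
    fix r
    have "(\<Sum>x<2^D. g x r) = measure_pmf.expectation (run machine_algo S r k) (\<lambda>h. \<Sum>x<2^D. f x r h)"
      unfolding g_def
      by (subst Bochner_Integration.integral_sum) (auto intro!: integrable_measure_pmf_finite finite_set_pmf_run)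
    also have "\<dots> \<le> measure_pmf.expectation (run machine_algo S r k) (\<lambda>h. 2 ^ D * \<Phi> (length h) (state r h))"
    proof (rule expectation_mono_finite[OF finite_set_pmf_run])
      fix h assume h: "h \<in> set_pmf (run machine_algo S r k)"
      show "(\<Sum>x<2^D. f x r h) \<le> 2 ^ D * \<Phi> (length h) (state r h)"
        using decrease[OF inv_run[OF h]] length_run_machine[OF h]
        by (cases "stop (state r h)") (auto simp: f_def)
    qed
    finally show "(\<Sum>x<2^D. g x r) / 2 ^ D \<le> potential k r"
      by (simp add: potential_def field_simps)
  qed (auto intro!: depends_below_integrable[OF dep] depends_below_integrable[OF depends_below_potential])
  finally show ?case using Suc.IH by simp
qed

lemma integral_prob_le:
  assumes L: "0 \<le> L"
    and le: "\<And>r h. h \<in> set_pmf (run machine_algo S r k) \<Longrightarrow> h \<in> X r \<Longrightarrow> L \<le> \<Phi> (length h) (state r h)"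
    and int: "integrable coin_space (\<lambda>r. measure_pmf.prob (run machine_algo S r k) (X r))"
  shows "L * (\<integral>r. measure_pmf.prob (run machine_algo S r k) (X r) \<partial>coin_space) \<le> \<Phi> 0 start"
proof -
  have "L * (\<integral>r. measure_pmf.prob (run machine_algo S r k) (X r) \<partial>coin_space)
      = (\<integral>r. L * measure_pmf.prob (run machine_algo S r k) (X r) \<partial>coin_space)" by simp
  also have "\<dots> \<le> (\<integral>r. potential k r \<partial>coin_space)"
  proof (rule integral_mono)
    show "L * measure_pmf.prob (run machine_algo S r k) (X r) \<le> potential k r" for r
      unfolding potential_def
      by (rule measure_le_finite) (use L le nonneg inv_run finite_set_pmf_run in auto)
  qed (use int depends_below_integrable[OF depends_below_potential] in auto)
  finally show ?thesis using potential_decreasing[of k] by simp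
qed
end

lemma coin_integral_le_1:
  assumes "\<And>r. f r \<le> 1"
  shows "(\<integral>r. f r \<partial>coin_space) \<le> (1::real)"
proof (cases "integrable coin_space f")
  case True
  then have "(\<integral>r. f r \<partial>coin_space) \<le> (\<integral>r. 1 \<partial>coin_space)"
    by (rule integral_mono) (use assms in auto)
  then show ?thesis by (simp add: coin.prob_space)
qed (simp add: not_integrable_integral_eq)

lemma prob_output_ge:
  "(\<integral>r. measure_pmf.prob (run A S r k) {h. query A r h = None \<and> P (estimate A r h)} \<partial>coin_space)
    \<le> prob_output A S P"
  unfolding prob_output_def
  by (rule cSUP_upper) (auto intro!: bdd_aboveI[where M = 1] coin_integral_le_1)

lemma uses_samples_mono:
  assumes "uses_samples A S b" "0 < b" "b \<le> b'"
  shows "uses_samples A S b'"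
  unfolding uses_samples_def
proof (intro allI impI)
  fix m :: nat assume m: "b' \<le> real m"
  then have "prob_more_samples A S m \<le> exp (- (real m / b))"
    using assms by (auto simp: uses_samples_def)
  also have "\<dots> \<le> exp (- (real m / b'))"
    using assms by (simp add: frac_le)
  finally show "prob_more_samples A S m \<le> exp (- (real m / b'))" .
qed

text \<open>Letting \<open>k\<close> grow removes the probability of still running from a lower
  bound on a success probability: the sample bound also yields termination with probability
  1.\<close>

lemma uses_samples_limit:
  assumes "uses_samples A S b" "0 < b" "\<And>k. c - prob_more_samples A S k \<le> x"
  shows "c \<le> x"
proof (rule LIMSEQ_le_const2)
  have "(\<lambda>k. exp (- (real k / b))) \<longlonglongrightarrow> 0"
    using \<open>0 < b\<close> by real_asymp
  then show "(\<lambda>k. c - exp (- (real k / b))) \<longlonglongrightarrow> c"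
    using tendsto_diff[OF tendsto_const[of c]] by fastforce
  show "\<exists>N. \<forall>k\<ge>N. c - exp (- (real k / b)) \<le> x"
  proof (intro exI allI impI)
    fix k assume "nat \<lceil>b\<rceil> \<le> k"
    then have "b \<le> real k" by linarith
    then show "c - exp (- (real k / b)) \<le> x"
      using assms(1) assms(3)[of k] by (auto simp: uses_samples_def)
  qed
qed

lemma (in machine) query_machine_None: "query machine_algo r h = None \<longleftrightarrow> stop (state r h)"
  by (simp add: query_machine)

lemma (in machine) integrable_prob_state:
  "integrable coin_space (\<lambda>r. measure_pmf.prob (run machine_algo S r k) {h. P (state r h)})"
proof -
  have "measure_pmf.prob (run machine_algo S r k) {h. P (state r h)} =
     measure_pmf.expectation (run machine_algo S r k) (\<lambda>h. of_bool (P (state r h)))" for r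
    unfolding prob_eq_expectation
    by (rule Bochner_Integration.integral_cong) (auto simp: indicator_def)
  moreover have "integrable coin_space 
     (\<lambda>r. measure_pmf.expectation (run machine_algo S r k) (\<lambda>h. of_bool (P (state r h)) :: real))"
  proof (rule depends_below_integrable[where N = "k * D"], rule depends_below_expectation)
    fix h :: "answer list" assume "length h \<le> k"
    then show "depends_below (k * D) (\<lambda>r. of_bool (P (state r h)))"
      by (rule depends_below_state_fun)
  qed simp
  ultimately show ?thesis by presburger
qed

context machine_supermartingale
begin

lemma prob_more_samples_bound:
  assumes "0 \<le> L" "\<And>s. inv m s \<Longrightarrow> \<not> stop s \<Longrightarrow> L \<le> \<Phi> m s"
  shows "L * prob_more_samples machine_algo S m \<le> \<Phi> 0 start"
  unfolding prob_more_samples_def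
proof (rule integral_prob_le)
  fix r h assume h: "h \<in> set_pmf (run machine_algo S r m)" "h \<in> {h. query machine_algo r h \<noteq> None}"
  then have "\<not> stop (state r h)" by (auto simp: query_machine)
  with h show "L \<le> \<Phi> (length h) (state r h)"
    using assms(2) inv_run[OF h(1)] length_run_machine[OF h(1)] by auto
next
  show "integrable coin_space
     (\<lambda>r. measure_pmf.prob (run machine_algo S r m) {h. query machine_algo r h \<noteq> None})"
    using integrable_prob_state[of S m "\<lambda>s. \<not> stop s"] by (simp add: query_machine_None)
qed fact

text \<open>After \<open>k\<close> samples the run goes on, has stopped well, or has stopped badly.
  In the last case the potential is at least 1, which by Markov's inequality has probability at most
  its initial value.\<close>

lemma prob_output_bound:
  assumes bad: "\<And>t s. inv t s \<Longrightarrow> stop s \<Longrightarrow> \<not> P (out s) \<Longrightarrow> 1 \<le> \<Phi> t s"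
  shows "1 - \<Phi> 0 start - prob_more_samples machine_algo S k \<le> prob_output machine_algo S P"
proof -
  let ?p = "\<lambda>r. measure_pmf.prob (run machine_algo S r k)"
  let ?N = "\<lambda>r. {h. \<not> stop (state r h)}"
  let ?G = "\<lambda>r. {h. stop (state r h) \<and> P (out (state r h))}"
  let ?B = "\<lambda>r. {h. stop (state r h) \<and> \<not> P (out (state r h))}"
  have int: "integrable coin_space (\<lambda>r. ?p r (?N r))" "integrable coin_space (\<lambda>r. ?p r (?G r))"
    "integrable coin_space (\<lambda>r. ?p r (?B r))"
    using integrable_prob_state[of S k "\<lambda>s. \<not> stop s"] integrable_prob_state[of S k "\<lambda>s. stop s \<and> P (out s)"]
      integrable_prob_state[of S k "\<lambda>s. stop s \<and> \<not> P (out s)"] by simp_all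
  have "?p r (?N r) + ?p r (?G r) + ?p r (?B r) = 1" for r
  proof -
    have "?p r (?N r) + ?p r (?G r) + ?p r (?B r) = ?p r (?N r \<union> ?G r) + ?p r (?B r)"
      by (subst measure_pmf.finite_measure_Union) auto
    also have "\<dots> = ?p r (?N r \<union> ?G r \<union> ?B r)"
      by (subst measure_pmf.finite_measure_Union) auto
    also have "?N r \<union> ?G r \<union> ?B r = UNIV" by auto
    finally show ?thesis by simp
  qed
  then have "(\<integral>r. ?p r (?N r) + ?p r (?G r) + ?p r (?B r) \<partial>coin_space) = 1"
    by (simp add: coin.prob_space)
  then have "(\<integral>r. ?p r (?N r) \<partial>coin_space) + (\<integral>r. ?p r (?G r) \<partial>coin_space)
      + (\<integral>r. ?p r (?B r) \<partial>coin_space) = 1"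
    using int by simp
  moreover have "1 * (\<integral>r. ?p r (?B r) \<partial>coin_space) \<le> \<Phi> 0 start"
    by (rule integral_prob_le) (use int bad inv_run in auto)
  moreover have "prob_more_samples machine_algo S k = (\<integral>r. ?p r (?N r) \<partial>coin_space)"
    by (simp add: prob_more_samples_def query_machine_None)
  moreover have "(\<integral>r. ?p r (?G r) \<partial>coin_space) \<le> prob_output machine_algo S P"
    using prob_output_ge[of machine_algo S k P] by (simp add: query_machine_None estimate_machine)
  ultimately show ?thesis by simp
qed

end

section \<open>Lower bound for non-adaptive algorithms\<close>

definition reached :: "algo \<Rightarrow> coins \<Rightarrow> nat \<Rightarrow> answer list \<Rightarrow> bool" where
  "reached A r k h \<longleftrightarrow> (\<forall>i<length h. query A r (take i h) \<noteq> None) \<and>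
     (length h = k \<or> length h < k \<and> query A r h = None)"

lemma pmf_run_snoc:
  "pmf (run A S r (Suc k)) (h @ [a]) = of_bool (query A r (h @ [a]) = None) * pmf (run A S r k) (h @ [a]) +
    (case query A r h of None \<Rightarrow> 0 | Some T \<Rightarrow> pmf (interval_sample S T) a * pmf (run A S r k) h)"
proof -
  let ?g = "\<lambda>x. pmf (case query A r x of None \<Rightarrow> return_pmf x
    | Some T \<Rightarrow> map_pmf (\<lambda>a. x @ [a]) (interval_sample S T)) (h @ [a])"
  have g: "?g x = (case query A r x of None \<Rightarrow> of_bool (x = h @ [a])
     | Some T \<Rightarrow> of_bool (x = h) * pmf (interval_sample S T) a)" for x
  proof (cases "query A r x")
    case (Some T)
    show ?thesis
    proof (cases "x = h")
      case True
      have "pmf (map_pmf (\<lambda>a. x @ [a]) (interval_sample S T)) (x @ [a]) = pmf (interval_sample S T) a"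
        by (rule pmf_map_inj') (auto simp: inj_on_def)
      then show ?thesis using Some True by simp
    next
      case False
      then have "pmf (map_pmf (\<lambda>a. x @ [a]) (interval_sample S T)) (h @ [a]) = 0"
        unfolding pmf_eq_0_set_pmf by auto
      then show ?thesis using Some False by simp
    qed
  qed auto
  have "pmf (run A S r (Suc k)) (h @ [a]) = measure_pmf.expectation (run A S r k) ?g"
    by (simp add: pmf_bind)
  also have "\<dots> = (\<Sum>x\<in>{h @ [a], h}. ?g x * pmf (run A S r k) x)"
    by (rule integral_measure_pmf_real) (unfold g, auto split: option.splits if_splits)
  finally show ?thesis unfolding g by (auto split: option.split)
qed

lemma pmf_run_Nil:
  "pmf (run A S r (Suc k)) [] = of_bool (query A r [] = None) * pmf (run A S r k) []"
proof -
  let ?g = "\<lambda>x. pmf (case query A r x of None \<Rightarrow> return_pmf x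
    | Some T \<Rightarrow> map_pmf (\<lambda>a. x @ [a]) (interval_sample S T)) []"
  have g: "?g x = of_bool (x = [] \<and> query A r [] = None)" for x
  proof (cases "query A r x")
    case (Some T)
    have "pmf (map_pmf (\<lambda>a. x @ [a]) (interval_sample S T)) [] = 0"
      unfolding pmf_eq_0_set_pmf by auto
    then show ?thesis using Some by auto
  qed (auto simp: indicator_def)
  have "pmf (run A S r (Suc k)) [] = measure_pmf.expectation (run A S r k) ?g"
    by (simp add: pmf_bind)
  also have "\<dots> = (\<Sum>x\<in>{[]}. ?g x * pmf (run A S r k) x)"
    by (rule integral_measure_pmf_real) (unfold g, auto split: if_splits)
  finally show ?thesis unfolding g by auto
qed

text \<open>\<open>S\<close> enters only through a product over the samples; the first factor is
  determined by the algorithm and its coins. Two hidden sets can therefore be compared factor by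
  factor.\<close>

lemma pmf_run:
  "pmf (run A S r k) h = of_bool (reached A r k h) *
     (\<Prod>i<length h. pmf (interval_sample S (the (query A r (take i h)))) (h ! i))"
proof (induction k arbitrary: h)
  case 0
  then show ?case by (cases h) (auto simp: reached_def)
next
  case (Suc k)
  show ?case
  proof (cases h rule: rev_cases)
    case Nil
    show ?thesis
      unfolding Nil pmf_run_Nil Suc.IH by (auto simp: reached_def)
  next
    case (snoc h' a)
    have P: "(\<Prod>i<length h. pmf (interval_sample S (the (query A r (take i h)))) (h ! i)) =
       (\<Prod>i<length h'. pmf (interval_sample S (the (query A r (take i h')))) (h' ! i)) *
         pmf (interval_sample S (the (query A r h'))) a"
      by (simp add: snoc nth_append)
    have r0: "reached A r j h \<longleftrightarrow> (\<forall>i<length h'. query A r (take i h') \<noteq> None) \<and> query A r h' \<noteq> None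
        \<and> (length h = j \<or> length h < j \<and> query A r h = None)" for j
      by (auto simp: reached_def snoc less_Suc_eq nth_append)
    have "pmf (run A S r (Suc k)) h = of_bool (query A r h = None \<and> reached A r k h) *
         (\<Prod>i<length h. pmf (interval_sample S (the (query A r (take i h)))) (h ! i)) +
       of_bool (query A r h' \<noteq> None \<and> reached A r k h') *
         (\<Prod>i<length h. pmf (interval_sample S (the (query A r (take i h)))) (h ! i))"
      unfolding P
      by (subst (1) snoc, subst pmf_run_snoc, unfold Suc.IH snoc[symmetric] P)
         (auto split: option.split)
    also have "\<dots> = of_bool (reached A r (Suc k) h) *
         (\<Prod>i<length h. pmf (interval_sample S (the (query A r (take i h)))) (h ! i))"
      unfolding r0 by (auto simp: reached_def snoc)
    finally show ?thesis .
  qed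
qed

text \<open>A finite superset of the support that serves all coin tosses and all subsets of
  \<open>X\<close> at once; probabilities become finite sums that can be interchanged with
  others.\<close>

definition answer_lists :: "nat set \<Rightarrow> nat \<Rightarrow> answer list set" where
  "answer_lists X k = {h. set h \<subseteq> insert None (Some ` X) \<and> length h \<le> k}"

lemma finite_answer_lists: "finite X \<Longrightarrow> finite (answer_lists X k)"
  unfolding answer_lists_def by (rule finite_lists_length_le) auto

lemma set_pmf_run_subset: "S \<subseteq> X \<Longrightarrow> set_pmf (run A S r k) \<subseteq> answer_lists X k"
  by (induction k)
    (auto simp: answer_lists_def set_pmf_interval_sample Let_def split: option.splits if_splits, force+)

lemma prob_run_sum:
  assumes "S \<subseteq> X" "finite X"
  shows "measure_pmf.prob (run A S r k) G = (\<Sum>h\<in>answer_lists X k. of_bool (h \<in> G) * pmf (run A S r k) h)"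
  unfolding prob_eq_expectation
  by (subst integral_measure_pmf_real[OF finite_answer_lists[OF assms(2), of k]])
    (use set_pmf_run_subset[OF assms(1), of A r k] in \<open>auto simp: indicator_def\<close>)

text \<open>An arbitrary algorithm may read infinitely many coins, so \<open>depends_below\<close>
  does not apply. But for each history the product formula is measurable in \<open>r\<close>, and
  there are finitely many histories.\<close>

lemma integrable_prob_run:
  assumes A: "interval_algorithm n A" and S: "finite S"
    and X: "\<And>h. (\<lambda>r. h \<in> X r) \<in> measurable coin_space (count_space UNIV)"
  shows "integrable coin_space (\<lambda>r. measure_pmf.prob (run A S r k) (X r))"
proof (rule coin.integrable_const_bound[where B = 1])
  have q: "(\<lambda>r. query A r h) \<in> measurable coin_space (count_space UNIV)" for h
    using A by (simp add: interval_algorithm_def)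
  have qF: "(\<lambda>r. F (query A r h)) \<in> measurable coin_space (count_space UNIV)" for h and F :: "_ \<Rightarrow> bool"
    by (rule measurable_compose[OF q]) simp
  have qR: "(\<lambda>r. F (query A r h)) \<in> borel_measurable coin_space" for h and F :: "_ \<Rightarrow> real"
    by (rule measurable_compose[OF q]) simp
  have R: "Measurable.pred coin_space (\<lambda>r. reached A r k h)" for h
    unfolding reached_def
    using qF[where F = "\<lambda>x. x \<noteq> None"] qF[where F = "\<lambda>x. x = None"]
    by (intro pred_intros_logic pred_intros_finite) auto
  have P: "(\<lambda>r. pmf (run A S r k) h) \<in> borel_measurable coin_space" for h
    unfolding pmf_run
    using R[of h] qR[where F = "\<lambda>x. pmf (interval_sample S (the x)) _"]
    by (intro borel_measurable_times borel_measurable_prod) (auto simp: of_bool_def)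
  show "(\<lambda>r. measure_pmf.prob (run A S r k) (X r)) \<in> borel_measurable coin_space"
    unfolding prob_run_sum[OF order_refl S]
    using X P by (intro borel_measurable_sum borel_measurable_times) (auto simp: of_bool_def)
qed (auto intro!: AE_I2)

abbreviation not_stopped :: "algo \<Rightarrow> coins \<Rightarrow> answer list set" where
  "not_stopped A r \<equiv> {h. query A r h \<noteq> None}"

abbreviation stopped_with :: "algo \<Rightarrow> (real \<Rightarrow> bool) \<Rightarrow> coins \<Rightarrow> answer list set" where
  "stopped_with A P r \<equiv> {h. query A r h = None \<and> P (estimate A r h)}"

lemma integrable_not_stopped:
  assumes "interval_algorithm n A" "finite S"
  shows "integrable coin_space (\<lambda>r. measure_pmf.prob (run A S r k) (not_stopped A r))"
proof (rule integrable_prob_run[OF assms])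
  fix h
  have "(\<lambda>r. query A r h) \<in> measurable coin_space (count_space UNIV)"
    using assms by (simp add: interval_algorithm_def)
  then show "(\<lambda>r. h \<in> not_stopped A r) \<in> measurable coin_space (count_space UNIV)"
    by (simp add: measurable_compose[where g = "\<lambda>x. x \<noteq> None"])
qed

lemma integrable_stopped_with:
  assumes "interval_algorithm n A" "finite S" "Measurable.pred borel P"
  shows "integrable coin_space (\<lambda>r. measure_pmf.prob (run A S r k) (stopped_with A P r))"
proof (rule integrable_prob_run[OF assms(1,2)])
  fix h
  have "(\<lambda>r. query A r h) \<in> measurable coin_space (count_space UNIV)"
    "(\<lambda>r. estimate A r h) \<in> borel_measurable coin_space"
    using assms by (auto simp: interval_algorithm_def)
  then have "Measurable.pred coin_space (\<lambda>r. query A r h = None)"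
    "Measurable.pred coin_space (\<lambda>r. P (estimate A r h))"
    using assms(3) by (auto intro: measurable_compose)
  then show "(\<lambda>r. h \<in> stopped_with A P r) \<in> measurable coin_space (count_space UNIV)"
    by simp
qed

lemma prob_stopped_Suc:
  "measure_pmf.prob (run A S r k) (stopped_with A P r)
    \<le> measure_pmf.prob (run A S r (Suc k)) (stopped_with A P r)"
  unfolding prob_eq_expectation expectation_run_Suc
  by (rule expectation_mono_finite[OF finite_set_pmf_run])
    (auto simp: indicator_def split: option.split intro!: Bochner_Integration.integral_nonneg)

lemma prob_not_stopped_Suc:
  "measure_pmf.prob (run A S r (Suc k)) (stopped_with A P r \<union> not_stopped A r)
    \<le> measure_pmf.prob (run A S r k) (stopped_with A P r \<union> not_stopped A r)"
  unfolding prob_eq_expectation expectation_run_Suc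
proof (rule expectation_mono_finite[OF finite_set_pmf_run])
  fix h
  have "measure_pmf.expectation (interval_sample S T)
      (\<lambda>a. indicat_real (stopped_with A P r \<union> not_stopped A r) (h @ [a])) \<le> 1" for T
    using measure_pmf.prob_le_1[of "map_pmf (\<lambda>a. h @ [a]) (interval_sample S T)" "stopped_with A P r \<union> not_stopped A r"]
    unfolding prob_eq_expectation integral_map_pmf .
  then show "(case query A r h of None \<Rightarrow> indicat_real (stopped_with A P r \<union> not_stopped A r) h
     | Some T \<Rightarrow> measure_pmf.expectation (interval_sample S T)
         (\<lambda>a. indicat_real (stopped_with A P r \<union> not_stopped A r) (h @ [a])))
     \<le> indicat_real (stopped_with A P r \<union> not_stopped A r) h"
    by (auto split: option.split)
qed

text \<open>Stopping is final: a run that ever stops with \<open>P\<close> has done so by time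
  \<open>m\<close> or is still running then. Going through \<open>max k m\<close> treats both orders
  of \<open>k\<close> and \<open>m\<close>.\<close>

lemma prob_stopped_le:
  "measure_pmf.prob (run A S r k) (stopped_with A P r)
    \<le> measure_pmf.prob (run A S r m) (stopped_with A P r) + measure_pmf.prob (run A S r m) (not_stopped A r)"
proof -
  let ?p = "\<lambda>k. measure_pmf.prob (run A S r k)"
  have mono: "i \<le> j \<Longrightarrow> ?p i (stopped_with A P r) \<le> ?p j (stopped_with A P r)" for i j
    by (rule lift_Suc_mono_le[of "\<lambda>k. ?p k (stopped_with A P r)"]) (rule prob_stopped_Suc)
  have anti: "i \<le> j \<Longrightarrow> ?p j (stopped_with A P r \<union> not_stopped A r) \<le> ?p i (stopped_with A P r \<union> not_stopped A r)" for i j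
    by (rule lift_Suc_antimono_le[of "\<lambda>k. ?p k (stopped_with A P r \<union> not_stopped A r)"]) (rule prob_not_stopped_Suc)
  have "?p k (stopped_with A P r) \<le> ?p (max k m) (stopped_with A P r \<union> not_stopped A r)"
    by (rule order_trans[OF mono[of k "max k m"]]) (auto intro: measure_pmf.finite_measure_mono)
  also have "\<dots> \<le> ?p m (stopped_with A P r \<union> not_stopped A r)" by (rule anti) simp
  also have "\<dots> \<le> ?p m (stopped_with A P r) + ?p m (not_stopped A r)"
    by (subst measure_pmf.finite_measure_Union) auto
  finally show ?thesis .
qed

lemma prob_output_le:
  assumes "interval_algorithm n A" "finite S" "Measurable.pred borel P"
  shows "prob_output A S P \<le>
    (\<integral>r. measure_pmf.prob (run A S r m) (stopped_with A P r) \<partial>coin_space) + prob_more_samples A S m"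
  unfolding prob_output_def
proof (rule cSUP_least)
  fix k
  note int = integrable_not_stopped[OF assms(1,2)] integrable_stopped_with[OF assms]
  have "(\<integral>r. measure_pmf.prob (run A S r k) (stopped_with A P r) \<partial>coin_space) \<le>
    (\<integral>r. measure_pmf.prob (run A S r m) (stopped_with A P r) + measure_pmf.prob (run A S r m) (not_stopped A r) \<partial>coin_space)"
    by (intro integral_mono int prob_stopped_le Bochner_Integration.integrable_add)
  also have "\<dots> = (\<integral>r. measure_pmf.prob (run A S r m) (stopped_with A P r) \<partial>coin_space) + prob_more_samples A S m"
    unfolding prob_more_samples_def by (rule Bochner_Integration.integral_add) (rule int)+
  finally show "(\<integral>r. measure_pmf.prob (run A S r k) (stopped_with A P r) \<partial>coin_space) \<le>
    (\<integral>r. measure_pmf.prob (run A S r m) (stopped_with A P r) \<partial>coin_space) + prob_more_samples A S m" .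
qed simp

lemma prob_more_samples_antimono:
  assumes "interval_algorithm n A" "finite S" "k \<le> m"
  shows "prob_more_samples A S m \<le> prob_more_samples A S k"
  unfolding prob_more_samples_def
proof (rule integral_mono)
  fix r
  \<comment> \<open>With the predicate \<open>False\<close>, the decreasing event of
    \<open>prob_not_stopped_Suc\<close> is that of still running.\<close>
  have "stopped_with A (\<lambda>_. False) r \<union> not_stopped A r = not_stopped A r" by auto
  then show "measure_pmf.prob (run A S r m) (not_stopped A r) \<le> measure_pmf.prob (run A S r k) (not_stopped A r)"
    using lift_Suc_antimono_le[of "\<lambda>k. measure_pmf.prob (run A S r k) (not_stopped A r)", OF _ assms(3)]
      prob_not_stopped_Suc[of A S r _ "\<lambda>_. False"] by simp
qed (rule integrable_not_stopped[OF assms(1,2)])+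

section \<open>Sets with one element per group against the whole block\<close>

context
  fixes s w :: nat
begin

text \<open>Group \<open>j < w\<close> consists of the five indices from \<open>s + 1 + 5 * j\<close> on, and \<open>f\<close> chooses one of them.\<close>

definition slots :: "nat set" where "slots = {s + 1..s + 5 * w}"

definition planted :: "(nat \<Rightarrow> nat) \<Rightarrow> nat set" where
  "planted f = (\<lambda>j. s + 1 + 5 * j + f j) ` {..<w}"

definition slot_group :: "nat \<Rightarrow> nat" where "slot_group y = (y - s - 1) div 5"

definition slot_offset :: "nat \<Rightarrow> nat" where "slot_offset y = (y - s - 1) mod 5"

definition choices :: "(nat \<Rightarrow> nat) set" where "choices = PiE {..<w} (\<lambda>_. {..<5})"

text \<open>The answer to such a query is surely \<open>None\<close> or a uniform element of the
  hidden set, for every nonempty hidden set inside the block.\<close>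

definition uncut :: "nat \<times> nat \<Rightarrow> bool" where
  "uncut T \<longleftrightarrow> slots \<subseteq> {fst T..snd T} \<or> {fst T..snd T} \<inter> slots = {}"

text \<open>Seeing the same element twice counts as well. Without a collision, every element seen
  reveals the offset in a new group.\<close>

definition collision :: "answer list \<Rightarrow> bool" where
  "collision h \<longleftrightarrow> (\<exists>i<length h. \<exists>i'<i. h ! i \<noteq> None \<and> h ! i' \<noteq> None \<and>
     slot_group (the (h ! i)) = slot_group (the (h ! i')))"

lemma finite_choices: "finite choices" and card_choices: "card choices = 5 ^ w"
  by (auto simp: choices_def card_PiE finite_PiE)

lemma slot_group_less: "y \<in> slots \<Longrightarrow> slot_group y < w"
  by (auto simp: slots_def slot_group_def) 

lemma slot_group_planted:
  "f \<in> choices \<Longrightarrow> j < w \<Longrightarrow> slot_group (s + 1 + 5 * j + f j) = j"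
  "f \<in> choices \<Longrightarrow> j < w \<Longrightarrow> slot_offset (s + 1 + 5 * j + f j) = f j"
  by (auto simp: slot_group_def slot_offset_def choices_def PiE_def Pi_def)

lemma slot_eq: "y \<in> slots \<Longrightarrow> y = s + 1 + 5 * slot_group y + slot_offset y"
  by (auto simp: slots_def slot_group_def slot_offset_def)

lemma planted_subset:
  assumes "f \<in> choices"
  shows "planted f \<subseteq> slots"
proof
  fix y assume "y \<in> planted f"
  then obtain j where j: "j < w" "y = s + 1 + 5 * j + f j" by (auto simp: planted_def)
  have "f j < 5" using assms j by (auto simp: choices_def PiE_def Pi_def)
  then show "y \<in> slots" using j by (auto simp: slots_def)
qed

lemma planted_iff:
  assumes "f \<in> choices" "y \<in> slots"
  shows "y \<in> planted f \<longleftrightarrow> f (slot_group y) = slot_offset y"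
proof
  assume "y \<in> planted f"
  then show "f (slot_group y) = slot_offset y"
    using slot_group_planted[OF assms(1)] by (auto simp: planted_def)
next
  assume "f (slot_group y) = slot_offset y"
  then show "y \<in> planted f"
    using slot_eq[OF assms(2)] slot_group_less[OF assms(2)] unfolding planted_def
    by (intro image_eqI[where x = "slot_group y"]) auto
qed

lemma card_planted:
  assumes "f \<in> choices"
  shows "card (planted f) = w"
proof -
  have "inj_on (\<lambda>j. s + 1 + 5 * j + f j) {..<w}"
    using slot_group_planted(1)[OF assms] by (intro inj_on_inverseI[where g = slot_group]) auto
  then show ?thesis by (simp add: planted_def card_image)
qed

lemma inj_on_slot_group_planted:
  assumes "f \<in> choices"
  shows "inj_on slot_group (planted f)"
  using slot_group_planted(1)[OF assms]
  by (intro inj_on_inverseI[where g = "\<lambda>j. s + 1 + 5 * j + f j"]) (auto simp: planted_def)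

lemma pmf_interval_sample_uncut:
  assumes "uncut T" "X \<subseteq> slots" "X \<noteq> {}"
  shows "pmf (interval_sample X T) a =
    (if slots \<subseteq> {fst T..snd T} then (case a of None \<Rightarrow> 0 | Some y \<Rightarrow> of_bool (y \<in> X) / card X)
     else of_bool (a = None))"
proof (cases "slots \<subseteq> {fst T..snd T}")
  case True
  then have I: "{fst T..snd T} \<inter> X = X" using assms by auto
  have fin: "finite X" using assms(2) finite_subset[of X slots] by (simp add: slots_def)
  have "pmf (map_pmf Some (pmf_of_set X)) a = (case a of None \<Rightarrow> 0 | Some y \<Rightarrow> of_bool (y \<in> X) / card X)"
  proof (cases a)
    case None
    then show ?thesis by (auto simp: pmf_eq_0_set_pmf)
  next
    case (Some y)
    have "pmf (map_pmf Some (pmf_of_set X)) (Some y) = pmf (pmf_of_set X) y"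
      by (rule pmf_map_inj') simp
    then show ?thesis using Some assms(3) fin by (simp add: indicator_def)
  qed
  then show ?thesis using True assms(3) by (simp add: interval_sample_def I)
next
  case False
  then have "{fst T..snd T} \<inter> X = {}" using assms by (auto simp: uncut_def)
  then show ?thesis using False by (auto simp: interval_sample_def)
qed

lemma card_slots: "card slots = 5 * w"
  by (simp add: slots_def)

text \<open>Each prescribed value leaves at most one of five choices in its coordinate; it leaves
  none if \<open>v i\<close> is 5 or more, hence an inequality.\<close>

lemma card_choices_constrained:
  assumes J: "finite J" and g: "inj_on g J" "g ` J \<subseteq> {..<w}"
  shows "real (card {f \<in> choices. \<forall>i\<in>J. f (g i) = v i}) \<le> 5 ^ w / 5 ^ card J"
proof -
  define u where "u j = v (the_inv_into J g j)" for j
  have "{f \<in> choices. \<forall>i\<in>J. f (g i) = v i} \<subseteq> PiE {..<w} (\<lambda>j. if j \<in> g ` J then {u j} else {..<5})"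
  proof
    fix f assume f: "f \<in> {f \<in> choices. \<forall>i\<in>J. f (g i) = v i}"
    then have "f (g i) = u (g i)" if "i \<in> J" for i
      using that g by (simp add: u_def the_inv_into_f_f)
    then show "f \<in> PiE {..<w} (\<lambda>j. if j \<in> g ` J then {u j} else {..<5})"
      using f by (auto simp: choices_def PiE_def Pi_def)
  qed
  then have "card {f \<in> choices. \<forall>i\<in>J. f (g i) = v i} \<le> card (PiE {..<w} (\<lambda>j. if j \<in> g ` J then {u j} else {..<5}))"
    by (intro card_mono finite_PiE) auto
  also have "\<dots> = (\<Prod>j<w. if j \<in> g ` J then 1 else 5)"
    by (subst card_PiE) (auto intro!: prod.cong)
  also have "\<dots> = 5 ^ card ({..<w} - g ` J)"
  proof -
    have "{..<w} \<inter> {j. j \<notin> g ` J} = {..<w} - g ` J" by auto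
    then show ?thesis by (simp add: prod.If_cases Diff_eq Compl_eq)
  qed
  also have "card ({..<w} - g ` J) = w - card J"
    using g J by (simp add: card_Diff_subset card_image)
  finally have "real (card {f \<in> choices. \<forall>i\<in>J. f (g i) = v i}) \<le> real (5 ^ (w - card J))"
    by (rule of_nat_mono)
  also have "\<dots> = 5 ^ w / 5 ^ card J"
  proof -
    have "card J \<le> w"
      using card_mono[OF finite_lessThan g(2)] g(1) by (simp add: card_image)
    then have "(5::real) ^ (w - card J) = 5 ^ w / 5 ^ card J" by (rule power_diff[rotated]) simp
    then show ?thesis by simp
  qed
  finally show ?thesis .
qed

text \<open>Averaged over \<open>f\<close>, an answer from \<open>planted f\<close> has the same distribution as one from
  \<open>slots\<close>; answers from different groups are independent, which fails as soon as groups collide.\<close>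

lemma sum_prod_planted_le_slots:
  assumes w: "1 \<le> w" and T: "\<And>i. i < length h \<Longrightarrow> uncut (T i)" and h: "\<not> collision h"
  shows "(\<Sum>f\<in>choices. \<Prod>i<length h. pmf (interval_sample (planted f) (T i)) (h ! i))
    \<le> 5 ^ w * (\<Prod>i<length h. pmf (interval_sample slots (T i)) (h ! i))"
proof (cases "\<exists>i<length h. pmf (interval_sample slots (T i)) (h ! i) = 0")
  case True
  then obtain i where i: "i < length h" "pmf (interval_sample slots (T i)) (h ! i) = 0" by blast
  \<comment> \<open>An answer that is impossible for the whole block is impossible for its subsets,
    so the left-hand side vanishes.\<close>
  have "pmf (interval_sample (planted f) (T i)) (h ! i) = 0" if f: "f \<in> choices" for f
    using i(2) w planted_subset[OF f] card_planted[OF f] card_slots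
      pmf_interval_sample_uncut[OF T[OF i(1)], of slots "h ! i"]
      pmf_interval_sample_uncut[OF T[OF i(1)], of "planted f" "h ! i"]
    by (fastforce split: if_splits option.splits)
  then have "(\<Sum>f\<in>choices. \<Prod>i<length h. pmf (interval_sample (planted f) (T i)) (h ! i)) = 0"
    using i(1) by (intro sum.neutral ballI prod_zero) auto
  moreover have "0 \<le> (5::real) ^ w * (\<Prod>i<length h. pmf (interval_sample slots (T i)) (h ! i))"
    by (intro mult_nonneg_nonneg prod_nonneg) auto
  ultimately show ?thesis by simp
next
  case False
  then have nz: "pmf (interval_sample slots (T i)) (h ! i) \<noteq> 0" if "i < length h" for i using that by auto
  \<comment> \<open>The queries that contain the block; the others answer \<open>None\<close> with
    certainty and contribute a factor 1.\<close>
  define J where "J = {i. i < length h \<and> slots \<subseteq> {fst (T i)..snd (T i)}}"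
  define g where "g i = slot_group (the (h ! i))" for i
  define v where "v i = slot_offset (the (h ! i))" for i
  have fJ: "finite J" by (simp add: J_def)
  have sl: "slots \<noteq> {}" using w by (simp add: slots_def)
  have B: "pmf (interval_sample slots (T i)) (h ! i) = (if i \<in> J then 1 / (5 * real w) else 1) \<and>
      (if i \<in> J then h ! i \<noteq> None \<and> the (h ! i) \<in> slots else h ! i = None)" if "i < length h" for i
    using nz[OF that] pmf_interval_sample_uncut[OF T[OF that] order_refl sl, of "h ! i"] that
    by (auto simp: J_def card_slots split: option.splits if_splits)
  have P: "pmf (interval_sample (planted f) (T i)) (h ! i) = (if i \<in> J then of_bool (f (g i) = v i) / real w else 1)"
    if i: "i < length h" and f: "f \<in> choices" for i f
  proof -
    have "planted f \<noteq> {}" using card_planted[OF f] w by auto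
    then show ?thesis
      using B[OF i] pmf_interval_sample_uncut[OF T[OF i] planted_subset[OF f], of "h ! i"] i
        planted_iff[OF f, of "the (h ! i)"] card_planted[OF f]
      by (auto simp: J_def g_def v_def split: if_splits)
  qed
  have restrict: "(\<Prod>i<length h. if i \<in> J then q i else 1) = (\<Prod>i\<in>J. q i)" for q :: "nat \<Rightarrow> real"
  proof -
    have "{..<length h} \<inter> {i. i \<in> J} = J" by (auto simp: J_def)
    then show ?thesis by (simp add: prod.If_cases)
  qed
  have inj: "inj_on g J"
  proof (rule inj_onI, rule ccontr)
    fix i i' assume *: "i \<in> J" "i' \<in> J" "g i = g i'" "i \<noteq> i'"
    have "a \<in> J \<Longrightarrow> b \<in> J \<Longrightarrow> a < b \<Longrightarrow> g a = g b \<Longrightarrow> collision h" for a b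
      using B[of a] B[of b] unfolding collision_def g_def J_def by (metis (mono_tags, lifting) mem_Collect_eq)
    from this[of i i'] this[of i' i] * h show False by (metis nat_neq_iff)
  qed
  have sub: "g ` J \<subseteq> {..<w}"
    using B slot_group_less by (auto simp: g_def J_def split: if_splits)
  have "(\<Sum>f\<in>choices. \<Prod>i<length h. pmf (interval_sample (planted f) (T i)) (h ! i))
     = (\<Sum>f\<in>choices. \<Prod>i\<in>J. of_bool (f (g i) = v i) / real w)"
    unfolding restrict[symmetric] by (intro sum.cong prod.cong refl) (simp add: P)
  also have "\<dots> = (\<Sum>f\<in>choices. of_bool (\<forall>i\<in>J. f (g i) = v i) / real w ^ card J)"
  proof (rule sum.cong)
    fix f
    have "(\<Prod>i\<in>J. of_bool (f (g i) = v i)) = (of_bool (\<forall>i\<in>J. f (g i) = v i) :: real)"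
      using fJ by (induction J rule: finite_induct) auto
    then show "(\<Prod>i\<in>J. of_bool (f (g i) = v i) / real w) = of_bool (\<forall>i\<in>J. f (g i) = v i) / real w ^ card J"
      by (simp add: prod_dividef)
  qed simp
  also have "\<dots> = real (card {f \<in> choices. \<forall>i\<in>J. f (g i) = v i}) / real w ^ card J"
    using finite_choices by (simp add: sum_divide_distrib[symmetric] Int_def)
  also have "\<dots> \<le> (5 ^ w / 5 ^ card J) / real w ^ card J"
    by (intro divide_right_mono card_choices_constrained[OF fJ inj sub]) simp
  \<comment> \<open>A group is hit with probability \<open>1 / w\<close>, and its offset agrees for
    one in five choices; together this is the probability \<open>1 / (5 * w)\<close> of an element
    of the block.\<close>
  also have "\<dots> = 5 ^ w * (\<Prod>i\<in>J. 1 / (5 * real w))"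
    by (simp add: power_mult_distrib power_divide)
  also have "\<dots> = 5 ^ w * (\<Prod>i<length h. pmf (interval_sample slots (T i)) (h ! i))"
    unfolding restrict[symmetric] by (intro arg_cong2[where f = "(*)"] prod.cong refl) (simp add: B)
  finally show ?thesis .
qed

lemma collision_snoc:
  "collision (h @ [a]) \<longleftrightarrow> collision h \<or>
    (a \<noteq> None \<and> (\<exists>i<length h. h ! i \<noteq> None \<and> slot_group (the a) = slot_group (the (h ! i))))"
proof -
  define Q where "Q x y \<longleftrightarrow> x \<noteq> None \<and> y \<noteq> None \<and> slot_group (the x) = slot_group (the y)" for x y
  have C: "collision l \<longleftrightarrow> (\<exists>i<length l. \<exists>i'<i. Q (l ! i) (l ! i'))" for l
    by (simp add: collision_def Q_def)
  have E: "(\<exists>i'<i. Q ((h @ [a]) ! i) ((h @ [a]) ! i')) \<longleftrightarrow> (\<exists>i'<i. Q (h ! i) (h ! i'))" if "i < length h" for i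
    using that by (intro ex_cong1 conj_cong refl) (simp add: nth_append)
  have "(\<exists>i<length h. \<exists>i'<i. Q ((h @ [a]) ! i) ((h @ [a]) ! i')) \<longleftrightarrow> collision h"
    unfolding C by (rule ex_cong1, rule conj_cong[OF refl], rule E)
  moreover have "(\<exists>i'<length h. Q ((h @ [a]) ! length h) ((h @ [a]) ! i')) \<longleftrightarrow> (\<exists>i'<length h. Q a (h ! i'))"
    by (intro ex_cong1 conj_cong refl) (simp add: nth_append)
  moreover have "collision (h @ [a]) \<longleftrightarrow> (\<exists>i'<length h. Q ((h @ [a]) ! length h) ((h @ [a]) ! i')) \<or>
      (\<exists>i<length h. \<exists>i'<i. Q ((h @ [a]) ! i) ((h @ [a]) ! i'))"
    unfolding C length_append_singleton Ex_less_Suc by blast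
  ultimately show ?thesis unfolding Q_def by blast
qed

text \<open>\<open>planted f\<close> has one element in each group, so at most
  \<open>length h\<close> of its \<open>w\<close> equally likely elements lie in groups already
  seen.\<close>

lemma prob_collision_step:
  assumes w: "1 \<le> w" and T: "uncut T" and f: "f \<in> choices" and h: "\<not> collision h"
  shows "measure_pmf.expectation (interval_sample (planted f) T) (\<lambda>a. of_bool (collision (h @ [a])))
    \<le> real (length h) / real w"
proof (cases "slots \<subseteq> {fst T..snd T}")
  case False
  then have "{fst T..snd T} \<inter> planted f = {}"
    using T planted_subset[OF f] by (auto simp: uncut_def)
  then have "interval_sample (planted f) T = return_pmf None" by (simp add: interval_sample_def)
  then show ?thesis using h by (simp add: collision_snoc expectation_return_pmf)
next
  case True
  then have I: "{fst T..snd T} \<inter> planted f = planted f" using planted_subset[OF f] by auto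
  have ne: "planted f \<noteq> {}" "finite (planted f)" using card_planted[OF f] w by (auto simp: planted_def)
  let ?X = "{y \<in> planted f. collision (h @ [Some y])}"
  have "slot_group ` ?X \<subseteq> (\<lambda>i. slot_group (the (h ! i))) ` {..<length h}"
    using h by (auto simp: collision_snoc)
  then have "card (slot_group ` ?X) \<le> card ((\<lambda>i. slot_group (the (h ! i))) ` {..<length h})"
    by (intro card_mono) auto
  also have "\<dots> \<le> length h" using card_image_le[of "{..<length h}"] by simp
  finally have "card ?X \<le> length h"
    using inj_on_subset[OF inj_on_slot_group_planted[OF f], of ?X] by (simp add: card_image)
  have "measure_pmf.expectation (interval_sample (planted f) T) (\<lambda>a. of_bool (collision (h @ [a])))
     = (\<Sum>y\<in>planted f. of_bool (collision (h @ [Some y]))) / real w"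
    using expectation_interval_sample[of "planted f" "fst T" "snd T" "\<lambda>a. of_bool (collision (h @ [a]))"]
      ne card_planted[OF f] by (simp add: I)
  also have "\<dots> = real (card ?X) / real w" using ne by (simp add: Int_def)
  also have "\<dots> \<le> real (length h) / real w" using \<open>card ?X \<le> length h\<close> by (intro divide_right_mono) auto
  finally show ?thesis .
qed

text \<open>Union bound over the samples; \<open>m\<close> bounds the length of every history met,
  so each sample contributes at most \<open>m / w\<close>.\<close>

lemma prob_collision:
  assumes w: "1 \<le> w" and f: "f \<in> choices"
    and A: "\<And>h T. query A r h = Some T \<Longrightarrow> length h < m \<Longrightarrow> uncut T"
  shows "k \<le> m \<Longrightarrow> measure_pmf.prob (run A (planted f) r k) {h. collision h} \<le> real k * real m / real w"
proof (induction k)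
  case 0
  then show ?case by (simp add: collision_def)
next
  case (Suc k)
  have "measure_pmf.prob (run A (planted f) r (Suc k)) {h. collision h}
     = measure_pmf.expectation (run A (planted f) r (Suc k)) (\<lambda>h. of_bool (collision h))"
    unfolding prob_eq_expectation by (rule Bochner_Integration.integral_cong) (auto simp: indicator_def)
  also have "\<dots> \<le> measure_pmf.expectation (run A (planted f) r k) (\<lambda>h. of_bool (collision h) + real m / real w)"
    unfolding expectation_run_Suc
  proof (rule expectation_mono_finite[OF finite_set_pmf_run])
    fix h assume h: "h \<in> set_pmf (run A (planted f) r k)"
    show "(case query A r h of None \<Rightarrow> of_bool (collision h)
         | Some T \<Rightarrow> measure_pmf.expectation (interval_sample (planted f) T) (\<lambda>a. of_bool (collision (h @ [a]))))
       \<le> of_bool (collision h) + real m / real w"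
    proof (cases "query A r h")
      case (Some T)
      then have len: "length h = k" using length_run(2)[OF h] by simp
      have T: "uncut T" using A[OF Some] len Suc.prems by simp
      show ?thesis
      proof (cases "collision h")
        case True
        have "measure_pmf.expectation (interval_sample (planted f) T) (\<lambda>a. 1) = (1::real)" by simp
        then show ?thesis using True Some by (simp add: collision_snoc)
      next
        case False
        have "real (length h) / real w \<le> real m / real w"
          using len Suc.prems by (intro divide_right_mono) auto
        then show ?thesis using prob_collision_step[OF w T f False] False Some by simp
      qed
    qed simp
  qed
  also have "\<dots> = measure_pmf.expectation (run A (planted f) r k) (\<lambda>h. of_bool (collision h)) + real m / real w"
    by (subst Bochner_Integration.integral_add) (auto intro!: integrable_measure_pmf_finite finite_set_pmf_run)
  also have "measure_pmf.expectation (run A (planted f) r k) (\<lambda>h. of_bool (collision h))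
     = measure_pmf.prob (run A (planted f) r k) {h. collision h}"
    unfolding prob_eq_expectation by (rule Bochner_Integration.integral_cong) (auto simp: indicator_def)
  finally show ?case using Suc by (simp add: add_divide_distrib distrib_right)
qed

text \<open>Histories without collision are compared one at a time; the others together have
  probability at most \<open>m\<^sup>2 / w\<close>.\<close>

lemma sum_prob_planted_le_slots:
  assumes w: "1 \<le> w" and A: "\<And>h T. query A r h = Some T \<Longrightarrow> T = q (length h)"
    and q: "\<And>i. i < m \<Longrightarrow> uncut (q i)"
  shows "(\<Sum>f\<in>choices. measure_pmf.prob (run A (planted f) r m) G)
    \<le> 5 ^ w * (measure_pmf.prob (run A slots r m) G + (real m)\<^sup>2 / real w)"
proof -
  let ?U = "answer_lists slots m"
  let ?G = "{h \<in> G. \<not> collision h}"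
  have fin: "finite slots" by (simp add: slots_def)
  have 1: "measure_pmf.prob (run A (planted f) r m) G
     \<le> measure_pmf.prob (run A (planted f) r m) ?G + (real m)\<^sup>2 / real w" if f: "f \<in> choices" for f
  proof -
    have "measure_pmf.prob (run A (planted f) r m) G
       \<le> measure_pmf.prob (run A (planted f) r m) (?G \<union> {h. collision h})"
      by (rule measure_pmf.finite_measure_mono) auto
    also have "\<dots> = measure_pmf.prob (run A (planted f) r m) ?G + measure_pmf.prob (run A (planted f) r m) {h. collision h}"
      by (rule measure_pmf.finite_measure_Union) auto
    also have "measure_pmf.prob (run A (planted f) r m) {h. collision h} \<le> real m * real m / real w"
      proof (rule prob_collision[OF w f])
      fix h T assume "query A r h = Some T" "length h < m"
      then show "uncut T" using A[of h T] q[of "length h"] by simp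
    qed simp
    finally show ?thesis by (simp add: power2_eq_square)
  qed
  have 2: "(\<Sum>f\<in>choices. pmf (run A (planted f) r m) h) \<le> 5 ^ w * pmf (run A slots r m) h"
    if h: "\<not> collision h" for h
  proof (cases "reached A r m h")
    case True
    have Q: "the (query A r (take i h)) = q i" if i: "i < length h" for i
    proof -
      have "query A r (take i h) \<noteq> None" using True i unfolding reached_def by blast
      then obtain T where "query A r (take i h) = Some T" by blast
      then show ?thesis using A[of "take i h" T] i by simp
    qed
    have "length h \<le> m" using True by (auto simp: reached_def)
    then show ?thesis
      using sum_prod_planted_le_slots[OF w _ h, of q] q True by (simp add: pmf_run Q)
  qed (simp add: pmf_run)
  have "(\<Sum>f\<in>choices. measure_pmf.prob (run A (planted f) r m) ?G)
     = (\<Sum>f\<in>choices. \<Sum>h\<in>?U. of_bool (h \<in> ?G) * pmf (run A (planted f) r m) h)"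
    by (intro sum.cong refl prob_run_sum planted_subset fin)
  also have "\<dots> = (\<Sum>h\<in>?U. of_bool (h \<in> ?G) * (\<Sum>f\<in>choices. pmf (run A (planted f) r m) h))"
    by (subst sum.swap) (simp add: sum_distrib_left)
  also have "\<dots> \<le> (\<Sum>h\<in>?U. of_bool (h \<in> G) * (5 ^ w * pmf (run A slots r m) h))"
    by (rule sum_mono) (use 2 in \<open>auto simp: of_bool_def\<close>)
  also have "\<dots> = 5 ^ w * measure_pmf.prob (run A slots r m) G"
    by (subst prob_run_sum[OF order_refl fin]) (simp add: sum_distrib_left ac_simps)
  finally have 3: "(\<Sum>f\<in>choices. measure_pmf.prob (run A (planted f) r m) ?G)
     \<le> 5 ^ w * measure_pmf.prob (run A slots r m) G" .
  have "(\<Sum>f\<in>choices. measure_pmf.prob (run A (planted f) r m) G)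
     \<le> (\<Sum>f\<in>choices. measure_pmf.prob (run A (planted f) r m) ?G + (real m)\<^sup>2 / real w)"
    by (rule sum_mono) (rule 1)
  also have "\<dots> = (\<Sum>f\<in>choices. measure_pmf.prob (run A (planted f) r m) ?G) + 5 ^ w * ((real m)\<^sup>2 / real w)"
    by (simp add: sum.distrib card_choices)
  finally show ?thesis using 3 by (simp add: distrib_left)
qed

end

text \<open>An interval that meets a block without containing it has an end point in that block; the
  two quotients are the indices of the blocks of the end points.\<close>

lemma card_cut_le:
  assumes w: "1 \<le> w"
  shows "card {b \<in> {..<nb}. \<not> uncut (5 * w * b) w T} \<le> 2"
proof -
  have "{b \<in> {..<nb}. \<not> uncut (5 * w * b) w T} \<subseteq> {(fst T - 1) div (5 * w), (snd T - 1) div (5 * w)}"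
  proof
    fix b assume "b \<in> {b \<in> {..<nb}. \<not> uncut (5 * w * b) w T}"
    then obtain x y where xy: "x \<in> slots (5 * w * b) w" "x \<in> {fst T..snd T}"
      "y \<in> slots (5 * w * b) w" "y \<notin> {fst T..snd T}"
      unfolding uncut_def by blast
    have slot: "(z - 1) div (5 * w) = b" if "5 * w * b < z" "z \<le> 5 * w * b + 5 * w" for z
    proof (rule div_nat_eqI)
      show "5 * w * b \<le> z - 1" "z - 1 < 5 * w * Suc b" using that by (auto simp: algebra_simps)
    qed
    from xy have "y < fst T \<or> snd T < y" by auto
    then show "b \<in> {(fst T - 1) div (5 * w), (snd T - 1) div (5 * w)}"
    proof
      assume "y < fst T"
      then have "(fst T - 1) div (5 * w) = b" using xy by (intro slot) (auto simp: slots_def)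
      then show ?thesis by simp
    next
      assume "snd T < y"
      then have "(snd T - 1) div (5 * w) = b" using xy by (intro slot) (auto simp: slots_def)
      then show ?thesis by simp
    qed
  qed
  then have "card {b \<in> {..<nb}. \<not> uncut (5 * w * b) w T} \<le> card {(fst T - 1) div (5 * w), (snd T - 1) div (5 * w)}"
    by (intro card_mono) auto
  also have "\<dots> \<le> 2" by (simp add: card_insert_if)
  finally show ?thesis .
qed

text \<open>Here non-adaptivity enters: for fixed coins the \<open>m\<close> queries are the same
  for every hidden set and cut at most \<open>2 * m\<close> blocks. In those the trivial bound 1 is
  used.\<close>

lemma sum_blocks_le:
  assumes w: "1 \<le> w" and A: "\<And>h T. query A r h = Some T \<Longrightarrow> T = q (length h)"
  shows "(\<Sum>b<nb. \<Sum>f\<in>choices w. measure_pmf.prob (run A (planted (5 * w * b) w f) r m) G)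
    \<le> 5 ^ w * ((\<Sum>b<nb. measure_pmf.prob (run A (slots (5 * w * b) w) r m) G)
        + real nb * ((real m)\<^sup>2 / real w) + 2 * real m)"
proof -
  define Bd where "Bd = {b \<in> {..<nb}. \<exists>i<m. \<not> uncut (5 * w * b) w (q i)}"
  have "Bd = (\<Union>i<m. {b \<in> {..<nb}. \<not> uncut (5 * w * b) w (q i)})" by (auto simp: Bd_def)
  then have "card Bd \<le> (\<Sum>i<m. card {b \<in> {..<nb}. \<not> uncut (5 * w * b) w (q i)})"
    using card_UN_le[of "{..<m}"] by simp
  also have "\<dots> \<le> (\<Sum>i<m. 2)" by (intro sum_mono card_cut_le w)
  finally have Bd: "card Bd \<le> 2 * m" by simp
  have "(\<Sum>b<nb. \<Sum>f\<in>choices w. measure_pmf.prob (run A (planted (5 * w * b) w f) r m) G)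
    \<le> (\<Sum>b<nb. 5 ^ w * (measure_pmf.prob (run A (slots (5 * w * b) w) r m) G + (real m)\<^sup>2 / real w + of_bool (b \<in> Bd)))"
  proof (rule sum_mono)
    fix b assume b: "b \<in> {..<nb}"
    show "(\<Sum>f\<in>choices w. measure_pmf.prob (run A (planted (5 * w * b) w f) r m) G)
      \<le> 5 ^ w * (measure_pmf.prob (run A (slots (5 * w * b) w) r m) G + (real m)\<^sup>2 / real w + of_bool (b \<in> Bd))"
    proof (cases "b \<in> Bd")
      case True
      have "(\<Sum>f\<in>choices w. measure_pmf.prob (run A (planted (5 * w * b) w f) r m) G) \<le> (\<Sum>f\<in>choices w. 1)"
        by (rule sum_mono) simp
      also have "\<dots> = 5 ^ w * 1" by (simp add: card_choices)
      also have "\<dots> \<le> 5 ^ w * (measure_pmf.prob (run A (slots (5 * w * b) w) r m) G + (real m)\<^sup>2 / real w + of_bool (b \<in> Bd))"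
        using True by (intro mult_left_mono) auto
      finally show ?thesis .
    next
      case False
      then have u: "\<And>i. i < m \<Longrightarrow> uncut (5 * w * b) w (q i)" using b by (auto simp: Bd_def)
      from False show ?thesis using sum_prob_planted_le_slots[where q = q, OF w A u, where G = G] by simp
    qed
  qed
  also have "\<dots> = 5 ^ w * ((\<Sum>b<nb. measure_pmf.prob (run A (slots (5 * w * b) w) r m) G)
        + real nb * ((real m)\<^sup>2 / real w) + (\<Sum>b<nb. of_bool (b \<in> Bd)))"
    by (simp add: sum_distrib_left[symmetric] sum.distrib)
  also have "(\<Sum>b<nb. of_bool (b \<in> Bd)) = real (card Bd)"
  proof -
    have "{..<nb} \<inter> Bd = Bd" by (auto simp: Bd_def)
    then show ?thesis by simp
  qed
  also have "5 ^ w * ((\<Sum>b<nb. measure_pmf.prob (run A (slots (5 * w * b) w) r m) G)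
        + real nb * ((real m)\<^sup>2 / real w) + real (card Bd)) \<le> 5 ^ w * ((\<Sum>b<nb. measure_pmf.prob (run A (slots (5 * w * b) w) r m) G)
        + real nb * ((real m)\<^sup>2 / real w) + 2 * real m)"
    using Bd by (intro mult_left_mono add_left_mono) (auto simp: of_nat_le_iff[symmetric, where 'a = real] simp del: of_nat_le_iff)
  finally show ?thesis .
qed

section \<open>The contradiction from too few samples\<close>

locale size_approximator =
  fixes n :: nat and \<epsilon> :: real and A :: algo
  assumes eps: "0 < \<epsilon>" "\<epsilon> \<le> 1" and approx: "size_approximation n \<epsilon> A"
begin

definition good :: "nat \<Rightarrow> real \<Rightarrow> bool" where
  "good w x \<longleftrightarrow> 1 / (1 + \<epsilon>) * real w \<le> x \<and> x \<le> (1 + \<epsilon>) * real w"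

text \<open>\<open>w\<close> may differ from \<open>card S\<close>: the argument asks how often an
  output suitable for \<open>w\<close> is given on a set of size \<open>5 * w\<close>.\<close>

definition success :: "nat \<Rightarrow> nat set \<Rightarrow> nat \<Rightarrow> real" where
  "success w S m = (\<integral>r. measure_pmf.prob (run A S r m) (stopped_with A (good w) r) \<partial>coin_space)"

lemma interval_A: "interval_algorithm n A"
  using approx by (simp add: size_approximation_def)

lemma pred_good: "Measurable.pred borel (good w)"
  unfolding good_def by measurable

lemma integrable_good:
  "finite S \<Longrightarrow> integrable coin_space (\<lambda>r. measure_pmf.prob (run A S r m) (stopped_with A (good w) r))"
  by (rule integrable_stopped_with[OF interval_A _ pred_good])

lemma success_ge:
  assumes "S \<subseteq> {1..n}"
  shows "2 / 3 \<le> success (card S) S m + prob_more_samples A S m"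
proof -
  have "finite S" using assms finite_subset by auto
  have "2 / 3 \<le> prob_output A S (good (card S))"
    using approx assms by (simp add: size_approximation_def good_def[abs_def])
  also have "\<dots> \<le> success (card S) S m + prob_more_samples A S m"
    unfolding success_def by (rule prob_output_le[OF interval_A \<open>finite S\<close> pred_good])
  finally show ?thesis .
qed

text \<open>Success intervals for sizes more than a factor \<open>(1 + \<epsilon>)\<^sup>2\<close> apart are disjoint.\<close>

lemma success_add_le:
  assumes "finite S" "(1 + \<epsilon>) * ((1 + \<epsilon>) * real w) < real w'"
  shows "success w S m + success w' S m + prob_more_samples A S m \<le> 1"
proof -
  let ?p = "\<lambda>r. measure_pmf.prob (run A S r m)"
  have disj: "\<not> (good w x \<and> good w' x)" for x
  proof
    assume *: "good w x \<and> good w' x"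
    then have "real w' \<le> (1 + \<epsilon>) * x" using eps by (auto simp: good_def field_simps)
    also have "\<dots> \<le> (1 + \<epsilon>) * ((1 + \<epsilon>) * real w)"
      using * eps by (intro mult_left_mono) (auto simp: good_def)
    finally show False using assms(2) by simp
  qed
  have "?p r (stopped_with A (good w) r) + ?p r (stopped_with A (good w') r) + ?p r (not_stopped A r) \<le> 1" for r
  proof -
    have "?p r (stopped_with A (good w) r) + ?p r (stopped_with A (good w') r) + ?p r (not_stopped A r)
      = ?p r (stopped_with A (good w) r \<union> stopped_with A (good w') r) + ?p r (not_stopped A r)"
      by (subst measure_pmf.finite_measure_Union) (use disj in auto)
    also have "\<dots> = ?p r (stopped_with A (good w) r \<union> stopped_with A (good w') r \<union> not_stopped A r)"
      by (subst measure_pmf.finite_measure_Union) auto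
    finally show ?thesis by simp
  qed
  then have "(\<integral>r. ?p r (stopped_with A (good w) r) + ?p r (stopped_with A (good w') r) + ?p r (not_stopped A r) \<partial>coin_space) \<le> 1"
    by (rule coin_integral_le_1)
  moreover have "(\<integral>r. ?p r (stopped_with A (good w) r) + ?p r (stopped_with A (good w') r) + ?p r (not_stopped A r) \<partial>coin_space)
     = success w S m + success w' S m + prob_more_samples A S m"
    unfolding success_def prob_more_samples_def
    by (simp only: Bochner_Integration.integral_add Bochner_Integration.integrable_add
        integrable_good[OF assms(1)] integrable_not_stopped[OF interval_A assms(1)])
  ultimately show ?thesis by simp
qed

text \<open>Without samples the run cannot tell \<open>S\<close> from the empty set. If
  \<open>p\<close> is the probability of going on, two disjoint ranges of output need 2/3 - p each
  and share 1 - p, so \<open>p\<close> is at least 1/3.\<close>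

lemma one_sample_needed:
  assumes "S \<subseteq> {1..n}" "S \<noteq> {}"
  shows "1 / 4 \<le> prob_more_samples A S 0"
proof -
  have fin: "finite S" using assms finite_subset by auto
  have same: "run A S r 0 = run A {} r 0" for r by simp
  have "prob_more_samples A S 0 = prob_more_samples A {} 0" "success x S 0 = success x {} 0" for x
    unfolding prob_more_samples_def success_def same by simp_all
  moreover have "2 / 3 \<le> success (card S) S 0 + prob_more_samples A S 0" by (rule success_ge) fact
  moreover have "2 / 3 \<le> success 0 {} 0 + prob_more_samples A {} 0" using success_ge[of "{}"] by simp
  moreover have "success 0 {} 0 + success (card S) {} 0 + prob_more_samples A {} 0 \<le> 1"
    using assms(2) fin by (intro success_add_le) (auto simp: card_gt_0_iff)
  ultimately show ?thesis by simp
qed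

text \<open>If the algorithm usually finished early on all sets of size \<open>w\<close>, it would
  often give an output suitable for \<open>w\<close> on the sparse sets, hence also on the full
  blocks, where such an output is wrong.\<close>

lemma many_samples_needed:
  assumes na: "nonadaptive A" and w: "1 \<le> w" and m: "1 \<le> m"
    and bound: "real m \<le> 1 / 1000 * min (real n / real w) (sqrt (real w))"
  shows "\<exists>S\<subseteq>{1..n}. card S = w \<and> 1 / 4 \<le> prob_more_samples A S m"
proof (rule ccontr)
  assume "\<not> ?thesis"
  then have few: "prob_more_samples A S m < 1 / 4" if "S \<subseteq> {1..n}" "card S = w" for S
    using that by force
  obtain q where q: "\<And>r h T. query A r h = Some T \<Longrightarrow> T = q r (length h)"
    using na by (auto simp: nonadaptive_def)
  define nb where "nb = n div (5 * w)"
  have m1: "real m \<le> real n / real w / 1000" "real m \<le> sqrt (real w) / 1000" using bound by auto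
  have nw: "1000 * real w * real m \<le> real n" using m1(1) w by (simp add: field_simps)
  have "1000 * real w * 1 \<le> 1000 * real w * real m" using m by (intro mult_left_mono) auto
  then have "1000 * w \<le> n" using nw by linarith
  then have "1 \<le> nb" using w unfolding nb_def by (simp add: div_greater_zero_iff Suc_le_eq)
  have "n < (nb + 1) * (5 * w)" unfolding nb_def using w
    by (metis Suc_eq_plus1 dividend_less_div_times mult_eq_0_iff not_one_le_zero zero_less_numeral
        zero_neq_numeral add.commute mult_Suc neq0_conv)
  also have "\<dots> \<le> (2 * nb) * (5 * w)" using \<open>1 \<le> nb\<close> by (intro mult_le_mono1) simp
  finally have "real n \<le> real (10 * (nb * w))" by (subst of_nat_le_iff) simp
  then have "(100 * real m) * real w \<le> real nb * real w" using nw by (simp add: algebra_simps)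
  then have m_nb: "100 * real m \<le> real nb" using w by simp
  have m2: "(real m)\<^sup>2 / real w \<le> 1 / 1000000"
  proof -
    have "(real m)\<^sup>2 \<le> (sqrt (real w) / 1000)\<^sup>2" using m1(2) by (intro power_mono) auto
    then show ?thesis using w by (simp add: power_divide divide_le_eq)
  qed
  have sub: "slots (5 * w * b) w \<subseteq> {1..n}" if "b < nb" for b
  proof -
    have "5 * w * b + 5 * w = 5 * w * (b + 1)" by simp
    also have "\<dots> \<le> 5 * w * nb" using that by (intro mult_le_mono2) simp
    also have "\<dots> \<le> n" unfolding nb_def by simp
    finally show ?thesis by (auto simp: slots_def)
  qed
  have psub: "planted (5 * w * b) w f \<subseteq> {1..n}" if "b < nb" "f \<in> choices w" for b f
    using planted_subset[OF that(2)] sub[OF that(1)] by blast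
  \<comment> \<open>5/12 = 2/3 - 1/4.\<close>
  have low: "5 / 12 \<le> success w (planted (5 * w * b) w f) m" if "b < nb" "f \<in> choices w" for b f
    using success_ge[OF psub[OF that], of m] few[OF psub[OF that]] card_planted[OF that(2)] by simp
  \<comment> \<open>Outputs suitable for \<open>5 * w\<close> and unfinished runs take up 2/3. Those
    suitable for \<open>w\<close> are disjoint from them, since the ratio 5 exceeds
    \<open>(1 + \<epsilon>)\<^sup>2 \<le> 4\<close>.\<close>
  have high: "success w (slots (5 * w * b) w) m \<le> 1 / 3" if b: "b < nb" for b
  proof -
    have "(1 + \<epsilon>) * ((1 + \<epsilon>) * real w) \<le> 2 * (2 * real w)"
      using eps by (intro mult_mono) auto
    then have "success w (slots (5 * w * b) w) m + success (5 * w) (slots (5 * w * b) w) m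
        + prob_more_samples A (slots (5 * w * b) w) m \<le> 1"
      using w by (intro success_add_le) (auto simp: slots_def)
    moreover have "2 / 3 \<le> success (5 * w) (slots (5 * w * b) w) m + prob_more_samples A (slots (5 * w * b) w) m"
      using success_ge[OF sub[OF b], of m] by (simp add: card_slots)
    ultimately show ?thesis by simp
  qed
  let ?p = "\<lambda>S r. measure_pmf.prob (run A S r m) (stopped_with A (good w) r)"
  have intP: "integrable coin_space (?p (planted (5 * w * b) w f))" for b f
    by (rule integrable_good) (simp add: planted_def)
  have intS: "integrable coin_space (?p (slots (5 * w * b) w))" for b
    by (rule integrable_good) (simp add: slots_def)
  have "5 ^ w * (real nb * (5 / 12)) = (\<Sum>b<nb. \<Sum>f\<in>choices w. 5 / 12)"
    by (simp add: card_choices)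
  also have "\<dots> \<le> (\<Sum>b<nb. \<Sum>f\<in>choices w. success w (planted (5 * w * b) w f) m)"
    by (intro sum_mono low) auto
  also have "\<dots> = (\<integral>r. (\<Sum>b<nb. \<Sum>f\<in>choices w. ?p (planted (5 * w * b) w f) r) \<partial>coin_space)"
    unfolding success_def
    by (simp only: Bochner_Integration.integral_sum Bochner_Integration.integrable_sum intP)
  also have "\<dots> \<le> (\<integral>r. 5 ^ w * ((\<Sum>b<nb. ?p (slots (5 * w * b) w) r)
        + real nb * ((real m)\<^sup>2 / real w) + 2 * real m) \<partial>coin_space)"
  proof (rule integral_mono)
    show "(\<Sum>b<nb. \<Sum>f\<in>choices w. ?p (planted (5 * w * b) w f) r) \<le> 5 ^ w * ((\<Sum>b<nb. ?p (slots (5 * w * b) w) r)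
        + real nb * ((real m)\<^sup>2 / real w) + 2 * real m)" for r
      by (rule sum_blocks_le[OF w, where q = "q r"]) (rule q)
  qed (intro Bochner_Integration.integrable_sum Bochner_Integration.integrable_add integrable_mult_right
      intP intS coin.integrable_const)+
  also have "\<dots> = 5 ^ w * ((\<Sum>b<nb. success w (slots (5 * w * b) w) m)
        + real nb * ((real m)\<^sup>2 / real w) + 2 * real m)"
    unfolding success_def
    by (simp only: Bochner_Integration.integral_sum Bochner_Integration.integrable_sum intS
       Bochner_Integration.integral_add Bochner_Integration.integrable_add integral_mult_right_zero
       coin_integral_const coin.integrable_const)
  also have "\<dots> \<le> 5 ^ w * ((\<Sum>b<nb. 1 / 3) + real nb * (1 / 1000000) + 2 * (real nb / 100))"
    using high m2 m_nb by (intro mult_left_mono add_mono sum_mono) auto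
  finally have "real nb * (5 / 12) \<le> (\<Sum>b<nb. 1 / 3) + real nb * (1 / 1000000) + 2 * (real nb / 100)"
    by (rule mult_left_le_imp_le) simp
  \<comment> \<open>5/12 exceeds 1/3 + 1/50 + 1/1000000; the constant 1/1000 makes the last two
    terms small enough.\<close>
  then show False using \<open>1 \<le> nb\<close> by simp
qed

end

text \<open>One set has to serve all \<open>m\<close>. It is chosen for the largest admissible
  \<open>m\<close>, as the probability of going on decreases in \<open>m\<close>; if that is 0, the
  comparison with the empty set takes over.\<close>

theorem nonadaptive_lower_bound:
  assumes eps: "0 < \<epsilon>" "\<epsilon> \<le> 1" and w: "1 \<le> w" "w \<le> n"
    and A: "size_approximation n \<epsilon> A" "nonadaptive A"
  shows "\<exists>S\<subseteq>{1..n}. card S = w \<and>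
    (\<forall>m::nat. real m \<le> 1 / 1000 * min (real n / real w) (sqrt (real w)) \<longrightarrow> 1 / 4 \<le> prob_more_samples A S m)"
proof -
  interpret size_approximator n \<epsilon> A using eps A by unfold_locales
  define M where "M = nat \<lfloor>1 / 1000 * min (real n / real w) (sqrt (real w))\<rfloor>"
  have pos: "0 \<le> 1 / 1000 * min (real n / real w) (sqrt (real w))" by simp
  have "\<exists>S\<subseteq>{1..n}. card S = w \<and> 1 / 4 \<le> prob_more_samples A S M"
  proof (cases "M = 0")
    case True
    have "{1..w} \<subseteq> {1..n}" "{1..w} \<noteq> {}" using w by auto
    from one_sample_needed[OF this] this True show ?thesis by (intro exI[where x = "{1..w}"]) simp
  next
    case False
    have "real M \<le> 1 / 1000 * min (real n / real w) (sqrt (real w))"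
      unfolding M_def using pos by (rule of_nat_floor)
    then show ?thesis using many_samples_needed[OF A(2) w(1), of M] False by simp
  qed
  then obtain S where S: "S \<subseteq> {1..n}" "card S = w" "1 / 4 \<le> prob_more_samples A S M" by blast
  have "1 / 4 \<le> prob_more_samples A S m"
    if "real m \<le> 1 / 1000 * min (real n / real w) (sqrt (real w))" for m
  proof -
    have "m \<le> M" unfolding M_def using that by (simp add: le_nat_floor)
    moreover have "finite S" using S(1) finite_subset by auto
    ultimately show ?thesis using prob_more_samples_antimono[OF interval_A] S(3) by fastforce
  qed
  with S show ?thesis by blast
qed

section \<open>A non-adaptive algorithm from repetitions and random indices\<close>

text \<open>The state \<open>(V, c, \<sigma>, \<tau>, j, e)\<close> records the elements \<open>V\<close> seen in samples of the universe (made at even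
  times), the number \<open>c\<close> of repetitions among them, the sum \<open>\<sigma>\<close> of \<open>card V\<close> over these samples, the number
  \<open>\<tau>\<close> of tests of random indices (made at odd times), the number \<open>j\<close> of hits among them, and whether
  the set has been found to be empty.  A random number \<open>x \<ge> n\<close> leads to a sample whose answer is ignored,
  so that every index is tested with probability exactly \<open>1 / 2 ^ D\<close>.\<close>

type_synonym sampler = "nat set \<times> nat \<times> nat \<times> nat \<times> nat \<times> bool"

fun sampler_ask :: "nat \<Rightarrow> nat \<Rightarrow> sampler \<Rightarrow> nat \<Rightarrow> nat \<times> nat" where
  "sampler_ask n t s x = (if odd t \<and> x < n then (x + 1, x + 1) else (1, n))"

fun sampler_step :: "nat \<Rightarrow> nat \<Rightarrow> sampler \<Rightarrow> nat \<Rightarrow> answer \<Rightarrow> sampler" where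
  "sampler_step n t (V, c, \<sigma>, \<tau>, j, e) x a =
     (if odd t then (V, c, \<sigma>, \<tau> + 1, j + of_bool (x < n \<and> a \<noteq> None), e)
      else (case a of None \<Rightarrow> (V, c, \<sigma>, \<tau>, j, True)
            | Some y \<Rightarrow> (insert y V, c + of_bool (y \<in> V), \<sigma> + card V, \<tau>, j, e)))"

fun sampler_stop :: "nat \<Rightarrow> sampler \<Rightarrow> bool" where
  "sampler_stop K (V, c, \<sigma>, \<tau>, j, e) \<longleftrightarrow> e \<or> K \<le> c \<or> K \<le> j"

fun sampler_out :: "nat \<Rightarrow> nat \<Rightarrow> sampler \<Rightarrow> real" where
  "sampler_out D K (V, c, \<sigma>, \<tau>, j, e) =
     (if e then 0 else if K \<le> c then real \<sigma> / real K else real K * 2 ^ D / real \<tau>)"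

abbreviation sampler_start :: sampler where
  "sampler_start \<equiv> ({}, 0, 0, 0, 0, False)"

text \<open>\<open>c\<close> counts events, and \<open>P\<close> is the sum of their conditional probabilities.\<close>

definition hit_supermartingale :: "nat \<Rightarrow> (real \<Rightarrow> nat \<Rightarrow> real) \<Rightarrow> bool" where
  "hit_supermartingale K F \<longleftrightarrow> (\<forall>P c p. 0 \<le> p \<and> p \<le> 1 \<and> c < K \<longrightarrow>
     p * F (P + p) (c + 1) + (1 - p) * F (P + p) c \<le> F P c) \<and> (\<forall>P c. c \<le> K \<longrightarrow> 0 \<le> F P c)"

text \<open>On average \<open>(P - c)\<^sup>2\<close> grows by the variance
  \<open>p * (1 - p)\<close> of a step, while \<open>K - c\<close> drops by \<open>p\<close>. The
  denominator makes the value at least 1 if \<open>c = K\<close> and \<open>P / K\<close> misses 1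
  by at least \<open>\<delta>\<close>.\<close>

definition hit_deviation :: "nat \<Rightarrow> real \<Rightarrow> real \<Rightarrow> nat \<Rightarrow> real" where
  "hit_deviation K \<delta> P c = ((P - real c)\<^sup>2 + (real K - real c)) / (\<delta> * real K)\<^sup>2"

lemma hit_supermartingale_deviation: "hit_supermartingale K (hit_deviation K \<delta>)"
  unfolding hit_supermartingale_def
proof (intro conjI allI impI)
  fix P p :: real and c :: nat
  assume "0 \<le> p \<and> p \<le> 1 \<and> c < K"
  have "p * ((P + p - real (c + 1))\<^sup>2 + (real K - real (c + 1))) + (1 - p) * ((P + p - real c)\<^sup>2 + (real K - real c))
    = (P - real c)\<^sup>2 + (real K - real c) - p\<^sup>2"
    by (simp add: power2_eq_square algebra_simps)
  also have "\<dots> \<le> (P - real c)\<^sup>2 + (real K - real c)" by simp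
  finally show "p * hit_deviation K \<delta> (P + p) (c + 1) + (1 - p) * hit_deviation K \<delta> (P + p) c
      \<le> hit_deviation K \<delta> P c"
    unfolding hit_deviation_def times_divide_eq_right add_divide_distrib[symmetric]
    by (rule divide_right_mono) simp
qed (auto simp: hit_deviation_def)

text \<open>Each event halves it, which outweighs the growth since
  \<open>(1 - p / 2) * exp (p / 2) \<le> 1\<close>. It is large if \<open>P\<close> is large
  although at most \<open>K\<close> events have occurred.\<close>

definition hit_tail :: "nat \<Rightarrow> real \<Rightarrow> nat \<Rightarrow> real" where
  "hit_tail K P c = 2 ^ (K - c) * exp (P / 2)"

lemma hit_supermartingale_tail: "hit_supermartingale K (hit_tail K)"
  unfolding hit_supermartingale_def
proof (intro conjI allI impI)
  fix P p :: real and c :: nat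
  assume *: "0 \<le> p \<and> p \<le> 1 \<and> c < K"
  then have "K - c = Suc (K - (c + 1))" by linarith
  then have 2: "(2::real) ^ (K - c) = 2 * 2 ^ (K - (c + 1))" by simp
  have "1 - p / 2 \<le> exp (- (p / 2))" using exp_ge_add_one_self[of "- (p / 2)"] by simp
  then have "(1 - p / 2) * exp (p / 2) \<le> exp (- (p / 2)) * exp (p / 2)" by (intro mult_right_mono) auto
  then have "(1 - p / 2) * exp (p / 2) \<le> 1" by (simp add: exp_add[symmetric])
  then have "2 ^ (K - c) * exp (P / 2) * ((1 - p / 2) * exp (p / 2)) \<le> 2 ^ (K - c) * exp (P / 2) * 1"
    by (intro mult_left_mono) auto
  then show "p * hit_tail K (P + p) (c + 1) + (1 - p) * hit_tail K (P + p) c \<le> hit_tail K P c"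
    by (simp add: hit_tail_def 2 exp_add add_divide_distrib algebra_simps)
qed (auto simp: hit_tail_def)

lemma hit_supermartingale_count:
  assumes "hit_supermartingale K F" "k \<le> N" "c < K" "0 < N"
  shows "real k * F (P + real k / real N) (c + 1) + (real N - real k) * F (P + real k / real N) c
    \<le> real N * F P c"
proof -
  let ?p = "real k / real N"
  have "?p * F (P + ?p) (c + 1) + (1 - ?p) * F (P + ?p) c \<le> F P c"
    using conjunct1[OF assms(1)[unfolded hit_supermartingale_def], THEN spec, THEN spec, THEN spec, of ?p c P] assms(2-4)
    by simp
  then have "real N * (?p * F (P + ?p) (c + 1) + (1 - ?p) * F (P + ?p) c) \<le> real N * F P c"
    by (intro mult_left_mono) auto
  moreover have "real N * ?p = real k" "real N * (1 - ?p) = real N - real k"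
    using assms(4) by (auto simp: field_simps)
  ultimately show ?thesis by (simp only: distrib_left mult.assoc[symmetric])
qed

lemma sum_of_bool_shift:
  fixes f :: "nat \<Rightarrow> real"
  assumes "finite A"
  shows "(\<Sum>x\<in>A. f (c + of_bool (P x)))
    = real (card {x \<in> A. P x}) * f (c + 1) + (real (card A) - real (card {x \<in> A. P x})) * f c"
proof -
  have "(\<Sum>x\<in>A. f (c + of_bool (P x))) = (\<Sum>x\<in>A. f c + of_bool (P x) * (f (c + 1) - f c))"
    by (rule sum.cong) auto
  also have "\<dots> = real (card A) * f c + real (card {x \<in> A. P x}) * (f (c + 1) - f c)"
    using assms by (simp add: sum.distrib sum_distrib_right[symmetric] Int_def)
  finally show ?thesis by (simp add: algebra_simps)
qed

text \<open>By time \<open>t\<close> the universe has been sampled \<open>u = (t + 1) div 2\<close>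
  times. When \<open>i\<close> of these samples have been made, at least \<open>i - K\<close>
  elements are known, so \<open>\<sigma>\<close> is at least \<open>u * (u - 1) / 2 - K * u\<close>;
  the inequality says this without subtraction.\<close>

fun sampler_inv :: "nat \<Rightarrow> nat set \<Rightarrow> nat \<Rightarrow> sampler \<Rightarrow> bool" where
  "sampler_inv K S t (V, c, \<sigma>, \<tau>, j, e) \<longleftrightarrow> V \<subseteq> S \<and> \<not> e \<and> card V + c = (t + 1) div 2 \<and>
     ((t + 1) div 2)\<^sup>2 \<le> 2 * \<sigma> + (t + 1) div 2 + 2 * K * ((t + 1) div 2) \<and>
     \<tau> = t div 2 \<and> c \<le> K \<and> j \<le> K"

text \<open>Each sample advances at most one of the two terms. Weights 1 and 1 control both
  estimates; weights 1 and 0 single out one kind of event for the tail.\<close>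

fun sampler_potential ::
  "nat \<Rightarrow> nat \<Rightarrow> real \<Rightarrow> real \<Rightarrow> (real \<Rightarrow> nat \<Rightarrow> real) \<Rightarrow> sampler \<Rightarrow> real" where
  "sampler_potential D w \<alpha> \<beta> F (V, c, \<sigma>, \<tau>, j, e) =
     \<alpha> * F (real \<sigma> / real w) c + \<beta> * F (real \<tau> * real w / 2 ^ D) j"

text \<open>An even step is a repetition for \<open>card V\<close> of the \<open>card S\<close>
  elements; an odd step is a hit for \<open>card S\<close> of the \<open>2 ^ D\<close> random
  numbers.\<close>

lemma sampler_supermartingale:
  assumes S: "S \<subseteq> {1..n}" "S \<noteq> {}" and n: "n \<le> 2 ^ D" and F: "hit_supermartingale K F"
    and ab: "0 \<le> \<alpha>" "0 \<le> \<beta>"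
  shows "machine_supermartingale D sampler_start (sampler_ask n) (sampler_step n) (sampler_stop K) S
    (sampler_inv K S) (\<lambda>t. sampler_potential D (card S) \<alpha> \<beta> F)"
proof
  show "sampler_inv K S 0 sampler_start" by simp
next
  fix t and s :: sampler and x a
  assume s: "sampler_inv K S t s" "\<not> sampler_stop K s" 
    and a: "a \<in> set_pmf (interval_sample S (sampler_ask n t s x))"
  obtain V c \<sigma> \<tau> j e where [simp]: "s = (V, c, \<sigma>, \<tau>, j, e)" by (cases s)
  have fin: "finite S" using S(1) finite_subset by auto
  then have finV: "finite V" using s finite_subset by auto
  show "sampler_inv K S (Suc t) (sampler_step n t s x a)"
  proof (cases "odd t")
    case True
    then obtain t' where "t = 2 * t' + 1" by (elim oddE)
    then show ?thesis using s by auto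
  next
    case False
    then obtain t' where t: "t = 2 * t'" by (auto elim: evenE)
    have "{1..n} \<inter> S = S" using S by auto
    then obtain y where y: "a = Some y" "y \<in> S"
      using a S(2) t by (auto simp: set_pmf_interval_sample)
    have u: "card V + c = t'" "t'\<^sup>2 \<le> 2 * \<sigma> + t' + 2 * K * t'" "c < K"
      using s t by auto
    have "(t' + 1)\<^sup>2 = t'\<^sup>2 + 2 * t' + 1" by (simp add: power2_eq_square)
    also have "\<dots> \<le> 2 * \<sigma> + t' + 2 * K * t' + 2 * (card V + K) + 1"
    proof -
      have "t' \<le> card V + K" unfolding u(1)[symmetric] using u(3) by simp
      then show ?thesis using u(2) by (intro add_mono mult_le_mono2) auto
    qed
    finally have "(t' + 1)\<^sup>2 \<le> 2 * (\<sigma> + card V) + (t' + 1) + 2 * K * (t' + 1)"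
      by (simp add: algebra_simps)
    then show ?thesis using s t y finV u by (auto simp: card_insert_if)
  qed
next
  fix t and s :: sampler
  assume s: "sampler_inv K S t s" "\<not> sampler_stop K s"
  obtain V c \<sigma> \<tau> j e where seq [simp]: "s = (V, c, \<sigma>, \<tau>, j, e)" by (cases s)
  define w where "w = card S"
  have fin: "finite S" using S(1) finite_subset by auto
  have w: "0 < w" using S fin by (simp add: w_def card_gt_0_iff)
  let ?\<Phi> = "sampler_potential D (card S) \<alpha> \<beta> F"
  have lt: "c < K" "j < K" "V \<subseteq> S" using s by auto
  have S_eq: "{Suc 0..n} \<inter> S = S" using S by auto
  show "(\<Sum>x<2^D. measure_pmf.expectation (interval_sample S (sampler_ask n t s x))
      (\<lambda>a. ?\<Phi> (sampler_step n t s x a))) \<le> 2 ^ D * ?\<Phi> s"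
  proof (cases "odd t")
    case True
    define G where "G = F ((real \<tau> + 1) * real w / 2 ^ D)"
    have "measure_pmf.expectation (interval_sample S (sampler_ask n t s x)) (\<lambda>a. ?\<Phi> (sampler_step n t s x a))
      = \<alpha> * F (real \<sigma> / real w) c + \<beta> * G (j + of_bool (x < n \<and> x + 1 \<in> S))" for x
      using True by (auto simp: G_def w_def expectation_interval_sample add.commute)
    then have "(\<Sum>x<2^D. measure_pmf.expectation (interval_sample S (sampler_ask n t s x)) (\<lambda>a. ?\<Phi> (sampler_step n t s x a)))
      = 2 ^ D * (\<alpha> * F (real \<sigma> / real w) c) + \<beta> * (\<Sum>x<2^D. G (j + of_bool (x < n \<and> x + 1 \<in> S)))"
      by (simp add: sum.distrib sum_distrib_left)
    also have "(\<Sum>x<2^D. G (j + of_bool (x < n \<and> x + 1 \<in> S)))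
       = real w * G (j + 1) + (2 ^ D - real w) * G j"
    proof -
      have "y - 1 < n \<and> y - 1 < 2 ^ D \<and> Suc (y - 1) = y" if "y \<in> S" for y
      proof -
        have "1 \<le> y" "y \<le> n" using S(1) that by auto
        with n show ?thesis by linarith
      qed
      then have "bij_betw Suc {x \<in> {..<2^D}. x < n \<and> x + 1 \<in> S} S"
        by (intro bij_betwI[where g = "\<lambda>y. y - 1"]) auto
      then have "card {x \<in> {..<2^D}. x < n \<and> x + 1 \<in> S} = w"
        unfolding w_def by (rule bij_betw_same_card)
      then show ?thesis by (subst sum_of_bool_shift) auto
    qed
    also have "\<dots> \<le> 2 ^ D * F (real \<tau> * real w / 2 ^ D) j"
    proof -
      have "card S \<le> card {1..n}" using S(1) by (intro card_mono) auto
      then have "w \<le> 2 ^ D" using n by (simp add: w_def)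
      from hit_supermartingale_count[OF F this lt(2), of "real \<tau> * real w / 2 ^ D"]
      show ?thesis by (simp add: G_def distrib_right add_divide_distrib)
    qed
    finally show ?thesis
      using ab by (simp add: w_def distrib_left mult_left_mono mult.left_commute)
  next
    case False
    define G where "G = F ((real \<sigma> + real (card V)) / real w)"
    have "measure_pmf.expectation (interval_sample S (sampler_ask n t s x)) (\<lambda>a. ?\<Phi> (sampler_step n t s x a))
      = (\<Sum>y\<in>S. \<alpha> * G (c + of_bool (y \<in> V)) + \<beta> * F (real \<tau> * real w / 2 ^ D) j) / real w" for x
      using False S(2) by (simp add: G_def w_def expectation_interval_sample S_eq)
    also have "(\<Sum>y\<in>S. \<alpha> * G (c + of_bool (y \<in> V)) + \<beta> * F (real \<tau> * real w / 2 ^ D) j)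
       = \<alpha> * (\<Sum>y\<in>S. G (c + of_bool (y \<in> V))) + real w * (\<beta> * F (real \<tau> * real w / 2 ^ D) j)"
      by (simp add: sum.distrib sum_distrib_left w_def)
    also have "(\<Sum>y\<in>S. G (c + of_bool (y \<in> V)))
       = real (card V) * G (c + 1) + (real w - real (card V)) * G c"
    proof -
      have "{y \<in> S. y \<in> V} = V" using lt by auto
      then show ?thesis using fin by (subst sum_of_bool_shift) (auto simp: w_def)
    qed
    finally have E: "measure_pmf.expectation (interval_sample S (sampler_ask n t s x)) (\<lambda>a. ?\<Phi> (sampler_step n t s x a))
      = (\<alpha> * (real (card V) * G (c + 1) + (real w - real (card V)) * G c)
         + real w * (\<beta> * F (real \<tau> * real w / 2 ^ D) j)) / real w" for x .
    have "real (card V) * G (c + 1) + (real w - real (card V)) * G c \<le> real w * F (real \<sigma> / real w) c"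
    proof -
      have "card V \<le> w" using lt fin unfolding w_def by (intro card_mono) auto
      from hit_supermartingale_count[OF F this lt(1) w, of "real \<sigma> / real w"]
      show ?thesis by (simp add: G_def add_divide_distrib)
    qed
    then have "\<alpha> * (real (card V) * G (c + 1) + (real w - real (card V)) * G c)
       \<le> \<alpha> * (real w * F (real \<sigma> / real w) c)"
      using ab by (intro mult_left_mono)
    then have "measure_pmf.expectation (interval_sample S (sampler_ask n t s x)) (\<lambda>a. ?\<Phi> (sampler_step n t s x a))
      \<le> ?\<Phi> s" for x
      unfolding E using w by (simp add: divide_le_eq w_def[symmetric] algebra_simps)
    then have "(\<Sum>x<2^D. measure_pmf.expectation (interval_sample S (sampler_ask n t s x))
        (\<lambda>a. ?\<Phi> (sampler_step n t s x a))) \<le> (\<Sum>x<(2::nat)^D. ?\<Phi> s)"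
      by (rule sum_mono)
    also have "\<dots> = 2 ^ D * ?\<Phi> s" by (simp only: sum_constant card_lessThan) simp
    finally show ?thesis .
  qed
next
  fix t and s :: sampler assume "sampler_inv K S t s"
  then show "0 \<le> sampler_potential D (card S) \<alpha> \<beta> F s"
    using ab F by (cases s) (auto simp: hit_supermartingale_def)
qed

text \<open>Both estimates are covered: repetitions give \<open>y * w\<close>, hits give
  \<open>w / y\<close>. The lower bound on \<open>y\<close> rests on
  \<open>(1 + \<epsilon>) * (1 - \<epsilon> / 2) \<ge> 1\<close>.\<close>

lemma ratio_of_deviation:
  fixes y \<epsilon> :: real
  assumes "0 < \<epsilon>" "\<epsilon> \<le> 1" "\<bar>y - 1\<bar> < \<epsilon> / 2"
  shows "1 / (1 + \<epsilon>) \<le> y" "y \<le> 1 + \<epsilon>" "1 / (1 + \<epsilon>) \<le> 1 / y" "1 / y \<le> 1 + \<epsilon>" "0 < y"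
proof -
  have "0 \<le> \<epsilon> * (1 - \<epsilon>)" using assms by simp
  then have "1 \<le> (1 + \<epsilon>) * (1 - \<epsilon> / 2)" by (simp add: algebra_simps)
  also have "\<dots> \<le> (1 + \<epsilon>) * y" using assms by (intro mult_left_mono) linarith+
  finally have 1: "1 \<le> (1 + \<epsilon>) * y" .
  show y: "0 < y" "y \<le> 1 + \<epsilon>" using assms by linarith+
  show "1 / (1 + \<epsilon>) \<le> y" "1 / (1 + \<epsilon>) \<le> 1 / y" "1 / y \<le> 1 + \<epsilon>"
    using 1 y assms by (auto simp: field_simps)
qed

lemma hit_deviation_ge_1:
  assumes "0 < \<delta>" "0 < K" "\<delta> \<le> \<bar>P / real K - 1\<bar>"
  shows "1 \<le> hit_deviation K \<delta> P K"
proof -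
  have "\<delta> * real K \<le> \<bar>P / real K - 1\<bar> * real K" using assms by (intro mult_right_mono) auto
  also have "\<dots> = \<bar>P - real K\<bar>"
  proof -
    have "(P / real K - 1) * real K = P - real K" using assms by (simp add: field_simps)
    then show ?thesis by (metis abs_mult abs_of_nat)
  qed
  finally have "(\<delta> * real K)\<^sup>2 \<le> (P - real K)\<^sup>2"
    using assms by (subst abs_le_square_iff[symmetric]) simp
  then show ?thesis using assms by (simp add: hit_deviation_def le_divide_eq)
qed

text \<open>\<open>2 ^ D < 2 * n\<close> lets a random index hit with probability at least
  \<open>w / (2 * n)\<close>. The two squared deviations together start at
  \<open>8 / (K * \<epsilon>\<^sup>2)\<close>, and 24 makes this at most 1/3; 25 leaves room for
  rounding \<open>K\<close> up.\<close>

locale sampler =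
  fixes n D K :: nat and \<epsilon> :: real
  assumes n: "1 \<le> n" and eps: "0 < \<epsilon>" "\<epsilon> \<le> 1"
    and D: "n \<le> 2 ^ D" "2 ^ D < 2 * n"
    and K: "24 \<le> real K * \<epsilon>\<^sup>2" "real K * \<epsilon>\<^sup>2 \<le> 25"
begin

sublocale machine D sampler_start "sampler_ask n" "sampler_step n" "sampler_stop K" "sampler_out D K" .

lemma K_pos: "1 \<le> K"
proof (rule ccontr)
  assume "\<not> 1 \<le> K"
  then have "K = 0" by simp
  then show False using K by simp
qed

lemma eps2: "0 < \<epsilon>\<^sup>2" "\<epsilon>\<^sup>2 \<le> 1"
  using eps by (auto simp: power_le_one)

text \<open>If the conditional probabilities add up to \<open>2 * Q\<close> before the stop,
  \<open>hit_tail\<close> is at least \<open>exp Q\<close>, having started at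
  \<open>2 ^ K \<le> exp K \<le> exp (Q / 2)\<close>.\<close>

lemma prob_more_samples_tail:
  assumes S: "S \<subseteq> {1..n}" "S \<noteq> {}" and ab: "\<alpha> \<in> {0, 1}" "\<beta> = 1 - \<alpha>"
    and Q: "\<And>V c \<sigma> \<tau> j e. sampler_inv K S m (V, c, \<sigma>, \<tau>, j, e) \<Longrightarrow>
      2 * Q \<le> \<alpha> * (real \<sigma> / real (card S)) + \<beta> * (real \<tau> * real (card S) / 2 ^ D)"
    and K: "2 * real K \<le> Q"
  shows "prob_more_samples machine_algo S m \<le> exp (- (Q / 2))"
proof -
  interpret T: machine_supermartingale D sampler_start "sampler_ask n" "sampler_step n" "sampler_stop K"
    "sampler_out D K" S "sampler_inv K S" "\<lambda>t. sampler_potential D (card S) \<alpha> \<beta> (hit_tail K)"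
    by (rule sampler_supermartingale[OF S D(1) hit_supermartingale_tail]) (use ab in auto)
  have "exp Q * prob_more_samples machine_algo S m \<le> sampler_potential D (card S) \<alpha> \<beta> (hit_tail K) sampler_start"
  proof (rule T.prob_more_samples_bound)
    fix s assume s: "sampler_inv K S m s" "\<not> sampler_stop K s"
    obtain V c \<sigma> \<tau> j e where seq [simp]: "s = (V, c, \<sigma>, \<tau>, j, e)" by (cases s)
    have "exp (P / 2) \<le> hit_tail K P i" for P i
      by (simp add: hit_tail_def)
    then have *: "2 * Q \<le> P \<Longrightarrow> exp Q \<le> hit_tail K P i" for P i
      by (rule order_trans[rotated]) simp
    show "exp Q \<le> sampler_potential D (card S) \<alpha> \<beta> (hit_tail K) s"
      using ab Q[of V c \<sigma> \<tau> j e] s by (auto intro!: *)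
  qed simp
  also have "\<dots> = 2 ^ K" using ab by (auto simp: hit_tail_def)
  also have "(2::real) ^ K \<le> exp 1 ^ K" using exp_ge_add_one_self[of 1] by (intro power_mono) auto
  also have "\<dots> = exp (real K)" by (simp add: exp_of_nat_mult[symmetric])
  finally have "prob_more_samples machine_algo S m \<le> exp (real K) / exp Q" by (simp add: field_simps)
  also have "\<dots> = exp (real K - Q)" by (simp add: exp_diff)
  also have "\<dots> \<le> exp (- (Q / 2))" using K by simp
  finally show ?thesis .
qed

lemma uses_samples_hits:
  assumes S: "S \<subseteq> {1..n}" "S \<noteq> {}"
  shows "uses_samples machine_algo S (32 * real K * (real n / real (card S)))"
  unfolding uses_samples_def
proof (intro allI impI)
  define w where "w = card S"
  have w: "1 \<le> w" using S finite_subset[OF S(1)] by (simp add: w_def Suc_le_eq card_gt_0_iff)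
  have "card S \<le> card {1..n}" using S(1) by (intro card_mono) auto
  then have wn: "w \<le> n" by (simp add: w_def)
  fix m :: nat
  let ?b = "32 * real K * (real n / real (card S))"
  assume m: "?b \<le> real m"
  \<comment> \<open>At least \<open>m / 4\<close> tests have been made, each hitting with
    probability at least \<open>w / (2 * n)\<close>, which adds up to at least
    \<open>2 * Q\<close>.\<close>
  define Q where "Q = real m * real w / (16 * real n)"
  have "32 * real K * real n \<le> real m * real w"
    using m w by (simp add: w_def[symmetric] field_simps)
  then have KQ: "2 * real K \<le> Q" using n by (simp add: Q_def field_simps)
  have "1 * 1 \<le> real K * (real n / real w)" using K_pos w wn by (intro mult_mono) auto
  then have m2: "2 \<le> m" using m by (simp add: w_def)
  have "prob_more_samples machine_algo S m \<le> exp (- (Q / 2))"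
  proof (rule prob_more_samples_tail[OF S, where \<alpha> = 0 and \<beta> = 1])
    fix V c \<sigma> \<tau> j e assume "sampler_inv K S m (V, c, \<sigma>, \<tau>, j, e)"
    then have "\<tau> = m div 2" by simp
    then have t: "real m \<le> 4 * real \<tau>" using m2 by linarith
    have "2 * Q = (real m / 4) * (real w / (2 * real n))" by (simp add: Q_def)
    also have "\<dots> \<le> real \<tau> * (real w / 2 ^ D)"
    proof (intro mult_mono divide_left_mono)
      have "real (2 ^ D) \<le> real (2 * n)" using D(2) by (subst of_nat_le_iff) simp
      then show "2 ^ D \<le> 2 * real n" by simp
    qed (use t n in auto)
    finally show "2 * Q \<le> 0 * (real \<sigma> / real (card S)) + 1 * (real \<tau> * real (card S) / 2 ^ D)"
      by (simp add: w_def)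
  qed (use KQ in auto)
  also have "\<dots> \<le> exp (- (real m / ?b))"
  proof -
    have "real m / ?b = (real m * real w / (32 * real n)) / real K" by (simp add: w_def)
    also have "\<dots> \<le> (real m * real w / (32 * real n)) / 1"
      using K_pos by (intro divide_left_mono) auto
    finally show ?thesis by (simp add: Q_def)
  qed
  finally show "prob_more_samples machine_algo S m \<le> exp (- (real m / ?b))" .
qed

lemma uses_samples_collisions:
  assumes S: "S \<subseteq> {1..n}" "S \<noteq> {}"
  shows "uses_samples machine_algo S (16 * real K * sqrt (real (card S)))"
  unfolding uses_samples_def
proof (intro allI impI)
  define w where "w = card S"
  have w: "1 \<le> w" using S finite_subset[OF S(1)] by (simp add: w_def Suc_le_eq card_gt_0_iff)
  fix m :: nat
  let ?b = "16 * real K * sqrt (real (card S))"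
  assume m: "?b \<le> real m"
  define r where "r = sqrt (real w)"
  have r: "1 \<le> r" "r\<^sup>2 = real w" using w by (auto simp: r_def)
  \<comment> \<open>For these \<open>m\<close>, the sum \<open>\<sigma>\<close> is at least
    \<open>m\<^sup>2 / 16\<close>, so the repetition probabilities add up to
    \<open>\<sigma> / w \<ge> 2 * Q\<close>.\<close>
  define Q where "Q = (real m)\<^sup>2 / (32 * real w)"
  have mr: "16 * real K * r \<le> real m" using m by (simp add: r_def w_def)
  have mK: "16 * real K \<le> real m"
  proof -
    have "16 * real K * 1 \<le> 16 * real K * r" using r by (intro mult_left_mono) auto
    then show ?thesis using mr by simp
  qed
  have Q_ge: "real m * (16 * real K * r) \<le> 32 * real w * Q"
  proof -
    have "real m * (16 * real K * r) \<le> real m * real m" using mr by (intro mult_left_mono) auto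
    then show ?thesis using w by (simp add: Q_def power2_eq_square)
  qed
  \<comment> \<open>Trading one factor \<open>m\<close> for its lower bound
    \<open>16 * K * r\<close> makes the exponent linear in \<open>m\<close>, as
    \<open>uses_samples\<close> demands.\<close>
  have Q_ge': "real m * real K / (2 * r) \<le> Q"
  proof -
    have "(2 * r) * (8 * r) * (real m * real K / (2 * r)) = real m * (16 * real K * r) / 2"
      using r by (simp add: field_simps)
    also have "\<dots> \<le> (2 * r) * (8 * r) * Q" using Q_ge r by (simp add: power2_eq_square)
    finally show ?thesis using r by (simp add: divide_le_eq ac_simps)
  qed
  have KQ: "2 * real K \<le> Q"
  proof -
    have "2 * real K * 1 \<le> 8 * real K * real K" using K_pos by (intro mult_mono) auto
    also have "\<dots> = (16 * real K * r) * real K / (2 * r)" using r by simp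
    also have "\<dots> \<le> real m * real K / (2 * r)" using mr r by (intro divide_right_mono mult_right_mono) auto
    finally show ?thesis using Q_ge' by simp
  qed
  have "prob_more_samples machine_algo S m \<le> exp (- (Q / 2))"
  proof (rule prob_more_samples_tail[OF S, where \<alpha> = 1 and \<beta> = 0])
    fix V c \<sigma> \<tau> j e assume inv: "sampler_inv K S m (V, c, \<sigma>, \<tau>, j, e)"
    define u where "u = (m + 1) div 2"
    have "real (u\<^sup>2) \<le> real (2 * \<sigma> + u + 2 * K * u)"
      using inv by (subst of_nat_le_iff) (simp add: u_def)
    then have u: "real u * real u \<le> 2 * real \<sigma> + real u * (1 + 2 * real K)"
      by (simp add: power2_eq_square algebra_simps)
    have mu: "real m \<le> 2 * real u" unfolding u_def by linarith
    \<comment> \<open>Once \<open>u\<close> is at least \<open>2 * (1 + 2 * K)\<close>, the linear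
      terms of the invariant take up at most half of \<open>u\<^sup>2\<close>.\<close>
    have "real u * (2 * (1 + 2 * real K)) \<le> real u * real u"
      using mu mK K_pos by (intro mult_left_mono) auto
    then have "real u * real u \<le> 4 * real \<sigma>" using u by (simp add: algebra_simps)
    moreover have "real m * real m \<le> (2 * real u) * (2 * real u)" using mu by (intro mult_mono) auto
    ultimately have "(real m)\<^sup>2 \<le> 16 * real \<sigma>" by (simp add: power2_eq_square)
    then show "2 * Q \<le> 1 * (real \<sigma> / real (card S)) + 0 * (real \<tau> * real (card S) / 2 ^ D)"
      using w by (simp add: Q_def w_def[symmetric] field_simps)
  qed (use KQ in auto)
  also have "\<dots> \<le> exp (- (real m / ?b))"
  proof -
    have "real m / ?b = (real m / (16 * r)) * (1 / real K)" by (simp add: w_def r_def)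
    also have "\<dots> \<le> (real m / (4 * r)) * real K"
      using K_pos r mult_mono[of 1 "real K" 1 "real K"] by (intro mult_mono divide_left_mono) (auto simp: divide_le_eq)
    also have "\<dots> = (real m * real K / (2 * r)) / 2" by simp
    also have "\<dots> \<le> Q / 2" using Q_ge' by (intro divide_right_mono) auto
    finally show ?thesis by simp
  qed
  finally show "prob_more_samples machine_algo S m \<le> exp (- (real m / ?b))" .
qed

text \<open>Both sample bounds hold for the same algorithm, so the smaller one applies without being
  known to it. 800 = 32 * 25.\<close>

lemma uses_samples_nonempty:
  assumes S: "S \<subseteq> {1..n}" "S \<noteq> {}"
  shows "uses_samples machine_algo S (800 * nonadaptive_bound n (card S) \<epsilon>)"
proof -
  define w where "w = card S"
  have w: "1 \<le> w" using S finite_subset[OF S(1)] by (simp add: w_def Suc_le_eq card_gt_0_iff)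
  define M where "M = max 1 (min (real n / real w) (sqrt (real w)))"
  have Keps: "real K \<le> 25 / \<epsilon>\<^sup>2" using K eps2 by (simp add: field_simps)
  show ?thesis
  proof (cases "real n / real w \<le> sqrt (real w)")
    case True
    have "32 * real K * (real n / real w) \<le> 32 * (25 / \<epsilon>\<^sup>2) * M"
      using Keps True eps2 by (intro mult_mono) (auto simp: M_def)
    then show ?thesis
      using K_pos w n
      by (intro uses_samples_mono[OF uses_samples_hits[OF S]])
        (auto simp: nonadaptive_bound_def w_def[symmetric] M_def)
  next
    case False
    have "16 * real K * sqrt (real w) \<le> 32 * (25 / \<epsilon>\<^sup>2) * M"
      using Keps False eps2 by (intro mult_mono) (auto simp: M_def)
    then show ?thesis
      using K_pos w n
      by (intro uses_samples_mono[OF uses_samples_collisions[OF S]])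
        (auto simp: nonadaptive_bound_def w_def[symmetric] M_def)
  qed
qed

lemma output_nonempty:
  assumes S: "S \<subseteq> {1..n}" "S \<noteq> {}"
  shows "2 / 3 \<le> prob_output machine_algo S
      (\<lambda>x. 1 / (1 + \<epsilon>) * real (card S) \<le> x \<and> x \<le> (1 + \<epsilon>) * real (card S))"
    (is "_ \<le> prob_output _ _ ?P")
proof -
  define w where "w = card S"
  have w: "1 \<le> w" using S finite_subset[OF S(1)] by (simp add: w_def Suc_le_eq card_gt_0_iff)
  let ?F = "hit_deviation K (\<epsilon> / 2)"
  interpret V: machine_supermartingale D sampler_start "sampler_ask n" "sampler_step n" "sampler_stop K"
    "sampler_out D K" S "sampler_inv K S" "\<lambda>t. sampler_potential D (card S) 1 1 ?F"
    by (rule sampler_supermartingale[OF S D(1) hit_supermartingale_deviation]) auto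
  have F_nonneg: "0 \<le> ?F P c" if "c \<le> K" for P c
    using that by (simp add: hit_deviation_def)
  show ?thesis
  proof (rule uses_samples_limit[OF uses_samples_collisions[OF S]])
    show "0 < 16 * real K * sqrt (real (card S))" using K_pos w by (simp add: w_def)
    fix k
    have "1 - sampler_potential D (card S) 1 1 ?F sampler_start - prob_more_samples machine_algo S k
       \<le> prob_output machine_algo S ?P"
    proof (rule V.prob_output_bound)
      fix t s assume s: "sampler_inv K S t s" "sampler_stop K s" "\<not> ?P (sampler_out D K s)"
      obtain V c \<sigma> \<tau> j e where [simp]: "s = (V, c, \<sigma>, \<tau>, j, e)" by (cases s)
      have inv: "\<not> e" "c \<le> K" "j \<le> K" using s(1) by auto
      show "1 \<le> sampler_potential D (card S) 1 1 ?F s"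
      proof (cases "c = K")
        case True
        define y where "y = real \<sigma> / real w / real K"
        have out: "sampler_out D K s = y * real w"
          using True inv w K_pos by (simp add: y_def)
        have "\<epsilon> / 2 \<le> \<bar>y - 1\<bar>"
        proof (rule ccontr)
          assume "\<not> ?thesis"
          then have "\<bar>y - 1\<bar> < \<epsilon> / 2" by simp
          note r = ratio_of_deviation[OF eps this]
          have "?P (sampler_out D K s)"
            unfolding out w_def[symmetric] using r by (intro conjI mult_right_mono) auto
          then show False using s(3) by blast
        qed
        then have "1 \<le> ?F (real \<sigma> / real w) K"
          using eps K_pos by (intro hit_deviation_ge_1) (auto simp: y_def)
        then show ?thesis using True F_nonneg[OF inv(3)] by (simp add: w_def add_increasing2)
      next
        case False
        then have j: "j = K" "c < K" using s(2) inv by auto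
        define y where "y = real \<tau> * real w / 2 ^ D / real K"
        have out: "sampler_out D K s = (1 / y) * real w"
          using j inv w K_pos by (simp add: y_def)
        have "\<epsilon> / 2 \<le> \<bar>y - 1\<bar>"
        proof (rule ccontr)
          assume "\<not> ?thesis"
          then have "\<bar>y - 1\<bar> < \<epsilon> / 2" by simp
          note r = ratio_of_deviation[OF eps this]
          have "?P (sampler_out D K s)"
            unfolding out w_def[symmetric] using r by (intro conjI mult_right_mono) auto
          then show False using s(3) by blast
        qed
        then have "1 \<le> ?F (real \<tau> * real w / 2 ^ D) K"
          using eps K_pos by (intro hit_deviation_ge_1) (auto simp: y_def)
        then show ?thesis using j F_nonneg[OF inv(2)] by (simp add: w_def add_increasing)
      qed
    qed
    moreover have "sampler_potential D (card S) 1 1 ?F sampler_start \<le> 1 / 3"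
    proof -
      have "sampler_potential D (card S) 1 1 ?F sampler_start = 8 / (real K * \<epsilon>\<^sup>2)"
        using K_pos by (simp add: hit_deviation_def power2_eq_square)
      also have "\<dots> \<le> 1 / 3" using K(1) by (simp add: divide_le_eq)
      finally show ?thesis .
    qed
    ultimately show "2 / 3 - prob_more_samples machine_algo S k \<le> prob_output machine_algo S ?P"
      by linarith
  qed
qed

text \<open>The first sample covers the universe and reveals emptiness, so with a suitable invariant
  the zero potential works: errors and a second sample have probability 0.\<close>

lemma properties_empty:
  shows "uses_samples machine_algo {} (800 * nonadaptive_bound n 0 \<epsilon>)"
    and "2 / 3 \<le> prob_output machine_algo {} (\<lambda>x. x = 0)"
proof -
  define inv :: "nat \<Rightarrow> sampler \<Rightarrow> bool" where
    "inv = (\<lambda>t (V, c, \<sigma>, \<tau>, j, e). t = 0 \<and> c = 0 \<and> j = 0 \<or> e)"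
  interpret V: machine_supermartingale D sampler_start "sampler_ask n" "sampler_step n" "sampler_stop K"
    "sampler_out D K" "{}" inv "\<lambda>_ _. 0"
  proof
    fix t and s :: sampler and x :: nat and a
    assume *: "inv t s" "\<not> sampler_stop K s" and a: "a \<in> set_pmf (interval_sample {} (sampler_ask n t s x))"
    then have "a = None" by (simp add: set_pmf_interval_sample)
    then show "inv (Suc t) (sampler_step n t s x a)"
      using * by (cases s) (auto simp: inv_def)
  qed (auto simp: inv_def)
  let ?b = "800 * nonadaptive_bound n 0 \<epsilon>"
  have b: "1 \<le> ?b" using eps2 by (simp add: nonadaptive_bound_def le_divide_eq)
  show uses: "uses_samples machine_algo {} ?b"
    unfolding uses_samples_def
  proof (intro allI impI)
    fix m :: nat assume "?b \<le> real m"
    then have "1 \<le> m" using b by linarith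
    then have "1 * prob_more_samples machine_algo {} m \<le> 0"
      by (intro V.prob_more_samples_bound) (auto simp: inv_def split: if_splits)
    then show "prob_more_samples machine_algo {} m \<le> exp (- (real m / ?b))"
      by (simp add: order_trans[OF _ exp_ge_zero])
  qed
  show "2 / 3 \<le> prob_output machine_algo {} (\<lambda>x. x = 0)"
  proof (rule uses_samples_limit[OF uses])
    fix k
    have "1 - 0 - prob_more_samples machine_algo {} k \<le> prob_output machine_algo {} (\<lambda>x. x = 0)"
    proof (rule V.prob_output_bound)
      fix t s assume "inv t s" "sampler_stop K s" "sampler_out D K s \<noteq> 0"
      then show "1 \<le> (0 :: real)" using K_pos by (cases s) (auto simp: inv_def)
    qed
    then show "2 / 3 - prob_more_samples machine_algo {} k \<le> prob_output machine_algo {} (\<lambda>x. x = 0)" by simp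
  qed (use b in simp)
qed

lemma size_approximation_sampler: "size_approximation n \<epsilon> machine_algo"
proof -
  have "interval_algorithm n machine_algo"
    using n by (intro machine_interval_algorithm) auto
  moreover have "2 / 3 \<le> prob_output machine_algo S
      (\<lambda>x. 1 / (1 + \<epsilon>) * real (card S) \<le> x \<and> x \<le> (1 + \<epsilon>) * real (card S))" if "S \<subseteq> {1..n}" for S
  proof (cases "S = {}")
    case True
    have "(\<lambda>x::real. 0 \<le> x \<and> x \<le> 0) = (\<lambda>x. x = 0)" by auto
    then show ?thesis using True properties_empty(2) by simp
  qed (rule output_nonempty[OF that])
  ultimately show ?thesis unfolding size_approximation_def by blast
qed

lemma nonadaptive_sampler: "nonadaptive machine_algo"
  unfolding nonadaptive_def
  \<comment> \<open>\<open>sampler_ask\<close> ignores the state, so the start state can stand for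
    the current one.\<close>
  by (rule exI[where x = "\<lambda>r t. sampler_ask n t sampler_start (block t r)"]) (auto simp: query_machine split: if_splits)

end

theorem nonadaptive_algorithm:
  assumes "1 \<le> n" "0 < \<epsilon>" "\<epsilon> \<le> 1"
  shows "\<exists>A. size_approximation n \<epsilon> A \<and> nonadaptive A \<and>
    (\<forall>S\<subseteq>{1..n}. uses_samples A S (800 * nonadaptive_bound n (card S) \<epsilon>))"
proof -
  define D where "D = (LEAST D. n \<le> 2 ^ D)"
  have D1: "n \<le> 2 ^ D" unfolding D_def by (rule LeastI[of _ n]) (simp add: less_imp_le)
  have D2: "2 ^ D < 2 * n"
  proof (cases D)
    case (Suc d)
    then have "\<not> n \<le> 2 ^ d" unfolding D_def by (intro not_less_Least) simp
    then show ?thesis using Suc by simp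
  qed (use assms in simp)
  define K where "K = nat \<lceil>24 / \<epsilon>\<^sup>2\<rceil>"
  have e2: "0 < \<epsilon>\<^sup>2" "\<epsilon>\<^sup>2 \<le> 1" using assms by (auto simp: power_le_one)
  have "24 / \<epsilon>\<^sup>2 \<le> real K" "real K \<le> 24 / \<epsilon>\<^sup>2 + 1"
    unfolding K_def using of_int_ceiling_le_add_one[of "24 / \<epsilon>\<^sup>2"] by (auto simp: real_nat_ceiling_ge)
  then have K: "24 \<le> real K * \<epsilon>\<^sup>2" "real K * \<epsilon>\<^sup>2 \<le> 24 + \<epsilon>\<^sup>2"
    using e2 by (auto simp: field_simps)
  interpret sampler n D K \<epsilon>
    using assms D1 D2 K e2 by unfold_locales auto
  have "uses_samples machine_algo S (800 * nonadaptive_bound n (card S) \<epsilon>)" if "S \<subseteq> {1..n}" for S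
    using uses_samples_nonempty[OF that] properties_empty(1) by (cases "S = {}") auto
  then show ?thesis using size_approximation_sampler nonadaptive_sampler by blast
qed

section \<open>An adaptive algorithm from descending walks\<close>

text \<open>A uniform element of \<open>X\<close> has a uniform number of elements of
  \<open>X\<close> below it.\<close>

lemma sum_card_less:
  fixes X :: "nat set" and f :: "nat \<Rightarrow> real"
  assumes "finite X"
  shows "(\<Sum>x\<in>X. f (card (X \<inter> {..<x}))) = (\<Sum>i<card X. f i)"
  using assms
proof (induction X rule: finite_linorder_max_induct)
  case (insert b A)
  have "insert b A \<inter> {..<x} = A \<inter> {..<x}" if "x \<in> A" for x using insert that by auto
  moreover have "insert b A \<inter> {..<b} = A" using insert by auto
  ultimately show ?case using insert by (auto simp: add.commute)
qed simp

text \<open>This is the recursion for the mean number of steps of a walk: one step, then a walk from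
  a uniform smaller rank.\<close>

lemma sum_one_plus_harm: "(\<Sum>i<N. 1 + harm i) = real N * harm N"
  by (induction N) (auto simp: harm_Suc field_simps)

text \<open>In terms of walks: the steps made plus the mean number to come change in one step with
  variance at most 1. The slack grows by exactly \<open>1 / (N + 1)\<close> in the
  induction.\<close>

lemma sum_one_plus_harm_squared: "(\<Sum>i<N. (1 + harm i)\<^sup>2) \<le> real N * ((harm N)\<^sup>2 + 1)"
proof (induction N)
  case (Suc N)
  have "x * ((h + inverse x)\<^sup>2 + 1) - (x - 1) * (h\<^sup>2 + 1) - (1 + h)\<^sup>2 = inverse x" if "x \<noteq> 0" for x h :: real
  proof -
    have "x * ((h + inverse x)\<^sup>2 + 1) = x * h\<^sup>2 + 2 * h * (x * inverse x) + (x * inverse x) * inverse x + x"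
      by (simp add: power2_eq_square algebra_simps)
    then show ?thesis using that by (simp add: power2_eq_square algebra_simps)
  qed
  from this[of "real (Suc N)" "harm N"]
  have "real (Suc N) * ((harm (Suc N))\<^sup>2 + 1) - real N * ((harm N)\<^sup>2 + 1) - (1 + harm N)\<^sup>2
    = inverse (real (Suc N))"
    by (simp add: harm_Suc)
  then have "(1 + harm N)\<^sup>2 \<le> real (Suc N) * ((harm (Suc N))\<^sup>2 + 1) - real N * ((harm N)\<^sup>2 + 1)"
    by (smt (verit) inverse_nonnegative_iff_nonnegative of_nat_0_le_iff)
  with Suc show ?case by simp
qed simp

text \<open>Exponential counterpart of \<open>sum_one_plus_harm\<close>: the mean drop of
  \<open>exp (\<mu> * harm N)\<close> pays for a factor \<open>1 + \<mu>\<close> per step. The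
  induction rests on \<open>1 + x \<le> exp x\<close>.\<close>

lemma sum_exp_harm:
  assumes "0 \<le> \<mu>"
  shows "(1 + \<mu>) * (\<Sum>i<N. exp (\<mu> * harm i)) \<le> real N * exp (\<mu> * harm N)"
proof (induction N)
  case (Suc N)
  have "(real N + (1 + \<mu>)) * exp (\<mu> * harm N) = real (Suc N) * ((1 + \<mu> / real (Suc N)) * exp (\<mu> * harm N))"
    by (simp add: field_simps)
  also have "\<dots> \<le> real (Suc N) * (exp (\<mu> / real (Suc N)) * exp (\<mu> * harm N))"
    by (intro mult_left_mono mult_right_mono exp_ge_add_one_self) auto
  also have "exp (\<mu> / real (Suc N)) * exp (\<mu> * harm N) = exp (\<mu> * harm (Suc N))"
    by (simp add: harm_Suc exp_add[symmetric] field_simps)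
  finally show ?case using Suc by (simp add: algebra_simps)
qed simp

text \<open>The variance, at most 1 per step, is paid for by the linear term \<open>harm\<close>,
  which drops by 1 on average.\<close>

lemma harm_quadratic_step:
  "(\<Sum>i<N. (y + 1 + harm i)\<^sup>2 + harm i + v) \<le> real N * ((y + harm N)\<^sup>2 + harm N + v)"
proof -
  have "(\<Sum>i<N. (y + 1 + harm i)\<^sup>2 + harm i + v)
     = (\<Sum>i<N. (y\<^sup>2 + v - 1) + (2 * y + 1) * (1 + harm i) + (1 + harm i)\<^sup>2)"
    by (rule sum.cong) (auto simp: power2_eq_square algebra_simps)
  also have "\<dots> = real N * (y\<^sup>2 + v - 1) + (2 * y + 1) * (real N * harm N) + (\<Sum>i<N. (1 + harm i)\<^sup>2)"
    by (subst sum.distrib, subst sum.distrib, subst sum_distrib_left[symmetric], subst sum_one_plus_harm) simp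
  also have "\<dots> \<le> real N * (y\<^sup>2 + v - 1) + (2 * y + 1) * (real N * harm N) + real N * ((harm N)\<^sup>2 + 1)"
    using sum_one_plus_harm_squared[of N] by simp
  also have "\<dots> = real N * ((y + harm N)\<^sup>2 + harm N + v)"
    by (simp add: power2_eq_square algebra_simps)
  finally show ?thesis .
qed

text \<open>The difference consists of \<open>w - v\<close> terms, each at least
  \<open>1 / w\<close>.\<close>

lemma harm_diff_ge:
  assumes "v \<le> w" "0 < w"
  shows "1 - real v / real w \<le> harm w - harm v"
proof -
  have "real (w - v) / real w \<le> harm w - harm v"
    using assms
  proof (induction w rule: dec_induct)
    case (step w)
    have "real (Suc w - v) / real (Suc w) = real (w - v) / real (Suc w) + inverse (real (Suc w))"
      using step by (simp add: Suc_diff_le field_simps)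
    also have "real (w - v) / real (Suc w) \<le> harm w - harm v"
    proof (cases "w = 0")
      case False
      then have "real (w - v) / real (Suc w) \<le> real (w - v) / real w"
        by (intro divide_left_mono) auto
      then show ?thesis using step False by simp
    qed (use step in auto)
    finally show ?case by (simp add: harm_Suc)
  qed simp
  then show ?thesis using assms by (simp add: of_nat_diff field_simps)
qed

text \<open>By \<open>harm_diff_ge\<close>, a difference below \<open>\<epsilon> / 2\<close> keeps
  the smaller-to-larger ratio above \<open>1 - \<epsilon> / 2\<close>, and
  \<open>(1 + \<epsilon>) * (1 - \<epsilon> / 2) \<ge> 1\<close>.\<close>

lemma harm_close_imp_ratio:
  assumes "0 < \<epsilon>" "\<epsilon> \<le> 1" "0 < w" "\<bar>harm v - (harm w :: real)\<bar> < \<epsilon> / 2"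
  shows "1 / (1 + \<epsilon>) * real w \<le> real v" "real v \<le> (1 + \<epsilon>) * real w"
proof -
  have key: "real b \<le> (1 + \<epsilon>) * real a" if "harm b - (harm a :: real) < \<epsilon> / 2" "0 < b" for a b
  proof (cases "a \<le> b")
    case True
    have "1 - real a / real b < \<epsilon> / 2" using harm_diff_ge[OF True] that by linarith
    then have "1 - \<epsilon> / 2 < real a / real b" by simp
    then have "(1 - \<epsilon> / 2) * real b \<le> real a" using that by (simp add: field_simps)
    then have "(1 + \<epsilon>) * ((1 - \<epsilon> / 2) * real b) \<le> (1 + \<epsilon>) * real a" using assms by simp
    moreover have "1 * real b \<le> ((1 + \<epsilon>) * (1 - \<epsilon> / 2)) * real b"
    proof (intro mult_right_mono)
      have "0 \<le> \<epsilon> * (1 - \<epsilon>)" using assms by simp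
      then show "1 \<le> (1 + \<epsilon>) * (1 - \<epsilon> / 2)" by (simp add: algebra_simps)
    qed simp
    ultimately show ?thesis by (simp add: mult.assoc)
  next
    case False
    then have "1 * real b \<le> (1 + \<epsilon>) * real a" using assms by (intro mult_mono) auto
    then show ?thesis by simp
  qed
  have "real w \<le> (1 + \<epsilon>) * real v" using assms(3,4) by (intro key) linarith+
  then show "1 / (1 + \<epsilon>) * real w \<le> real v" using assms by (simp add: field_simps)
  show "real v \<le> (1 + \<epsilon>) * real w"
  proof (cases "v = 0")
    case False
    then show ?thesis using assms(4) by (intro key) linarith+
  qed (use assms in auto)
qed

lemma harm_le_log: "1 \<le> w \<Longrightarrow> harm w \<le> 2 * log 2 (max 2 (real w))"
proof -
  assume w: "1 \<le> w"
  have 1: "1 \<le> log 2 (max 2 (real w))" by (simp add: le_log_iff)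
  have "harm w - ln (real w) \<le> harm 1 - ln (real 1)" 
    using decseq_harm_diff_ln[THEN decseqD, of 0 "w - 1"] w by simp
  then have "harm w \<le> 1 + ln (real w)" by (simp add: harm_expand)
  moreover have "ln (real w) \<le> log 2 (max 2 (real w))"
  proof -
    have "ln (real w) \<le> ln (max 2 (real w)) * 1" using w by simp
    also have "\<dots> \<le> ln (max 2 (real w)) * (1 / ln 2)"
      using ln_2_less_1 by (intro mult_left_mono) (auto simp: field_simps)
    finally show ?thesis by (simp add: log_def)
  qed
  ultimately show ?thesis using 1 by linarith
qed

lemma exp_le_one_plus_double: "0 \<le> x \<Longrightarrow> x \<le> 1 \<Longrightarrow> exp x \<le> 1 + 2 * (x::real)"
  using exp_bound[of x] by (smt (verit) mult_left_le power2_eq_square)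

section \<open>Ranks and the transitions of the walk\<close>

definition rank_in :: "nat set \<Rightarrow> nat \<Rightarrow> nat" where
  "rank_in S e = card (S \<inter> {1..e})"

text \<open>In the state \<open>(ph, K, k, M, e)\<close>, the flag \<open>ph\<close> tells whether the forty preliminary walks are over,
  \<open>K\<close> and \<open>k\<close> are the total and the remaining number of walks of the current phase, \<open>M\<close> is the number of
  elements sampled in this phase, and the current walk continues in \<open>{1..e}\<close>.  For \<open>e = 0\<close> there is
  no interval to sample, so \<open>{1..1}\<close> is sampled and the answer ignored.\<close>

type_synonym walk = "bool \<times> nat \<times> nat \<times> nat \<times> nat"

fun walk_ask :: "nat \<Rightarrow> nat \<Rightarrow> walk \<Rightarrow> nat \<Rightarrow> nat \<times> nat" where
  "walk_ask n t (ph, K, k, M, e) x = (1, max 1 (min e n))"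

text \<open>With \<open>H\<close> the mean walk length, \<open>M\<close> is near
  \<open>40 * H\<close> after the preliminary walks, so about
  \<open>200 * H / \<epsilon>\<^sup>2\<close> further walks follow; for an empty set there are
  none.\<close>

fun walk_step :: "real \<Rightarrow> nat \<Rightarrow> nat \<Rightarrow> walk \<Rightarrow> nat \<Rightarrow> answer \<Rightarrow> walk" where
  "walk_step \<epsilon> n t (ph, K, k, M, e) x a =
     (if e = 0 \<or> a = None then
        (if k \<le> 1 \<and> \<not> ph
         then let K' = nat \<lceil>5 * real M / \<epsilon>\<^sup>2\<rceil> in (True, K', K', 0, n)
         else (ph, K, k - 1, M, n))
      else (ph, K, k, M + 1, the a - 1))"

fun walk_stop :: "walk \<Rightarrow> bool" where
  "walk_stop (ph, K, k, M, e) \<longleftrightarrow> ph \<and> k = 0"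

text \<open>If the average \<open>M / K\<close> is within \<open>\<epsilon> / 4\<close> of
  \<open>harm w\<close>, the true size \<open>w\<close> is a candidate, and every candidate has a
  harmonic number within \<open>\<epsilon> / 2\<close> of \<open>harm w\<close>.\<close>

fun walk_out :: "real \<Rightarrow> walk \<Rightarrow> real" where
  "walk_out \<epsilon> (ph, K, k, M, e) = real (SOME v. \<bar>harm v - real M / real K\<bar> < \<epsilon> / 4)"

text \<open>Seen through \<open>rank_in\<close>, a walk moves from a positive rank to a uniform
  smaller one and ends at rank 0, whether \<open>e = 0\<close> or \<open>{1..e}\<close> merely
  misses \<open>S\<close>. The value \<open>u\<close> stands for what follows that end.\<close>

lemma expectation_walk:
  fixes g :: "nat \<Rightarrow> real"
  assumes "1 \<le> n" "e \<le> n"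
  shows "measure_pmf.expectation (interval_sample S (1, max 1 (min e n)))
      (\<lambda>a. if e = 0 \<or> a = None then u else g (rank_in S (the a - 1))) =
    (if rank_in S e = 0 then u else (\<Sum>i<rank_in S e. g i) / real (rank_in S e))"
proof (cases "rank_in S e = 0")
  case True
  then have "e = 0 \<or> {1..max 1 (min e n)} \<inter> S = {}"
    using assms by (auto simp: rank_in_def max_def min_def split: if_splits)
  with True show ?thesis by (auto simp: expectation_interval_sample)
next
  case False
  define X where "X = {1..e} \<inter> S"
  have e: "0 < e" using False by (auto simp: rank_in_def intro!: Nat.gr0I)
  then have "{1..max 1 (min e n)} \<inter> S = X" using assms by (auto simp: X_def)
  moreover have "X \<noteq> {}" "card X = rank_in S e" using False by (auto simp: rank_in_def X_def Int_commute)
  moreover have "g (rank_in S (x - 1)) = g (card (X \<inter> {..<x}))" if "x \<in> X" for x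
  proof -
    have "S \<inter> {1..x - 1} = X \<inter> {..<x}" using that by (auto simp: X_def)
    then show ?thesis by (simp add: rank_in_def)
  qed
  ultimately show ?thesis
    using e False sum_card_less[of X g] by (simp add: expectation_interval_sample X_def)
qed

fun lift_potential :: "nat set \<Rightarrow> (nat \<Rightarrow> bool \<Rightarrow> nat \<Rightarrow> nat \<Rightarrow> nat \<Rightarrow> nat \<Rightarrow> real) \<Rightarrow> nat \<Rightarrow> walk \<Rightarrow> real" where
  "lift_potential S F t (ph, K, k, M, e) = F t ph K k M (rank_in S e)"

fun walk_inv :: "nat \<Rightarrow> nat \<Rightarrow> walk \<Rightarrow> bool" where
  "walk_inv n t (ph, K, k, M, e) \<longleftrightarrow> e \<le> n \<and> (\<not> ph \<longrightarrow> K = 40 \<and> 1 \<le> k)"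

abbreviation walk_start :: "nat \<Rightarrow> walk" where
  "walk_start n \<equiv> (False, 40, 40, 0, n)"

lemma the_answer_le: "a \<in> set_pmf (interval_sample S (1, m)) \<Longrightarrow> a \<noteq> None \<Longrightarrow> the a \<le> m"
  by (auto simp: set_pmf_interval_sample Let_def split: if_splits)

lemma walk_supermartingale:
  assumes "1 \<le> n"
    and nonneg: "\<And>t ph K k M N. (\<not> ph \<longrightarrow> 1 \<le> k) \<Longrightarrow> 0 \<le> F t ph K k M N"
    and visit: "\<And>t ph K k M N. (\<not> ph \<longrightarrow> K = 40) \<Longrightarrow> 1 \<le> k \<Longrightarrow> 0 < N \<Longrightarrow>
       (\<Sum>i<N. F (Suc t) ph K k (M + 1) i) \<le> real N * F t ph K k M N"
    and restart: "\<And>t ph K k M. (\<not> ph \<longrightarrow> K = 40 \<and> 2 \<le> k) \<Longrightarrow> 1 \<le> k \<Longrightarrow>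
       F (Suc t) ph K (k - 1) M (rank_in S n) \<le> F t ph K k M 0"
    and switch: "\<And>t M K'. K' = nat \<lceil>5 * real M / \<epsilon>\<^sup>2\<rceil> \<Longrightarrow>
       F (Suc t) True K' K' 0 (rank_in S n) \<le> F t False 40 1 M 0"
  shows "machine_supermartingale 0 (walk_start n) (walk_ask n) (walk_step \<epsilon> n) walk_stop S
      (walk_inv n) (lift_potential S F)"
proof
  show "walk_inv n 0 (walk_start n)" by simp
next
  fix t and s :: walk and x a
  assume s: "walk_inv n t s" "\<not> walk_stop s" and a: "a \<in> set_pmf (interval_sample S (walk_ask n t s x))"
  obtain ph K k M e where [simp]: "s = (ph, K, k, M, e)" by (cases s)
  show "walk_inv n (Suc t) (walk_step \<epsilon> n t s x a)"
    using s a the_answer_le[of a S "max 1 (min e n)"] by (auto simp: Let_def)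
next
  fix t and s :: walk assume s: "walk_inv n t s" "\<not> walk_stop s"
  obtain ph K k M e where seq [simp]: "s = (ph, K, k, M, e)" by (cases s)
  define u where "u = (if k \<le> 1 \<and> \<not> ph
    then let K' = nat \<lceil>5 * real M / \<epsilon>\<^sup>2\<rceil> in F (Suc t) True K' K' 0 (rank_in S n)
    else F (Suc t) ph K (k - 1) M (rank_in S n))"
  define g where "g = F (Suc t) ph K k (M + 1)"
  have "lift_potential S F (Suc t) (walk_step \<epsilon> n t s x a)
      = (if e = 0 \<or> a = None then u else g (rank_in S (the a - 1)))" for x a
    by (simp add: u_def g_def Let_def)
  then have "measure_pmf.expectation (interval_sample S (walk_ask n t s x))
      (\<lambda>a. lift_potential S F (Suc t) (walk_step \<epsilon> n t s x a))
     = (if rank_in S e = 0 then u else (\<Sum>i<rank_in S e. g i) / real (rank_in S e))" for x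
    using expectation_walk[of n e S u g] s assms(1) by simp
  moreover have "u \<le> F t ph K k M 0"
    using s switch restart by (auto simp: u_def Let_def)
  moreover have "(\<Sum>i<N. g i) \<le> real N * F t ph K k M N" if "0 < N" for N
    using s that visit by (auto simp: g_def)
  ultimately show "(\<Sum>x<2 ^ 0. measure_pmf.expectation (interval_sample S (walk_ask n t s x))
      (\<lambda>a. lift_potential S F (Suc t) (walk_step \<epsilon> n t s x a))) \<le> 2 ^ 0 * lift_potential S F t s"
    by (auto simp: divide_le_eq mult.commute)
next
  fix t and s :: walk assume "walk_inv n t s"
  then show "0 \<le> lift_potential S F t s" using nonneg by (cases s) auto
qed

section \<open>Potentials of the adaptive algorithm\<close>

context
  fixes \<epsilon> H :: real
begin

text \<open>\<open>H\<close> stands for the mean number of steps of a walk.  The linear terms bound the variance of the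
  steps still to be made.\<close>

definition deviation :: "nat \<Rightarrow> nat \<Rightarrow> nat \<Rightarrow> nat \<Rightarrow> real" where
  "deviation K k M N = (if k = 0 then (real M - real K * H)\<^sup>2 else (real M + harm N + (real k - 1) * H - real K * H)\<^sup>2
     + harm N + (real k - 1) * H)"

text \<open>With \<open>K \<ge> 100 * H / \<epsilon>\<^sup>2\<close> walks the second phase starts
  at \<open>16 * H / (K * \<epsilon>\<^sup>2)\<close>, for which 1/6 is set aside. With fewer walks
  it counts as failed; then \<open>M\<close> has missed \<open>40 * H\<close> by
  \<open>20 * H\<close>, which explains the first denominator.\<close>

definition deviation_potential :: "nat \<Rightarrow> bool \<Rightarrow> nat \<Rightarrow> nat \<Rightarrow> nat \<Rightarrow> nat \<Rightarrow> real" where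
  "deviation_potential t ph K k M N =
     (if \<not> ph then 1 / 6 + deviation 40 k M N / (20 * H)\<^sup>2
      else if 100 * H \<le> real K * \<epsilon>\<^sup>2 then deviation K k M N / (\<epsilon> / 4 * real K)\<^sup>2 else 1)"

text \<open>The rate of exponential growth of the potential per sample.  In the first phase every sampled
  element also creates about \<open>5 / \<epsilon>\<^sup>2\<close> walks of the second phase, which the record rate accounts for.\<close>

definition tail_rate :: real where "tail_rate = \<epsilon>\<^sup>2 / (841 * (1 + H)\<^sup>2)"

definition tail_record_rate :: real where "tail_record_rate = 5 / (841 * (1 + H))"

text \<open>With this rate, \<open>sum_exp_harm\<close> pays exactly for one sampled element of the
  first phase: the time factor \<open>1 + tail_rate\<close> and the increase of
  \<open>M\<close>.\<close>

definition tail_phase1_rate :: real where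
  "tail_phase1_rate = (1 + tail_rate) * exp tail_record_rate - 1"

text \<open>A walk to come costs \<open>1 + H\<close> samples on average, one of them for its end.
  The summand \<open>tail_rate * (1 + H)\<close> of the first phase pays for rounding up the number
  of walks.\<close>

definition tail_potential :: "nat \<Rightarrow> bool \<Rightarrow> nat \<Rightarrow> nat \<Rightarrow> nat \<Rightarrow> nat \<Rightarrow> real" where
  "tail_potential t ph K k M N = (1 + tail_rate) ^ t *
     exp (if ph then tail_rate * (harm N + 1 + (real k - 1) * (1 + H))
          else tail_record_rate * real M + tail_rate * (1 + H)
            + tail_phase1_rate * (harm N + 1 + (real k - 1) * (1 + H)))"

context
  assumes eps: "0 < \<epsilon>" "\<epsilon> \<le> 1" and H: "1 \<le> H"
begin

lemma deviation_record:
  "1 \<le> k \<Longrightarrow> (\<Sum>i<N. deviation K k (M + 1) i) \<le> real N * deviation K k M N"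
  using harm_quadratic_step[where N = N and y = "real M + (real k - 1) * H - real K * H" and v = "(real k - 1) * H"]
  by (simp add: deviation_def algebra_simps)

text \<open>The potential starts at the exponential of \<open>(1 + H)\<close> times
  \<open>tail_rate + 40 * tail_phase1_rate\<close>, which is at most (1 + 40 * 21) / 841 = 1; hence
  841. The 21 is 1 + 4 * 5, with 5 from the number of walks in the second phase.\<close>

lemma rates: "0 < tail_rate" "tail_rate \<le> 1" "0 \<le> tail_record_rate" "tail_rate \<le> tail_phase1_rate"
  "tail_rate * (1 + H) \<le> 1 / 841" "tail_phase1_rate * (1 + H) \<le> 21 / 841"
  "tail_rate * (1 + H) * 5 / \<epsilon>\<^sup>2 = tail_record_rate"
proof -
  have e2: "0 < \<epsilon>\<^sup>2" "\<epsilon>\<^sup>2 \<le> 1" using eps by (auto simp: power_le_one)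
  have h2: "1 \<le> (1 + H)" "1 \<le> (1 + H)\<^sup>2" using H by (auto simp: one_le_power)
  show 1: "0 < tail_rate" using e2 H by (simp add: tail_rate_def)
  show 5: "tail_rate * (1 + H) \<le> 1 / 841"
  proof -
    have "tail_rate * (1 + H) = \<epsilon>\<^sup>2 / (841 * (1 + H))"
      using H by (simp add: tail_rate_def power2_eq_square)
    also have "\<dots> \<le> 1 / (841 * 1)" using e2 h2 by (intro frac_le) auto
    finally show ?thesis by simp
  qed
  have "tail_rate * 1 \<le> tail_rate * (1 + H)" using 1 h2 by (intro mult_left_mono) auto
  with 5 show 2: "tail_rate \<le> 1" by simp
  show 3: "0 \<le> tail_record_rate" using H by (simp add: tail_record_rate_def)
  show 4: "tail_rate \<le> tail_phase1_rate"
  proof -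
    have "(1 + tail_rate) * 1 \<le> (1 + tail_rate) * exp tail_record_rate"
      using 1 3 by (intro mult_left_mono) auto
    then show ?thesis by (simp add: tail_phase1_rate_def)
  qed
  have r: "tail_record_rate * (1 + H) = 5 / 841"
    using H by (simp add: tail_record_rate_def divide_eq_eq)
  have "tail_record_rate * 1 \<le> tail_record_rate * (1 + H)" using 3 h2 by (intro mult_left_mono) auto
  then have "exp tail_record_rate \<le> 1 + 2 * tail_record_rate"
    using 3 r by (intro exp_le_one_plus_double) auto
  then have "(1 + tail_rate) * exp tail_record_rate \<le> (1 + tail_rate) * (1 + 2 * tail_record_rate)"
    using 1 by (intro mult_left_mono) auto
  also have "\<dots> \<le> 1 + tail_rate + 4 * tail_record_rate"
    using mult_right_mono[OF 2 3] by (simp add: algebra_simps)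
  finally have "tail_phase1_rate \<le> tail_rate + 4 * tail_record_rate"
    by (simp add: tail_phase1_rate_def)
  then have "tail_phase1_rate * (1 + H) \<le> (tail_rate + 4 * tail_record_rate) * (1 + H)"
    using h2 by (intro mult_right_mono) auto
  then show "tail_phase1_rate * (1 + H) \<le> 21 / 841" using 5 r by (simp add: distrib_right)
  show "tail_rate * (1 + H) * 5 / \<epsilon>\<^sup>2 = tail_record_rate"
    using e2 H eps by (simp add: tail_rate_def tail_record_rate_def power2_eq_square)
qed

text \<open>A new walk within a phase leaves the deviation unchanged: the mean \<open>H\<close> of
  the walk moves from the pending ones into \<open>harm N\<close>.\<close>

lemma deviation_supermartingale:
  assumes "1 \<le> n" "harm (rank_in S n) = H"
  shows "machine_supermartingale 0 (walk_start n) (walk_ask n) (walk_step \<epsilon> n) walk_stop S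
      (walk_inv n) (lift_potential S deviation_potential)"
proof (rule walk_supermartingale)
  fix t ph and K k M N :: nat
  have "0 \<le> deviation K k M N" for K k M N
    using H by (cases k) (auto simp: deviation_def intro!: add_nonneg_nonneg harm_nonneg)
  then show "0 \<le> deviation_potential t ph K k M N"
    by (simp add: deviation_potential_def)
next
  fix t ph and K k M N :: nat
  assume 1: "1 \<le> k" "\<not> ph \<longrightarrow> K = 40" "0 < N"
  have D: "(\<Sum>i<N. deviation K k (M + 1) i / c) \<le> real N * (deviation K k M N / c)" if "0 \<le> c" for c
    using divide_right_mono[OF deviation_record[OF 1(1), of K M N] that] by (simp add: sum_divide_distrib)
  show "(\<Sum>i<N. deviation_potential (Suc t) ph K k (M + 1) i) \<le> real N * deviation_potential t ph K k M N"
    using 1 D[of "(20 * H)\<^sup>2"] D[of "(\<epsilon> / 4 * real K)\<^sup>2"]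
    unfolding deviation_potential_def by (cases ph) (simp_all add: sum.distrib distrib_left)
next
  fix t ph and K k M :: nat
  assume 1: "1 \<le> k" "\<not> ph \<longrightarrow> K = 40 \<and> 2 \<le> k"
  have "deviation K (k - 1) M (rank_in S n) = deviation K k M 0"
    using 1(1) assms(2)
    by (cases "k = 1") (auto simp: deviation_def of_nat_diff algebra_simps harm_expand)
  then show "deviation_potential (Suc t) ph K (k - 1) M (rank_in S n) \<le> deviation_potential t ph K k M 0"
    using 1 by (cases ph) (simp_all add: deviation_potential_def)
next
  fix t and M K' :: nat
  assume K': "K' = nat \<lceil>5 * real M / \<epsilon>\<^sup>2\<rceil>"
  have e2: "0 < \<epsilon>\<^sup>2" using eps by simp
  have F: "deviation_potential t False 40 1 M 0 = 1 / 6 + (real M - 40 * H)\<^sup>2 / (20 * H)\<^sup>2"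
    by (simp add: deviation_potential_def deviation_def harm_expand)
  show "deviation_potential (Suc t) True K' K' 0 (rank_in S n) \<le> deviation_potential t False 40 1 M 0"
  proof (cases "100 * H \<le> real K' * \<epsilon>\<^sup>2")
    case True
    then have K0: "0 < K'" using H by (intro Nat.gr0I) auto
    have "deviation K' K' 0 (rank_in S n) = real K' * H"
      using K0 assms(2) by (simp add: deviation_def algebra_simps)
    then have "deviation_potential (Suc t) True K' K' 0 (rank_in S n) = 16 * H / (real K' * \<epsilon>\<^sup>2)"
      using True K0 by (simp add: deviation_potential_def power2_eq_square ac_simps)
    also have "\<dots> \<le> 1 / 6"
      using True K0 e2 H by (simp add: divide_le_eq)
    also have "\<dots> \<le> deviation_potential t False 40 1 M 0" unfolding F by simp
    finally show ?thesis .
  next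
    \<comment> \<open>Too few walks mean \<open>5 * M < 100 * H\<close>, so \<open>M\<close> is
      below half of its mean \<open>40 * H\<close>.\<close>
    case False
    have "5 * real M / \<epsilon>\<^sup>2 \<le> real K'" unfolding K' by (rule real_nat_ceiling_ge)
    then have "5 * real M \<le> real K' * \<epsilon>\<^sup>2" using e2 by (simp add: field_simps)
    then have "20 * H \<le> \<bar>real M - 40 * H\<bar>" using False by linarith
    then have "(20 * H)\<^sup>2 \<le> (real M - 40 * H)\<^sup>2" using H by (subst abs_le_square_iff[symmetric]) simp
    then have "1 \<le> (real M - 40 * H)\<^sup>2 / (20 * H)\<^sup>2" using H by (simp add: le_divide_eq)
    then show ?thesis unfolding F using False by (simp add: deviation_potential_def)
  qed
qed fact

lemma tail_step:
  assumes "tail_rate + x \<le> y"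
  shows "(1 + tail_rate) ^ Suc t * exp x \<le> (1 + tail_rate) ^ t * exp y"
proof -
  have "(1 + tail_rate) * exp x \<le> exp tail_rate * exp x"
    by (intro mult_right_mono exp_ge_add_one_self) auto
  also have "\<dots> \<le> exp y" using assms by (simp add: exp_add[symmetric])
  finally show ?thesis using rates by (simp add: mult_left_mono ac_simps)
qed

lemma tail_supermartingale:
  assumes "1 \<le> n" "harm (rank_in S n) = H"
  shows "machine_supermartingale 0 (walk_start n) (walk_ask n) (walk_step \<epsilon> n) walk_stop S
      (walk_inv n) (lift_potential S tail_potential)"
proof (rule walk_supermartingale)
  fix t ph and K k M N :: nat
  show "0 \<le> tail_potential t ph K k M N"
    using rates by (simp add: tail_potential_def)
next
  fix t ph and K k M N :: nat
  assume "1 \<le> k" "0 < N"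
  show "(\<Sum>i<N. tail_potential (Suc t) ph K k (M + 1) i) \<le> real N * tail_potential t ph K k M N"
  proof (cases ph)
    case True
    define c where "c = (1 + tail_rate) ^ t * exp (tail_rate * (1 + (real k - 1) * (1 + H)))"
    have "(\<Sum>i<N. tail_potential (Suc t) ph K k (M + 1) i)
       = c * ((1 + tail_rate) * (\<Sum>i<N. exp (tail_rate * harm i)))"
      using True by (simp add: tail_potential_def c_def sum_distrib_left exp_add[symmetric] algebra_simps)
    also have "\<dots> \<le> c * (real N * exp (tail_rate * harm N))"
      using rates by (intro mult_left_mono sum_exp_harm) (auto simp: c_def)
    also have "\<dots> = real N * tail_potential t ph K k M N"
      using True by (simp add: tail_potential_def c_def exp_add[symmetric] algebra_simps)
    finally show ?thesis .
  next
    case False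
    define X where "X = tail_record_rate * real M + tail_rate * (1 + H)
       + tail_phase1_rate * (1 + (real k - 1) * (1 + H))"
    define c where "c = (1 + tail_rate) ^ t * exp X"
    have "tail_potential (Suc t) ph K k (M + 1) i
       = c * ((1 + tail_phase1_rate) * exp (tail_phase1_rate * harm i))" for i
    proof -
      have "tail_record_rate * real (M + 1) + tail_rate * (1 + H) + tail_phase1_rate * (harm i + 1 + (real k - 1) * (1 + H))
        = X + tail_record_rate + tail_phase1_rate * harm i"
        by (simp add: X_def algebra_simps)
      then show ?thesis
        using False by (simp add: tail_potential_def tail_phase1_rate_def c_def exp_add)
    qed
    then have "(\<Sum>i<N. tail_potential (Suc t) ph K k (M + 1) i)
       = c * ((1 + tail_phase1_rate) * (\<Sum>i<N. exp (tail_phase1_rate * harm i)))"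
      by (simp add: sum_distrib_left)
    also have "\<dots> \<le> c * (real N * exp (tail_phase1_rate * harm N))"
      using rates by (intro mult_left_mono sum_exp_harm) (auto simp: c_def)
    also have "\<dots> = real N * tail_potential t ph K k M N"
      using False by (simp add: tail_potential_def c_def X_def exp_add[symmetric] algebra_simps)
    finally show ?thesis .
  qed
next
  fix t ph and K k M :: nat
  assume k: "1 \<le> k"
  show "tail_potential (Suc t) ph K (k - 1) M (rank_in S n) \<le> tail_potential t ph K k M 0"
    unfolding tail_potential_def
  proof (rule tail_step)
    show "tail_rate + (if ph then tail_rate * (harm (rank_in S n) + 1 + (real (k - 1) - 1) * (1 + H))
        else tail_record_rate * real M + tail_rate * (1 + H) +
             tail_phase1_rate * (harm (rank_in S n) + 1 + (real (k - 1) - 1) * (1 + H)))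
      \<le> (if ph then tail_rate * (harm 0 + 1 + (real k - 1) * (1 + H))
        else tail_record_rate * real M + tail_rate * (1 + H) +
             tail_phase1_rate * (harm 0 + 1 + (real k - 1) * (1 + H)))"
      using k rates(4) by (simp add: assms(2) of_nat_diff algebra_simps harm_expand)
  qed
next
  fix t and M K' :: nat
  assume K': "K' = nat \<lceil>5 * real M / \<epsilon>\<^sup>2\<rceil>"
  have "real K' \<le> 5 * real M / \<epsilon>\<^sup>2 + 1"
    unfolding K' using of_int_ceiling_le_add_one[of "5 * real M / \<epsilon>\<^sup>2"] by simp
  then have "tail_rate * (1 + H) * real K' \<le> tail_rate * (1 + H) * (5 * real M / \<epsilon>\<^sup>2 + 1)"
    using rates(1) H by (intro mult_left_mono) auto
  also have "\<dots> = tail_rate * (1 + H) * 5 / \<epsilon>\<^sup>2 * real M + tail_rate * (1 + H)"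
    by (simp add: algebra_simps)
  finally have le: "tail_rate * (1 + H) * real K' \<le> tail_record_rate * real M + tail_rate * (1 + H)"
    unfolding rates(7) .
  show "tail_potential (Suc t) True K' K' 0 (rank_in S n) \<le> tail_potential t False 40 1 M 0"
    unfolding tail_potential_def if_True
  proof (rule tail_step)
    show "tail_rate + tail_rate * (harm (rank_in S n) + 1 + (real K' - 1) * (1 + H))
      \<le> (if False then tail_rate * (harm 0 + 1 + (real 1 - 1) * (1 + H))
        else tail_record_rate * real M + tail_rate * (1 + H) +
             tail_phase1_rate * (harm 0 + 1 + (real 1 - 1) * (1 + H)))"
      using le rates(4) by (simp add: harm_expand assms(2) algebra_simps)
  qed
qed fact

end
end

section \<open>Guarantees of the adaptive algorithm\<close>

lemma walk_properties_nonempty: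
  assumes n: "1 \<le> n" and eps: "0 < \<epsilon>" "\<epsilon> \<le> 1" and S: "S \<subseteq> {1..n}" "S \<noteq> {}"
  defines "A \<equiv> machine.machine_algo 0 (walk_start n) (walk_ask n) (walk_step \<epsilon> n) walk_stop (walk_out \<epsilon>)"
  shows "uses_samples A S (30276 * adaptive_bound (card S) \<epsilon>)"
    and "2 / 3 \<le> prob_output A S
      (\<lambda>x. 1 / (1 + \<epsilon>) * real (card S) \<le> x \<and> x \<le> (1 + \<epsilon>) * real (card S))"
proof -
  define w where "w = card S"
  define H :: real where "H = harm w"
  have fin: "finite S" using S(1) finite_subset by auto
  then have w: "1 \<le> w" using S(2) by (simp add: w_def Suc_le_eq card_gt_0_iff)
  have rk: "rank_in S n = w" using S(1) by (simp add: rank_in_def w_def Int_absorb2)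
  have H: "1 \<le> H" using harm_mono[OF w, where 'a = real] by (simp add: H_def harm_expand)
  let ?tr = "tail_rate \<epsilon> H"
  note rates = rates[OF eps H]
  \<comment> \<open>The tail is at most \<open>exp (1 - m * tail_rate / 2)\<close>; from
    \<open>m = 4 / tail_rate\<close> on, half of the exponent absorbs the 1.\<close>
  define b where "b = 4 / ?tr"
  have b0: "0 < b" using rates(1) by (simp add: b_def)
  interpret T: machine_supermartingale 0 "walk_start n" "walk_ask n" "walk_step \<epsilon> n" walk_stop "walk_out \<epsilon>"
    S "walk_inv n" "lift_potential S (tail_potential \<epsilon> H)"
    by (rule tail_supermartingale[OF eps H n]) (simp add: rk H_def)
  have uses_b: "uses_samples A S b"
    unfolding uses_samples_def
  proof (intro allI impI)
    fix m :: nat assume m: "b \<le> real m"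
    have "(1 + ?tr) ^ m * prob_more_samples A S m \<le> lift_potential S (tail_potential \<epsilon> H) 0 (walk_start n)"
      unfolding A_def
    proof (rule T.prob_more_samples_bound)
      fix s assume s: "walk_inv n m s" "\<not> walk_stop s"
      obtain ph K k M e where [simp]: "s = (ph, K, k, M, e)" by (cases s)
      have "1 \<le> k" using s by auto
      then have "0 \<le> harm (rank_in S e) + 1 + (real k - 1) * (1 + H)"
        using H by (auto intro!: add_nonneg_nonneg harm_nonneg)
      then show "(1 + ?tr) ^ m \<le> lift_potential S (tail_potential \<epsilon> H) m s"
        using rates(1-4) H by (auto simp: tail_potential_def)
    qed (use rates(1) in auto)
    also have "\<dots> = exp (?tr * (1 + H) + 40 * (tail_phase1_rate \<epsilon> H * (1 + H)))"
      by (simp add: tail_potential_def rk H_def algebra_simps)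
    also have "\<dots> \<le> exp 1" using rates(5,6) by simp
    finally have 1: "(1 + ?tr) ^ m * prob_more_samples A S m \<le> exp 1" .
    have "exp (?tr / 2) \<le> 1 + ?tr"
      using exp_le_one_plus_double[of "?tr / 2"] rates(1,2) by simp
    then have "exp (?tr / 2) ^ m \<le> (1 + ?tr) ^ m" by (intro power_mono) auto
    then have "exp (real m * (?tr / 2)) \<le> (1 + ?tr) ^ m" by (simp only: exp_of_nat_mult)
    moreover have p0: "0 \<le> prob_more_samples A S m"
      unfolding prob_more_samples_def by (rule integral_nonneg_AE) simp
    ultimately have "exp (real m * (?tr / 2)) * prob_more_samples A S m \<le> exp 1"
      using 1 mult_right_mono by (metis order_trans)
    then have "prob_more_samples A S m \<le> exp 1 / exp (real m * (?tr / 2))"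
      by (simp add: field_simps)
    also have "\<dots> = exp (1 - real m * (?tr / 2))" by (simp add: exp_diff)
    also have "\<dots> \<le> exp (- (real m / b))"
    proof -
      have "1 \<le> real m * (?tr / 4)" using m rates(1) by (simp add: b_def field_simps)
      then show ?thesis by (simp add: b_def field_simps)
    qed
    finally show "prob_more_samples A S m \<le> exp (- (real m / b))" .
  qed
  show "uses_samples A S (30276 * adaptive_bound (card S) \<epsilon>)"
  proof (rule uses_samples_mono[OF uses_b b0])
    define l where "l = log 2 (max 2 (real w))"
    have l: "1 \<le> l" by (simp add: l_def le_log_iff)
    \<comment> \<open>\<open>1 + H \<le> 3 * l\<close> gives 30276 = 4 * 841 * 9; the square of the
      logarithm is then widened to the fourth power.\<close>
    have "H \<le> 2 * l" unfolding H_def l_def by (rule harm_le_log) fact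
    then have "(1 + H)\<^sup>2 \<le> (3 * l)\<^sup>2" using l H by (intro power_mono) auto
    also have "\<dots> = 9 * (l\<^sup>2 * 1)" by (simp add: power2_eq_square)
    also have "\<dots> \<le> 9 * (l\<^sup>2 * l\<^sup>2)" using l by (intro mult_left_mono) (auto simp: one_le_power)
    also have "\<dots> = 9 * l ^ 4" by (simp add: power2_eq_square power4_eq_xxxx)
    finally have "3364 * (1 + H)\<^sup>2 / \<epsilon>\<^sup>2 \<le> 3364 * (9 * l ^ 4) / \<epsilon>\<^sup>2"
      by (intro divide_right_mono mult_left_mono) auto
    then show "b \<le> 30276 * adaptive_bound (card S) \<epsilon>"
      by (simp add: b_def tail_rate_def adaptive_bound_def l_def w_def)
  qed
  interpret V: machine_supermartingale 0 "walk_start n" "walk_ask n" "walk_step \<epsilon> n" walk_stop "walk_out \<epsilon>"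
    S "walk_inv n" "lift_potential S (deviation_potential \<epsilon> H)"
    by (rule deviation_supermartingale[OF eps H n]) (simp add: rk H_def)
  let ?P = "\<lambda>x. 1 / (1 + \<epsilon>) * real (card S) \<le> x \<and> x \<le> (1 + \<epsilon>) * real (card S)"
  show "2 / 3 \<le> prob_output A S ?P"
  proof (rule uses_samples_limit[OF uses_b b0])
    fix j
    have "1 - lift_potential S (deviation_potential \<epsilon> H) 0 (walk_start n) - prob_more_samples A S j
       \<le> prob_output A S ?P"
      unfolding A_def
    proof (rule V.prob_output_bound)
      fix t s assume s: "walk_inv n t s" "walk_stop s" "\<not> ?P (walk_out \<epsilon> s)"
      obtain ph K k M e where seq: "s = (ph, K, k, M, e)" by (cases s)
      have st: "ph" "k = 0" using s(2) by (auto simp: seq)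
      have far: "\<epsilon> / 4 \<le> \<bar>H - real M / real K\<bar>"
      proof (rule ccontr)
        assume "\<not> ?thesis"
        then have ex: "\<bar>harm w - real M / real K\<bar> < \<epsilon> / 4" by (simp add: H_def)
        define v where "v = (SOME v. \<bar>harm v - real M / real K\<bar> < \<epsilon> / 4)"
        have "\<bar>harm v - real M / real K\<bar> < \<epsilon> / 4" unfolding v_def by (rule someI, rule ex)
        with ex have "\<bar>harm v - (harm w :: real)\<bar> < \<epsilon> / 2" by linarith
        from harm_close_imp_ratio[OF eps _ this] have "?P (real v)" using w by (simp add: w_def)
        moreover have "walk_out \<epsilon> s = real v" by (simp only: seq v_def walk_out.simps)
        ultimately show False using s(3) by simp
      qed
      show "1 \<le> lift_potential S (deviation_potential \<epsilon> H) t s"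
      proof (cases "100 * H \<le> real K * \<epsilon>\<^sup>2")
        case True
        then have K: "0 < K" using H by (intro Nat.gr0I) auto
        have "(\<epsilon> / 4 * real K) \<le> \<bar>H - real M / real K\<bar> * real K"
          using far by (intro mult_right_mono) auto
        also have "\<dots> = \<bar>real M - real K * H\<bar>"
        proof -
          have "(H - real M / real K) * real K = - (real M - real K * H)"
            using K by (simp add: field_simps)
          then show ?thesis by (metis abs_minus_cancel abs_mult abs_of_nat)
        qed
        finally have "(\<epsilon> / 4 * real K)\<^sup>2 \<le> (real M - real K * H)\<^sup>2"
          using eps by (subst abs_le_square_iff[symmetric]) simp
        then show ?thesis using True K st eps
          by (simp add: seq deviation_potential_def deviation_def le_divide_eq)
      next
        case False
        then show ?thesis using st by (simp add: seq deviation_potential_def)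
      qed
    qed
    moreover have "lift_potential S (deviation_potential \<epsilon> H) 0 (walk_start n) \<le> 1 / 3"
    proof -
      \<comment> \<open>Forty walks of variance at most \<open>H\<close> each, against the squared
        tolerance \<open>(20 * H)\<^sup>2\<close>.\<close>
      have "lift_potential S (deviation_potential \<epsilon> H) 0 (walk_start n) = 1 / 6 + 40 * H / (20 * H)\<^sup>2"
        using rk by (simp add: deviation_potential_def deviation_def H_def)
      also have "40 * H / (20 * H)\<^sup>2 = 1 / (10 * H)" using H by (simp add: power2_eq_square)
      also have "\<dots> \<le> 1 / 10" using H by simp
      finally show ?thesis by simp
    qed
    ultimately show "2 / 3 - prob_more_samples A S j \<le> prob_output A S ?P" by linarith
  qed
qed

text \<open>Each of the forty preliminary walks ends with its first sample; then
  \<open>M = 0\<close> leads to a second phase without walks, and the machine stops.\<close>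

lemma walk_properties_empty:
  assumes n: "1 \<le> n" and eps: "0 < \<epsilon>" "\<epsilon> \<le> 1"
  defines "A \<equiv> machine.machine_algo 0 (walk_start n) (walk_ask n) (walk_step \<epsilon> n) walk_stop (walk_out \<epsilon>)"
  shows "uses_samples A {} (30276 * adaptive_bound 0 \<epsilon>)"
    and "2 / 3 \<le> prob_output A {} (\<lambda>x. x = 0)"
proof -
  define inv :: "nat \<Rightarrow> walk \<Rightarrow> bool" where
    "inv = (\<lambda>t (ph, K, k, M, e). M = 0 \<and> (if ph then K = 0 \<and> k = 0 else t + k = 40 \<and> 1 \<le> k))"
  interpret machine_supermartingale 0 "walk_start n" "walk_ask n" "walk_step \<epsilon> n" walk_stop "walk_out \<epsilon>"
    "{}" inv "\<lambda>_ _. 0"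
  proof
    fix t and s :: walk and x :: nat and a
    assume *: "inv t s" "\<not> walk_stop s" and a: "a \<in> set_pmf (interval_sample {} (walk_ask n t s x))"
    then have "a = None" by (simp add: set_pmf_interval_sample)
    then show "inv (Suc t) (walk_step \<epsilon> n t s x a)"
      using * by (cases s) (auto simp: inv_def)
  qed (auto simp: inv_def)
  let ?b = "30276 * adaptive_bound 0 \<epsilon>"
  have e2: "\<epsilon>\<^sup>2 \<le> 1" "0 < \<epsilon>\<^sup>2" using eps by (auto simp: power_le_one)
  have b: "40 \<le> ?b" using e2 by (simp add: adaptive_bound_def le_divide_eq)
  show uses: "uses_samples A {} ?b"
    unfolding uses_samples_def
  proof (intro allI impI)
    fix m :: nat assume "?b \<le> real m"
    then have "40 \<le> m" using b by linarith
    then have "1 * prob_more_samples A {} m \<le> 0"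
      unfolding A_def by (intro prob_more_samples_bound) (auto simp: inv_def split: if_splits)
    then show "prob_more_samples A {} m \<le> exp (- (real m / ?b))"
      by (simp add: order_trans[OF _ exp_ge_zero])
  qed
  show "2 / 3 \<le> prob_output A {} (\<lambda>x. x = 0)"
  proof (rule uses_samples_limit[OF uses])
    fix j
    have "1 - 0 - prob_more_samples A {} j \<le> prob_output A {} (\<lambda>x. x = 0)"
      unfolding A_def
    proof (rule prob_output_bound)
      fix t s assume s: "inv t s" "walk_stop s" "walk_out \<epsilon> s \<noteq> 0"
      \<comment> \<open>Here \<open>M / K\<close> is \<open>0 / 0 = 0\<close>, and only
        \<open>v = 0\<close> has a harmonic number below \<open>\<epsilon> / 4\<close>.\<close>
      have "(SOME v. \<bar>harm v - 0\<bar> < \<epsilon> / 4) = 0"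
      proof (rule some_equality)
        fix v assume v: "\<bar>harm v - 0\<bar> < \<epsilon> / 4"
        show "v = 0"
        proof (rule ccontr)
          assume "v \<noteq> 0"
          then have "harm 1 \<le> (harm v :: real)" by (intro harm_mono) auto
          then show False using v eps by (simp add: harm_expand)
        qed
      qed (use eps in \<open>simp add: harm_expand\<close>)
      then have False using s by (cases s) (auto simp: inv_def)
      then show "1 \<le> (0 :: real)" ..
    qed
    then show "2 / 3 - prob_more_samples A {} j \<le> prob_output A {} (\<lambda>x. x = 0)" by simp
  qed (use b in simp)
qed

theorem adaptive_algorithm:
  assumes "1 \<le> n" "0 < \<epsilon>" "\<epsilon> \<le> 1"
  shows "\<exists>A. size_approximation n \<epsilon> A \<and>
    (\<forall>S\<subseteq>{1..n}. uses_samples A S (30276 * adaptive_bound (card S) \<epsilon>))"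
proof -
  define A where "A = machine.machine_algo 0 (walk_start n) (walk_ask n) (walk_step \<epsilon> n) walk_stop (walk_out \<epsilon>)"
  have "interval_algorithm n A"
    unfolding A_def using assms(1)
    by (intro machine.machine_interval_algorithm) (auto simp: split_paired_all)
  moreover have "uses_samples A S (30276 * adaptive_bound (card S) \<epsilon>)"
    "2 / 3 \<le> prob_output A S (\<lambda>x. 1 / (1 + \<epsilon>) * real (card S) \<le> x \<and> x \<le> (1 + \<epsilon>) * real (card S))"
    if "S \<subseteq> {1..n}" for S
  proof -
    have "(\<lambda>x::real. 0 \<le> x \<and> x \<le> 0) = (\<lambda>x. x = 0)" by auto
    then show "uses_samples A S (30276 * adaptive_bound (card S) \<epsilon>)"
      "2 / 3 \<le> prob_output A S (\<lambda>x. 1 / (1 + \<epsilon>) * real (card S) \<le> x \<and> x \<le> (1 + \<epsilon>) * real (card S))"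
      using walk_properties_nonempty[OF assms that] walk_properties_empty[OF assms]
      by (cases "S = {}"; simp add: A_def)+
  qed
  ultimately show ?thesis unfolding size_approximation_def by blast
qed

theorem theorem3:
  shows
    "(\<forall>\<epsilon>::real. 0 < \<epsilon> \<and> \<epsilon> \<le> 1 \<longrightarrow>
       (\<exists>c>0. \<forall>n w A. 1 \<le> w \<and> w \<le> n \<and> size_approximation n \<epsilon> A \<and> nonadaptive A \<longrightarrow>
          (\<exists>S\<subseteq>{1..n}. card S = w \<and>
             (\<forall>m::nat. real m \<le> c * min (real n / real w) (sqrt (real w)) \<longrightarrow>
                prob_more_samples A S m \<ge> 1/4)))) \<and>
     (\<exists>C>0. \<forall>n\<ge>1. \<forall>\<epsilon>::real. 0 < \<epsilon> \<and> \<epsilon> \<le> 1 \<longrightarrow>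
       (\<exists>A. size_approximation n \<epsilon> A \<and> nonadaptive A \<and>
          (\<forall>S\<subseteq>{1..n}. uses_samples A S (C * nonadaptive_bound n (card S) \<epsilon>)))) \<and>
     (\<exists>C>0. \<exists>d::nat. \<forall>n\<ge>1. \<forall>\<epsilon>::real. 0 < \<epsilon> \<and> \<epsilon> \<le> 1 \<longrightarrow>
       (\<exists>A. size_approximation n \<epsilon> A \<and>
          (\<forall>S\<subseteq>{1..n}. uses_samples A S
             (C * adaptive_bound (card S) \<epsilon> * (1 + ln (adaptive_bound (card S) \<epsilon>)) ^ d))))"
proof (intro conjI)
  show "\<forall>\<epsilon>::real. 0 < \<epsilon> \<and> \<epsilon> \<le> 1 \<longrightarrow>
       (\<exists>c>0. \<forall>n w A. 1 \<le> w \<and> w \<le> n \<and> size_approximation n \<epsilon> A \<and> nonadaptive A \<longrightarrow>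
          (\<exists>S\<subseteq>{1..n}. card S = w \<and>
             (\<forall>m::nat. real m \<le> c * min (real n / real w) (sqrt (real w)) \<longrightarrow>
                prob_more_samples A S m \<ge> 1/4)))"
    by (intro allI impI exI[where x = "1 / 1000"] conjI nonadaptive_lower_bound) auto
  show "\<exists>C>0. \<forall>n\<ge>1. \<forall>\<epsilon>::real. 0 < \<epsilon> \<and> \<epsilon> \<le> 1 \<longrightarrow>
       (\<exists>A. size_approximation n \<epsilon> A \<and> nonadaptive A \<and>
          (\<forall>S\<subseteq>{1..n}. uses_samples A S (C * nonadaptive_bound n (card S) \<epsilon>)))"
    by (intro exI[where x = 800] conjI allI impI nonadaptive_algorithm) auto
  show "\<exists>C>0. \<exists>d::nat. \<forall>n\<ge>1. \<forall>\<epsilon>::real. 0 < \<epsilon> \<and> \<epsilon> \<le> 1 \<longrightarrow>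
       (\<exists>A. size_approximation n \<epsilon> A \<and>
          (\<forall>S\<subseteq>{1..n}. uses_samples A S
             (C * adaptive_bound (card S) \<epsilon> * (1 + ln (adaptive_bound (card S) \<epsilon>)) ^ d)))"
    \<comment> \<open>With exponent 0 the logarithmic factor is 1.\<close>
    using adaptive_algorithm
    by (intro exI[where x = 30276] exI[where x = "0::nat"] conjI) auto
qed

end
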